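(* For fixed $t\in\mathbb{R}$, let $h_n(t)=\int_{-\infty}^{\infty}P_n^2(x;t)w(x;t)\,dx$ be the square of the $L^2$-norm of the monic orthogonal polynomial $P_n(x;t)$ of degree $n$ with respect to the weight $w(x;t)=\mathrm{e}^{-x^6+tx^2}$ on $\mathbb{R}$. Then, as $n\to\infty$, \begin{align*} \ln h_n(t)=&\ \frac{n\ln n}{3}-\frac{1}{3}(1+\ln 60)n+\frac{2\,n^{1/3}t}{\sqrt[3]{60}}+\frac{\ln n}{6}+\ln(2\pi)-\frac{\ln 60}{6}+\frac{t^2}{3\sqrt[3]{450}\,n^{1/3}}\\ &+\frac{t}{3\sqrt[3]{60}\,n^{2/3}}-\frac{1}{36n}-\frac{t^2}{18\sqrt[3]{450}\,n^{4/3}}-\frac{t^4}{1215\sqrt[3]{60}\,n^{5/3}}+O(n^{-2}). \end{align*}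
   Context: For $t\in\mathbb{R}$, $P_n(x;t)$, $n=0,1,2,\ldots$, are the monic polynomials of degree $n$ satisfying $\int_{-\infty}^{\infty}P_j(x;t)P_k(x;t)w(x;t)\,dx=h_j(t)\delta_{jk}$ with $w(x;t)=\mathrm{e}^{-x^6+tx^2}$. The implied constant in the $O$-term may depend on $t$. *)

theory Defs
  imports
    "HOL-Analysis.Analysis"
    "HOL-Computational_Algebra.Polynomial"
    "HOL-Library.Landau_Symbols"
begin

definition weight :: "real \<Rightarrow> real \<Rightarrow> real" where
  "weight t x = exp (- (x ^ 6) + t * x\<^sup>2)"

text \<open>
  A polynomial times the weight is Lebesgue integrable on the whole line, so the Bochner
  integrals below never take the default value 0 of a non-integrable function.
\<close>

definition sq_norm :: "real \<Rightarrow> real poly \<Rightarrow> real" where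
  "sq_norm t p = (\<integral>x. (poly p x)\<^sup>2 * weight t x \<partial>lborel)"

text \<open>
  The diagonal case of the orthogonality relation only names the number \<open>h\<^sub>j(t)\<close>, so the
  relation is stated with \<open>h\<^sub>j(t)\<close> already replaced by \<open>sq_norm t (P j)\<close>.
\<close>

definition monic_orthogonal_polys :: "real \<Rightarrow> (nat \<Rightarrow> real poly) \<Rightarrow> bool" where
  "monic_orthogonal_polys t P \<longleftrightarrow>
     (\<forall>n. degree (P n) = n \<and> lead_coeff (P n) = 1) \<and>
     (\<forall>j k. (\<integral>x. poly (P j) x * poly (P k) x * weight t x \<partial>lborel) =
             (if j = k then sq_norm t (P j) else 0))"

end

theory Submission
  imports Defs "HOL-Probability.Distributions" "HOL-Real_Asymp.Real_Asymp"
begin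

text \<open>
  Write \<open>b\<close> for the recurrence coefficients \<open>\<beta>\<^sub>n = h\<^sub>n / h\<^sub>n\<^sub>-\<^sub>1\<close>. They satisfy the string equation,
  a nonlinear difference equation whose slowly varying solutions are close to the root \<open>B\<close> of
  \<open>60 B\<^sup>3 - 2 t B = n\<close>. Freud's comparison of the upper and lower limit gives \<open>b / B \<rightarrow> 1\<close>, and
  since the linearised string equation is diagonally dominant, a formal solution with residual
  \<open>O(n\<^sup>-\<^sup>p)\<close> (relative to \<open>n\<close>) approximates \<open>b\<close> with relative error \<open>O(n\<^sup>-\<^sup>p)\<close>. Summing
  \<open>ln \<beta>\<^sub>n\<close> yields the expansion of \<open>ln h\<^sub>n\<close> up to an additive constant.

  The constant is found by deforming \<open>t\<close> to \<open>-\<infinity>\<close>. The estimates are uniform for \<open>t \<le> T\<close>, so the limit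
  of \<open>ln h\<^sub>n\<close> minus its leading part can be compared with the Gaussian weight, where it is given by
  Stirling's formula; by the Toda equation \<open>\<partial>\<^sub>t ln h\<^sub>n = \<beta>\<^sub>n + \<beta>\<^sub>n\<^sub>+\<^sub>1\<close> this limit does not depend on \<open>t\<close>.
\<close>

subsection \<open>The moment functional\<close>

text \<open>The string equation controls only ratios of the norms, so the constant ln(2 pi) is
  invisible to it. It has to be transported from a weight whose norms are known, which forces the
  estimates on the way to hold uniformly down to t = -infinity. This is why \<open>b\<close> is
  first compared with the exact root \<open>B\<close> and not with a series in n: for t -> -infinity
  and fixed n, \<open>B\<close> behaves like n / (2 |t|), the Gaussian value, whereas an expansion
  in powers of n^(-1/3) breaks down. The price is accuracy, as \<open>B\<close> solves the string
  equation only up to relative order n^-2. That still makes the remainder \<open>E\<close> converge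
  at a rate C / n uniform in t, so that the limits n -> infinity and t -> -infinity can be
  interchanged. The finer relative order n^-3 is required for fixed t only and comes from a formal
  solution. Evaluating \<open>G\<close> at n + 1/2 turns sums of ln \<open>B\<close> into midpoint
  sums.\<close>

lemma weight_pos [simp]: "weight t x > 0"
  by (simp add: weight_def)

lemma weight_minus [simp]: "weight t (- x) = weight t x"
  by (simp add: weight_def)

lemma weight_measurable [measurable]: "weight t \<in> borel_measurable borel"
  unfolding weight_def[abs_def] by measurable

text \<open>Makes the sextic beat any quadratic exponent: past z = 1 + |c| one has z^2 >= |c|, so
  the left side is not positive there.\<close>

lemma linear_minus_cube_le:
  fixes c z :: real
  assumes "0 \<le> z"
  shows "c * z - z ^ 3 \<le> \<bar>c\<bar> * (1 + \<bar>c\<bar>)"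
proof (cases "z \<le> 1 + \<bar>c\<bar>")
  case True
  have "c * z \<le> \<bar>c\<bar> * (1 + \<bar>c\<bar>)"
    using assms True by (intro mult_mono) auto
  moreover have "0 \<le> z ^ 3" using assms by simp
  ultimately show ?thesis by linarith
next
  case False
  then have z: "z \<ge> 1" "\<bar>c\<bar> \<le> z" by auto
  have "z * z \<ge> \<bar>c\<bar> * 1" using z by (intro mult_mono) auto
  then have "c \<le> z * z" by linarith
  then have "c * z \<le> z * z * z" using z by (intro mult_right_mono) auto
  moreover have "0 \<le> \<bar>c\<bar> * (1 + \<bar>c\<bar>)" by simp
  ultimately show ?thesis unfolding power3_eq_cube by linarith
qed

text \<open>The bound |x| <= exp (1 + x^2) moves the power into the exponent, where -(x^2)^3 absorbs
  all quadratic growth. One factor exp (-x^2) is kept back; it supplies both integrability and the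
  decay of boundary terms.\<close>

lemma power_weight_le:
  "\<bar>x\<bar> ^ k * weight t x \<le> exp (real k + \<bar>real k + t + 1\<bar> * (1 + \<bar>real k + t + 1\<bar>)) * exp (- x\<^sup>2)"
proof -
  have "\<bar>x\<bar> \<le> exp (1 + x\<^sup>2)"
  proof -
    have "0 \<le> (\<bar>x\<bar> - 1)\<^sup>2 + \<bar>x\<bar>" by simp
    then have "\<bar>x\<bar> \<le> 1 + x\<^sup>2" by (simp add: power2_eq_square algebra_simps)
    also have "\<dots> \<le> exp (1 + x\<^sup>2)" using exp_ge_add_one_self[of "1 + x\<^sup>2"] by simp
    finally show ?thesis .
  qed
  then have "\<bar>x\<bar> ^ k \<le> exp (1 + x\<^sup>2) ^ k" by (intro power_mono) auto
  also have "\<dots> = exp (real k * (1 + x\<^sup>2))" by (simp add: exp_of_nat_mult)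
  finally have "\<bar>x\<bar> ^ k * weight t x \<le> exp (real k * (1 + x\<^sup>2)) * weight t x"
    by (intro mult_right_mono) (auto simp: less_imp_le)
  also have "\<dots> = exp (real k + ((real k + t + 1) * x\<^sup>2 - (x\<^sup>2) ^ 3) - x\<^sup>2)"
    by (simp add: weight_def flip: exp_add power_mult) (simp add: algebra_simps)
  also have "\<dots> \<le> exp (real k + \<bar>real k + t + 1\<bar> * (1 + \<bar>real k + t + 1\<bar>) - x\<^sup>2)"
    using linear_minus_cube_le[of "x\<^sup>2" "real k + t + 1"] by simp
  finally show ?thesis by (simp flip: exp_add)
qed

lemma integrable_exp_minus_square: "integrable lborel (\<lambda>x::real. exp (- x\<^sup>2))"
proof -
  have "integrable lborel (\<lambda>x. sqrt pi * normal_density 0 (sqrt (1/2)) x)"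
    by (intro integrable_mult_right integrable_normal_density) auto
  then show ?thesis by (simp add: normal_density_def)
qed

lemma integral_exp_minus_square: "(\<integral>x. exp (- (x::real)\<^sup>2) \<partial>lborel) = sqrt pi"
proof -
  have "(\<integral>x. normal_density 0 (sqrt (1/2)) x \<partial>lborel) = 1" by simp
  then show ?thesis by (simp add: normal_density_def)
qed

lemma integrable_power_weight: "integrable lborel (\<lambda>x. \<bar>x\<bar> ^ k * weight t x)"
proof (rule Bochner_Integration.integrable_bound)
  show "integrable lborel (\<lambda>x. exp (real k + \<bar>real k + t + 1\<bar> * (1 + \<bar>real k + t + 1\<bar>)) * exp (- x\<^sup>2 :: real))"
    by (intro integrable_mult_right integrable_exp_minus_square)
qed (use power_weight_le in \<open>auto simp: abs_mult less_imp_le\<close>)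

lemma integrable_monom_weight: "integrable lborel (\<lambda>x. x ^ k * weight t x)"
  by (rule Bochner_Integration.integrable_bound[OF integrable_power_weight[of k t]])
     (auto simp: abs_mult power_abs)

lemma integrable_poly_weight [simp, intro]: "integrable lborel (\<lambda>x. poly p x * weight t x)"
proof -
  have "integrable lborel (\<lambda>x. \<Sum>i\<le>degree p. coeff p i * (x ^ i * weight t x))"
    by (intro Bochner_Integration.integrable_sum integrable_mult_right integrable_monom_weight)
  then show ?thesis by (simp add: poly_altdef sum_distrib_right mult.assoc)
qed

definition lin :: "real \<Rightarrow> real poly \<Rightarrow> real" where
  "lin t p = (\<integral>x. poly p x * weight t x \<partial>lborel)"

lemma lin_0 [simp]: "lin t 0 = 0"
  by (simp add: lin_def)

lemma lin_add: "lin t (p + q) = lin t p + lin t q"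
  by (simp add: lin_def distrib_right)

lemma lin_diff: "lin t (p - q) = lin t p - lin t q"
  by (simp add: lin_def left_diff_distrib)

lemma lin_smult: "lin t (smult c p) = c * lin t p"
  by (simp add: lin_def mult.assoc)

lemma lin_uminus: "lin t (- p) = - lin t p"
  by (simp add: lin_def)

lemma lin_sum: "lin t (\<Sum>i\<in>I. f i) = (\<Sum>i\<in>I. lin t (f i))"
  by (induction I rule: infinite_finite_induct) (auto simp: lin_add)

lemma lin_eq_moments: "lin t p = (\<Sum>i\<le>degree p. coeff p i * lin t (monom 1 i))"
proof -
  have "lin t p = lin t (\<Sum>i\<le>degree p. smult (coeff p i) (monom 1 i))"
    by (simp add: smult_monom poly_as_sum_of_monoms)
  then show ?thesis by (simp add: lin_sum lin_smult)
qed

text \<open>A nonzero polynomial vanishes only on a finite, hence null, set. This positivity keeps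
  the Gram-Schmidt denominators nonzero.\<close>

lemma lin_square_pos:
  assumes "p \<noteq> 0"
  shows "lin t (p * p) > 0"
proof -
  have nn: "0 \<le> poly (p * p) x * weight t x" for x
    by (simp add: less_imp_le)
  then have "lin t (p * p) \<ge> 0" unfolding lin_def by (intro integral_nonneg_AE) auto
  moreover have "lin t (p * p) \<noteq> 0"
  proof
    assume "lin t (p * p) = 0"
    then have "AE x in lborel. poly (p * p) x * weight t x = 0"
      unfolding lin_def using nn by (subst (asm) integral_nonneg_eq_0_iff_AE[OF integrable_poly_weight]) auto
    then have "AE x in lborel. x \<in> {x. poly p x = 0}"
      by (simp add: less_imp_neq[OF weight_pos, symmetric])
    moreover have "AE x in lborel. x \<notin> {x. poly p x = 0}"
      using poly_roots_finite[OF assms] by (intro AE_not_in finite_imp_null_set_lborel)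
    ultimately have "AE x in (lborel :: real measure). False"
      by eventually_elim auto
    then show False by (simp add: eventually_False ae_filter_eq_bot_iff)
  qed
  ultimately show ?thesis by linarith
qed

lemma lin_reflect: "lin t (p \<circ>\<^sub>p [:0, -1:]) = lin t p"
proof -
  have "lin t p = (\<integral>x. poly p (0 + (-1) * x) * weight t (0 + (-1) * x) \<partial>lborel)"
    unfolding lin_def using lborel_integral_real_affine[of "-1" "\<lambda>x. poly p x * weight t x" 0] by simp
  then show ?thesis by (simp add: lin_def poly_pcompose)
qed

lemma tendsto_monom_weight:
  assumes "filterlim (\<lambda>x::real. \<bar>x\<bar>) at_top F"
  shows "((\<lambda>x. x ^ k * weight t x) \<longlongrightarrow> 0) F"
proof -
  define C where "C = exp (real k + \<bar>real k + t + 1\<bar> * (1 + \<bar>real k + t + 1\<bar>))"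
  have "((\<lambda>x::real. C * exp (- x\<^sup>2)) \<longlongrightarrow> 0) at_top" by real_asymp
  from filterlim_compose[OF this assms] have *: "((\<lambda>x::real. C * exp (- x\<^sup>2)) \<longlongrightarrow> 0) F" by simp
  show ?thesis
    by (rule Lim_null_comparison[OF _ *], rule always_eventually)
       (use power_weight_le[of _ k t] in \<open>auto simp: abs_mult power_abs C_def less_imp_le\<close>)
qed

lemma tendsto_poly_weight:
  assumes "filterlim (\<lambda>x::real. \<bar>x\<bar>) at_top F"
  shows "((\<lambda>x. poly p x * weight t x) \<longlongrightarrow> 0) F"
proof -
  have "((\<lambda>x. \<Sum>i\<le>degree p. coeff p i * (x ^ i * weight t x)) \<longlongrightarrow> (\<Sum>i\<le>degree p. coeff p i * 0)) F"
    by (intro tendsto_sum tendsto_mult tendsto_const tendsto_monom_weight assms)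
  then show ?thesis by (simp add: poly_altdef sum_distrib_right mult.assoc)
qed

lemma weight_deriv:
  "(weight t has_real_derivative (2 * t * x - 6 * x ^ 5) * weight t x) (at x)"
  unfolding weight_def[abs_def]
  by (auto intro!: derivative_eq_intros simp: algebra_simps)

text \<open>Integration by parts. With the weight written as exp (-V), the listed polynomial is V' =
  6 x^5 - 2 t x; the boundary terms vanish by the Gaussian bound.\<close>

lemma lin_pderiv: "lin t (pderiv p) = lin t (p * [:0, - 2 * t, 0, 0, 0, 6:])"
proof -
  let ?q = "pderiv p - p * [:0, - 2 * t, 0, 0, 0, 6:]"
  have "(LBINT x=-\<infinity>..\<infinity>. poly ?q x * weight t x) = 0 - 0"
  proof (rule interval_integral_FTC_integrable)
    show "((\<lambda>x. poly p x * weight t x) has_vector_derivative poly ?q x * weight t x) (at x)" for x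
      unfolding has_real_derivative_iff_has_vector_derivative[symmetric]
      by (auto intro!: derivative_eq_intros weight_deriv simp: algebra_simps power_numeral_reduce)
    show "isCont (\<lambda>x. poly ?q x * weight t x) x" for x
      by (intro continuous_intros DERIV_isCont[OF weight_deriv])
    show "set_integrable lborel (einterval (-\<infinity>) \<infinity>) (\<lambda>x. poly ?q x * weight t x)"
      using integrable_poly_weight[of ?q t] by (simp only: set_integrable_def einterval_eq) simp
    have "filterlim (\<lambda>x::real. \<bar>x\<bar>) at_top at_bot" "filterlim (\<lambda>x::real. \<bar>x\<bar>) at_top at_top"
      by real_asymp+
    note lims = this[THEN tendsto_poly_weight[of _ p t]]
    show "(((\<lambda>x. poly p x * weight t x) \<circ> real_of_ereal) \<longlongrightarrow> 0) (at_right (-\<infinity>))"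
      using lims(1) by (simp add: ereal_tendsto_simps)
    show "(((\<lambda>x. poly p x * weight t x) \<circ> real_of_ereal) \<longlongrightarrow> 0) (at_left \<infinity>)"
      using lims(2) by (simp add: ereal_tendsto_simps)
  qed simp_all
  then have "lin t ?q = 0" by (simp add: lin_def interval_lebesgue_integral_def set_lebesgue_integral_def)
  then show ?thesis by (simp add: lin_diff)
qed

subsection \<open>Orthogonal polynomials and the string equation\<close>

text \<open>Gram-Schmidt applied to the monomials. The arbitrary sequence of the theorem is
  identified with this one by uniqueness.\<close>

fun OP :: "real \<Rightarrow> nat \<Rightarrow> real poly" where
  "OP t n = monom 1 n -
     (\<Sum>j<n. smult (lin t (monom 1 n * OP t j) / lin t (OP t j * OP t j)) (OP t j))"

declare OP.simps [simp del]

lemma coeff_OP: "n \<le> i \<Longrightarrow> coeff (OP t n) i = (if i = n then 1 else 0)"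
proof (induction n arbitrary: i rule: less_induct)
  case (less n)
  have "coeff (OP t j) i = 0" if "j < n" for j
    using less.IH[OF that, of i] that less.prems by auto
  then show ?case
    by (subst OP.simps) (simp add: coeff_sum)
qed

lemma OP_nonzero [simp]: "OP t n \<noteq> 0"
  using coeff_OP[of n n t] by auto

definition H :: "real \<Rightarrow> nat \<Rightarrow> real" where
  "H t n = lin t (OP t n * OP t n)"

text \<open>
  The value \<open>b t 0 = 0\<close> makes the recurrence and the string equation hold for small \<open>n\<close> too: it
  annihilates every term in which the subtraction \<open>n - 1\<close> or \<open>n - 2\<close> is truncated.
\<close>

definition b :: "real \<Rightarrow> nat \<Rightarrow> real" where
  "b t n = (if n = 0 then 0 else H t n / H t (n - 1))"

lemma H_pos [simp]: "H t n > 0"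
  by (simp add: H_def lin_square_pos)

lemma H_neq_0 [simp]: "H t n \<noteq> 0"
  using H_pos[of t n] by linarith

lemma b_0 [simp]: "b t 0 = 0"
  by (simp add: b_def)

lemma b_pos: "n > 0 \<Longrightarrow> b t n > 0"
  by (simp add: b_def)

lemma b_nonneg: "b t n \<ge> 0"
  using b_pos[of n t] by (cases "n = 0") (auto simp: less_imp_le)

lemma H_Suc: "H t (Suc n) = b t (Suc n) * H t n"
  by (simp add: b_def)

section \<open>Orthogonality, uniqueness, parity and the three-term recurrence\<close>

lemma lin_OP_OP_less: "j < n \<Longrightarrow> lin t (OP t n * OP t j) = 0"
proof (induction n arbitrary: j rule: less_induct)
  case (less n)
  let ?c = "\<lambda>k. lin t (monom 1 n * OP t k) / H t k"
  have *: "lin t (OP t k * OP t j) = (if k = j then H t j else 0)" if "k < n" for k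
    using less.IH[of k j] less.IH[of j k] that less.prems
    by (cases k j rule: linorder_cases) (auto simp: H_def mult.commute)
  have "lin t (OP t n * OP t j)
      = lin t (monom 1 n * OP t j) - (\<Sum>k<n. ?c k * lin t (OP t k * OP t j))"
    by (subst OP.simps) (simp add: left_diff_distrib lin_diff sum_distrib_right lin_sum lin_smult H_def)
  also have "(\<Sum>k<n. ?c k * lin t (OP t k * OP t j)) = (\<Sum>k<n. if k = j then ?c j * H t j else 0)"
    by (intro sum.cong refl) (auto simp: *)
  also have "\<dots> = ?c j * H t j" using less.prems by simp
  also have "\<dots> = lin t (monom 1 n * OP t j)"
    by simp
  finally show ?case by simp
qed

lemma lin_OP_OP: "lin t (OP t i * OP t j) = (if i = j then H t i else 0)"
  using lin_OP_OP_less[of i j t] lin_OP_OP_less[of j i t]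
  by (cases i j rule: linorder_cases) (auto simp: H_def mult.commute)

text \<open>The monic \<open>P j\<close> with j < n span the polynomials of degree below n; the
  induction strips leading coefficients. \<open>P\<close> is left arbitrary to serve both the
  constructed and the given sequence.\<close>

lemma lin_mult_eq_0:
  assumes deg: "\<And>n i. n \<le> i \<Longrightarrow> coeff (P n) i = (if i = n then 1 else (0::real))"
    and orth: "\<And>j. j < n \<Longrightarrow> lin t (R * P j) = 0"
    and q: "\<And>i. n \<le> i \<Longrightarrow> coeff q i = 0"
  shows "lin t (R * q) = 0"
  using orth q
proof (induction n arbitrary: q)
  case 0
  then have "q = 0" by (intro poly_eqI) auto
  then show ?case by simp
next
  case (Suc n)
  have "lin t (R * (q - smult (coeff q n) (P n))) = 0"
  proof (rule Suc.IH)
    fix i assume "n \<le> i"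
    then show "coeff (q - smult (coeff q n) (P n)) i = 0"
      using deg[of n i] Suc.prems(2)[of i] by (cases "i = n") auto
  qed (use Suc.prems in auto)
  then show ?case
    using Suc.prems(1)[of n] by (simp add: right_diff_distrib lin_diff lin_smult)
qed

lemma lin_OP_mult_eq_0: "(\<And>i. n \<le> i \<Longrightarrow> coeff q i = 0) \<Longrightarrow> lin t (OP t n * q) = 0"
  using lin_mult_eq_0[of "OP t" n t "OP t n" q] coeff_OP lin_OP_OP_less by blast

text \<open>The difference \<open>R - OP t n\<close> has degree below n, so both of its terms are
  orthogonal to it and it is orthogonal to itself.\<close>

lemma OP_unique:
  assumes deg: "\<And>n i. n \<le> i \<Longrightarrow> coeff (P n) i = (if i = n then 1 else (0::real))"
    and R: "\<And>i. n \<le> i \<Longrightarrow> coeff R i = (if i = n then 1 else 0)"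
    and orth: "\<And>j. j < n \<Longrightarrow> lin t (R * P j) = 0"
  shows "R = OP t n"
proof -
  have r: "coeff (R - OP t n) i = 0" if "n \<le> i" for i
    using that by (simp add: R coeff_OP)
  have "lin t (R * (R - OP t n)) = 0"
    using lin_mult_eq_0[of P n t R "R - OP t n"] deg orth r by blast
  moreover have "lin t (OP t n * (R - OP t n)) = 0"
    by (rule lin_OP_mult_eq_0) (rule r)
  ultimately have "lin t ((R - OP t n) * (R - OP t n)) = 0"
    by (simp add: left_diff_distrib lin_diff)
  then show ?thesis
    using lin_square_pos[of "R - OP t n" t] by (cases "R - OP t n = 0") auto
qed

lemma monic_orthogonal_polys_imp:
  assumes "monic_orthogonal_polys t P"
  shows "P n = OP t n"
proof (rule OP_unique[of P])
  have *: "degree (P n) = n" "lead_coeff (P n) = 1" for n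
    using assms unfolding monic_orthogonal_polys_def by blast+
  show "coeff (P m) i = (if i = m then 1 else 0)" if "m \<le> i" for m i
    using *[of m] that by (auto intro: coeff_eq_0)
  then show "coeff (P n) i = (if i = n then 1 else 0)" if "n \<le> i" for i
    using that by blast
  show "lin t (P n * P j) = 0" if "j < n" for j
    using assms that by (auto simp: monic_orthogonal_polys_def lin_def)
qed

lemma coeff_reflect: "coeff (p \<circ>\<^sub>p [:0, -1:]) i = (-1) ^ i * coeff (p :: real poly) i"
proof (induction p arbitrary: i)
  case (pCons a p)
  then show ?case by (cases i) (simp_all add: pcompose_pCons)
qed simp

text \<open>The weight is even, so the sign-corrected reflection is again monic and orthogonal to
  all lower degrees.\<close>

lemma OP_reflect: "OP t n \<circ>\<^sub>p [:0, -1:] = smult ((-1) ^ n) (OP t n)"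
proof -
  let ?R = "smult ((-1) ^ n) (OP t n \<circ>\<^sub>p [:0, -1:])"
  have "?R = OP t n"
  proof (rule OP_unique[of "OP t"])
    show "coeff ?R i = (if i = n then 1 else 0)" if "n \<le> i" for i
      using that by (auto simp: coeff_reflect coeff_OP simp flip: power_mult_distrib)
    fix j assume j: "j < n"
    have inv: "(OP t j \<circ>\<^sub>p [:0, -1:]) \<circ>\<^sub>p [:0, -1:] = OP t j"
      by (simp add: pcompose_assoc[symmetric] pcompose_pCons pcompose_idR)
    have "lin t ((OP t n \<circ>\<^sub>p [:0, -1:]) * OP t j)
        = lin t ((OP t n * (OP t j \<circ>\<^sub>p [:0, -1:])) \<circ>\<^sub>p [:0, -1:])"
      by (simp add: pcompose_mult inv)
    also have "\<dots> = lin t (OP t n * (OP t j \<circ>\<^sub>p [:0, -1:]))" by (rule lin_reflect)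
    also have "\<dots> = 0"
      using j by (intro lin_OP_mult_eq_0) (auto simp: coeff_reflect coeff_OP)
    finally show "lin t (?R * OP t j) = 0" by (simp add: lin_smult)
  qed (auto simp: coeff_OP)
  then have "smult ((-1) ^ n) ?R = smult ((-1) ^ n) (OP t n)" by simp
  then show ?thesis by (simp flip: power_mult_distrib)
qed

text \<open>The integrand is odd. This removes the diagonal term from the three-term
  recurrence.\<close>

lemma lin_X_OP_OP_self: "lin t ([:0, 1:] * OP t n * OP t n) = 0"
proof -
  have "([:0, 1:] * OP t n * OP t n) \<circ>\<^sub>p [:0, -1:] = - ([:0, 1:] * OP t n * OP t n)"
    by (simp add: pcompose_mult OP_reflect pcompose_pCons flip: power_mult_distrib)
  with lin_reflect[of t "[:0, 1:] * OP t n * OP t n"] show ?thesis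
    by (simp only: lin_uminus)
qed

lemma coeff_X_mult: "coeff ([:0, 1:] * p) i = (if i = 0 then 0 else coeff (p :: real poly) (i - 1))"
  by (cases i) auto

lemma lin_X_OP_OP_Suc: "lin t ([:0, 1:] * OP t (Suc n) * OP t n) = H t (Suc n)"
proof -
  have "lin t (OP t (Suc n) * ([:0, 1:] * OP t n - OP t (Suc n))) = 0"
    by (rule lin_OP_mult_eq_0) (auto simp: coeff_X_mult coeff_OP simp del: mult_pCons_left)
  then show ?thesis by (simp only: right_diff_distrib lin_diff H_def) (simp add: mult_ac)
qed

text \<open>The candidate for the next polynomial is monic and orthogonal to all lower ones: for j =
  n by parity, for j = n - 1 by the choice of \<open>b\<close>, and for smaller j because the factor
  x can be moved onto \<open>OP t j\<close>.\<close>

lemma OP_rec: "[:0, 1:] * OP t n = OP t (Suc n) + smult (b t n) (OP t (n - 1))"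
proof -
  let ?R = "[:0, 1:] * OP t n - smult (b t n) (OP t (n - 1))"
  have "?R = OP t (Suc n)"
  proof (rule OP_unique[of "OP t"])
    show "coeff ?R i = (if i = Suc n then 1 else 0)" if "Suc n \<le> i" for i
      using that by (auto simp: coeff_X_mult coeff_OP simp del: mult_pCons_left)
    fix j assume j: "j < Suc n"
    have R: "lin t (?R * OP t j) = lin t ([:0, 1:] * OP t n * OP t j) - b t n * lin t (OP t (n - 1) * OP t j)"
      by (simp only: left_diff_distrib lin_diff) (simp only: mult_smult_left lin_smult)
    consider "j = n" "n = 0" | "j = n" "n > 0" | "Suc j = n" | "Suc j < n" using j by linarith
    then show "lin t (?R * OP t j) = 0"
    proof cases
      case 4
      have "lin t ([:0, 1:] * OP t n * OP t j) = lin t (OP t n * ([:0, 1:] * OP t j))"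
        by (simp only: mult_ac)
      also have "\<dots> = 0"
        using 4 by (intro lin_OP_mult_eq_0) (auto simp: coeff_X_mult coeff_OP simp del: mult_pCons_left)
      finally show ?thesis using 4 unfolding R by (auto simp add: lin_OP_OP)
    next
      case 3
      then show ?thesis unfolding R using lin_X_OP_OP_Suc[of t j]
        by (auto simp: lin_OP_OP H_Suc simp del: mult_pCons_left)
    qed (unfold R, auto simp: lin_X_OP_OP_self lin_OP_OP simp del: mult_pCons_left)
  qed (auto simp: coeff_OP)
  then show ?thesis by (simp add: algebra_simps)
qed

lemma lin_pderiv_OP: "lin t (pderiv (OP t (Suc n)) * OP t n) = real (Suc n) * H t n"
proof -
  have "lin t (OP t n * (pderiv (OP t (Suc n)) - smult (real (Suc n)) (OP t n))) = 0"
    by (rule lin_OP_mult_eq_0) (auto simp: coeff_pderiv coeff_OP)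
  then show ?thesis by (simp add: right_diff_distrib lin_diff lin_smult H_def mult_ac)
qed

lemma X2_OP: "[:0, 1:] * ([:0, 1:] * OP t n) = OP t (n + 2) + smult (b t n + b t (n + 1)) (OP t n)
    + smult (b t n * b t (n - 1)) (OP t (n - 2))"
proof -
  have "[:0, 1:] * ([:0, 1:] * OP t n) = [:0, 1:] * OP t (Suc n) + smult (b t n) ([:0, 1:] * OP t (n - 1))"
    by (simp only: OP_rec[of t n] distrib_left mult_smult_right)
  also have "\<dots> = OP t (n + 2) + smult (b t n + b t (n + 1)) (OP t n)
    + smult (b t n * b t (n - 1)) (OP t (n - 2))"
    unfolding OP_rec by (cases n) (auto simp: smult_add_left smult_add_right algebra_simps)
  finally show ?thesis .
qed

lemma lin_X2_OP_OP: "lin t (monom 1 2 * (OP t n * OP t n)) = H t n * (b t n + b t (Suc n))"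
proof -
  have "lin t (monom 1 2 * (OP t n * OP t n)) = lin t (([:0, 1:] * ([:0, 1:] * OP t n)) * OP t n)"
    by (simp add: monom_altdef power2_eq_square mult_ac)
  also have "\<dots> = H t n * (b t n + b t (Suc n))"
    unfolding X2_OP by (cases n rule: nat.exhaust[case_names 0 Suc])
      (auto simp: distrib_right lin_add lin_smult lin_OP_OP algebra_simps)
  finally show ?thesis .
qed

text \<open>The pairing of the derivative of \<open>OP t (Suc m)\<close> with \<open>OP t m\<close>
  is evaluated twice: by leading coefficients, and by parts, which brings in 6 x^5 - 2 t x. The
  fifth power is split as x^3 times x^2, so that each factor expands in orthogonal polynomials by
  the recurrence.\<close>

theorem string_equation:
  assumes "n > 0"
  shows "real n = b t n * (6 * (b t (n + 1) * (b t n + b t (n + 1) + b t (n + 2))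
      + (b t (n - 1) + b t n + b t (n + 1)) * (b t (n - 1) + b t n) + b t (n - 1) * b t (n - 2)) - 2 * t)"
proof -
  obtain m where n: "n = Suc m" using assms by (cases n) auto
  let ?X = "[:0, 1:] :: real poly"
  have X3: "?X * (?X * (?X * OP t (Suc m))) = OP t (m + 4)
      + smult (b t (m + 1) + b t (m + 2) + b t (m + 3)) (OP t (m + 2))
      + smult (b t (m + 1) * (b t m + b t (m + 1) + b t (m + 2))) (OP t m)
      + smult (b t (m + 1) * b t m * b t (m - 1)) (OP t (m - 2))" (is "_ = ?Q3")
  proof -
    have "?X * (?X * (?X * OP t (Suc m))) = ?X * (?X * OP t (m + 2)) + smult (b t (Suc m)) (?X * (?X * OP t m))"
      by (subst OP_rec) (simp add: distrib_left)
    also have "\<dots> = ?Q3"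
      unfolding X2_OP by (simp add: numeral_eq_Suc smult_add_left smult_add_right algebra_simps)
    finally show ?thesis .
  qed
  let ?Q2 = "OP t (m + 2) + smult (b t m + b t (m + 1)) (OP t m) + smult (b t m * b t (m - 1)) (OP t (m - 2))"
  have H2: "H t (m + 2) = b t (m + 2) * b t (m + 1) * H t m"
    using H_Suc[of t m] H_Suc[of t "Suc m"] by simp
  have H2': "b t m * b t (m - 1) * H t (m - 2) = H t m" if "m \<ge> 2"
    using H_Suc[of t "m - 1"] H_Suc[of t "m - 2"] that
    by (auto simp: numeral_eq_Suc Suc_diff_Suc)
  have Q: "lin t (?Q3 * ?Q2) = H t m * (b t (m + 1) * (b t (m + 2) * (b t (m + 1) + b t (m + 2) + b t (m + 3))
      + (b t m + b t (m + 1) + b t (m + 2)) * (b t m + b t (m + 1)) + b t m * b t (m - 1)))"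
  proof -
    consider "m = 0" | "m = 1" | "m \<ge> 2" by linarith
    then show ?thesis
    proof cases
      case 3
      have "lin t (?Q3 * ?Q2) = (b t (m + 1) + b t (m + 2) + b t (m + 3)) * H t (m + 2)
         + b t (m + 1) * (b t m + b t (m + 1) + b t (m + 2)) * (b t m + b t (m + 1)) * H t m
         + b t (m + 1) * b t m * b t (m - 1) * (b t m * b t (m - 1) * H t (m - 2))"
        using 3 by (auto simp: distrib_left distrib_right lin_add lin_smult lin_OP_OP)
      then show ?thesis unfolding H2'[OF 3] H2 by (simp add: algebra_simps)
    qed (use H2 in \<open>auto simp: distrib_left distrib_right lin_add lin_smult lin_OP_OP numeral_eq_Suc algebra_simps\<close>)
  qed
  have "real (Suc m) * H t m = lin t (pderiv (OP t (Suc m)) * OP t m)"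
    by (simp add: lin_pderiv_OP)
  also have "\<dots> = lin t (pderiv (OP t (Suc m) * OP t m)) - lin t (OP t (Suc m) * pderiv (OP t m))"
    by (simp add: pderiv_mult lin_add mult_ac)
  also have "lin t (OP t (Suc m) * pderiv (OP t m)) = 0"
    by (rule lin_OP_mult_eq_0) (auto simp: coeff_pderiv coeff_OP)
  also have "lin t (pderiv (OP t (Suc m) * OP t m))
      = lin t (OP t (Suc m) * OP t m * [:0, - 2 * t, 0, 0, 0, 6:])" by (simp only: lin_pderiv)
  also have "OP t (Suc m) * OP t m * [:0, - 2 * t, 0, 0, 0, 6:]
     = smult (- 2 * t) (?X * OP t (Suc m) * OP t m) + smult 6 ((?X * (?X * (?X * OP t (Suc m)))) * (?X * (?X * OP t m)))"
    by (simp add: mult_ac flip: smult_add_right)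
  also have "lin t \<dots> = - 2 * t * H t (Suc m) + 6 * lin t (?Q3 * ?Q2)"
    unfolding lin_add lin_smult lin_X_OP_OP_Suc X3 unfolding X2_OP ..
  finally have "H t m * real n = H t m * (b t n * (6 * (b t (n + 1) * (b t n + b t (n + 1) + b t (n + 2))
      + (b t (n - 1) + b t n + b t (n + 1)) * (b t (n - 1) + b t n) + b t (n - 1) * b t (n - 2)) - 2 * t))"
    unfolding Q H_Suc n by (simp add: numeral_eq_Suc algebra_simps)
  then show ?thesis by simp
qed

subsection \<open>The Toda flow\<close>

text \<open>The factor exp |u| is harmless later: for u = (s - t) x^2 with |s - t| <= 1 it is
  absorbed by passing to the weight at t + 1.\<close>

lemma exp_quadratic_bound:
  fixes u :: real
  shows "\<bar>exp u - 1 - u\<bar> \<le> u\<^sup>2 * exp \<bar>u\<bar>"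
proof -
  have lower: "0 \<le> exp u - 1 - u" using exp_ge_add_one_self[of u] by linarith
  have "(1 - u) * exp u \<le> exp (- u) * exp u"
    using exp_ge_add_one_self[of "- u"] by (intro mult_right_mono) auto
  then have upper: "exp u - 1 - u \<le> u * (exp u - 1)" by (simp add: algebra_simps exp_minus)
  have "u * (exp u - 1) \<le> u\<^sup>2 * exp \<bar>u\<bar>"
  proof (cases "u \<ge> 0")
    case True
    have "exp u - 1 \<le> u * exp u"
      using \<open>(1 - u) * exp u \<le> exp (- u) * exp u\<close> by (simp add: algebra_simps exp_minus)
    then have "u * (exp u - 1) \<le> u * (u * exp u)" using True by (rule mult_left_mono)
    then show ?thesis using True by (simp add: power2_eq_square mult.assoc)
  next
    case False
    have "u * (exp u - 1) \<le> u * u"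
      using lower False by (intro mult_left_mono_neg) auto
    also have "\<dots> \<le> u\<^sup>2 * exp \<bar>u\<bar>"
      by (simp add: power2_eq_square mult_le_cancel_left1)
    finally show ?thesis .
  qed
  with lower upper show ?thesis by linarith
qed

lemma has_real_derivative_quadratic:
  fixes f :: "real \<Rightarrow> real"
  assumes "\<And>s. \<bar>s - t\<bar> \<le> 1 \<Longrightarrow> \<bar>f s - f t - (s - t) * D\<bar> \<le> C * (s - t)\<^sup>2"
  shows "(f has_real_derivative D) (at t)"
  unfolding has_field_derivative_iff
proof (rule LIM_zero_cancel, rule Lim_null_comparison)
  show "\<forall>\<^sub>F s in at t. norm ((f s - f t) / (s - t) - D) \<le> C * \<bar>s - t\<bar>"
    unfolding eventually_at
  proof (intro exI[of _ 1] conjI ballI impI)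
    fix s assume s: "s \<noteq> t \<and> dist s t < 1"
    then have "\<bar>f s - f t - (s - t) * D\<bar> \<le> C * (s - t)\<^sup>2"
      by (intro assms) (auto simp: dist_real_def)
    moreover have "(f s - f t) / (s - t) - D = (f s - f t - (s - t) * D) / (s - t)"
      using s by (simp add: field_simps)
    moreover have "(s - t)\<^sup>2 = \<bar>s - t\<bar> * \<bar>s - t\<bar>" by (simp add: power2_eq_square)
    ultimately show "norm ((f s - f t) / (s - t) - D) \<le> C * \<bar>s - t\<bar>"
      using s by (simp add: abs_divide pos_divide_le_eq mult.assoc)
  qed simp
  have "((\<lambda>s. C * \<bar>s - t\<bar>) \<longlongrightarrow> C * \<bar>t - t\<bar>) (at t)" by (intro tendsto_intros)
  then show "((\<lambda>s. C * \<bar>s - t\<bar>) \<longlongrightarrow> 0) (at t)" by simp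
qed

text \<open>Differentiation under the integral brings down x^2. The quadratic remainder is dominated
  by |x^4 p| times the weight at t + 1, a single function for all |s - t| <= 1.\<close>

lemma lin_has_real_derivative:
  "((\<lambda>s. lin s p) has_real_derivative lin t (monom 1 2 * p)) (at t)"
proof (rule has_real_derivative_quadratic)
  fix s assume s: "\<bar>s - t\<bar> \<le> 1"
  let ?d = "\<lambda>x. poly p x * weight s x - poly p x * weight t x - (s - t) * (poly (monom 1 2 * p) x * weight t x)"
  let ?g = "\<lambda>x. \<bar>poly (monom 1 4 * p) x * weight (t + 1) x\<bar>"
  have *: "\<bar>weight s x - weight t x - (s - t) * (x\<^sup>2 * weight t x)\<bar> \<le> (s - t)\<^sup>2 * (x ^ 4 * weight (t + 1) x)" for x
  proof -
    define u where "u = (s - t) * x\<^sup>2"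
    have ws: "weight s x = weight t x * exp u"
      by (simp add: weight_def u_def algebra_simps flip: exp_add)
    have "\<bar>u\<bar> \<le> x\<^sup>2" using s by (simp add: u_def abs_mult mult_left_le_one_le)
    then have "weight t x * exp \<bar>u\<bar> \<le> weight (t + 1) x"
      by (simp add: weight_def algebra_simps flip: exp_add)
    then have "u\<^sup>2 * (weight t x * exp \<bar>u\<bar>) \<le> u\<^sup>2 * weight (t + 1) x"
      by (intro mult_left_mono) auto
    moreover have "weight t x * \<bar>exp u - 1 - u\<bar> \<le> weight t x * (u\<^sup>2 * exp \<bar>u\<bar>)"
      "weight t x * (u\<^sup>2 * exp \<bar>u\<bar>) = u\<^sup>2 * (weight t x * exp \<bar>u\<bar>)"
      by (intro mult_left_mono exp_quadratic_bound) (simp_all add: less_imp_le)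
    moreover have "\<bar>weight s x - weight t x - (s - t) * (x\<^sup>2 * weight t x)\<bar> = weight t x * \<bar>exp u - 1 - u\<bar>"
    proof -
      have "weight s x - weight t x - (s - t) * (x\<^sup>2 * weight t x) = weight t x * (exp u - 1 - u)"
        by (simp add: ws u_def algebra_simps)
      then show ?thesis by (simp add: abs_mult less_imp_le)
    qed
    moreover have "u\<^sup>2 * weight (t + 1) x = (s - t)\<^sup>2 * (x ^ 4 * weight (t + 1) x)"
      by (simp add: u_def power_mult_distrib flip: power_mult)
    ultimately show ?thesis by linarith
  qed
  have int: "integrable lborel (\<lambda>x. poly p x * weight r x)" "integrable lborel (\<lambda>x. poly (monom 1 2 * p) x * weight r x)" for r
    by (rule integrable_poly_weight)+
  have eq: "lin s p - lin t p - (s - t) * lin t (monom 1 2 * p)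
      = (\<integral>x. ?d x \<partial>lborel)"
    unfolding lin_def
    by (subst Bochner_Integration.integral_diff) (simp_all only: Bochner_Integration.integral_diff
      Bochner_Integration.integrable_diff integral_mult_right_zero integrable_mult_right int simp_thms)
  have "\<bar>\<integral>x. ?d x \<partial>lborel\<bar> \<le> (\<integral>x. (s - t)\<^sup>2 * ?g x \<partial>lborel)"
  proof (rule integral_abs_bound_integral)
    show "integrable lborel (\<lambda>x. ?d x)"
      using int by (intro Bochner_Integration.integrable_diff integrable_mult_right) auto
    show "integrable lborel (\<lambda>x. (s - t)\<^sup>2 * ?g x)"
      by (intro integrable_mult_right integrable_abs integrable_poly_weight)
    fix x
    have "\<bar>?d x\<bar>
        = \<bar>poly p x\<bar> * \<bar>weight s x - weight t x - (s - t) * (x\<^sup>2 * weight t x)\<bar>"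
      unfolding abs_mult[symmetric] by (rule arg_cong[where f = abs]) (simp add: poly_monom right_diff_distrib)
    also have "\<dots> \<le> \<bar>poly p x\<bar> * ((s - t)\<^sup>2 * (x ^ 4 * weight (t + 1) x))"
      by (intro mult_left_mono *) auto
    also have "\<dots> = (s - t)\<^sup>2 * ?g x"
      by (simp add: poly_monom abs_mult less_imp_le)
    finally show "\<bar>?d x\<bar>
      \<le> (s - t)\<^sup>2 * ?g x" .
  qed
  then show "\<bar>lin s p - lin t p - (s - t) * lin t (monom 1 2 * p)\<bar> \<le> (\<integral>x. ?g x \<partial>lborel) * (s - t)\<^sup>2"
    unfolding eq by (simp only: integral_mult_right_zero mult.commute)
qed

lemma lin_eq_moments_le:
  assumes "degree p \<le> m"
  shows "lin t p = (\<Sum>i\<le>m. coeff p i * lin t (monom 1 i))"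
proof -
  have "(\<Sum>i\<le>m. coeff p i * lin t (monom 1 i)) = (\<Sum>i\<le>degree p. coeff p i * lin t (monom 1 i))"
    using assms by (intro sum.mono_neutral_right) (auto simp: coeff_eq_0)
  then show ?thesis by (simp add: lin_eq_moments[of t p])
qed

lemma degree_OP [simp]: "degree (OP t n) = n"
  by (intro antisym degree_le le_degree) (auto simp: coeff_OP)

lemma differentiable_lin:
  assumes "\<And>s. degree (q s) \<le> m" and "\<And>i. (\<lambda>s. coeff (q s) i) differentiable (at (t :: real))"
  shows "(\<lambda>s. lin s (q s)) differentiable (at t)"
proof -
  have "(\<lambda>s. lin s (monom 1 i)) differentiable (at t)" for i
    using lin_has_real_derivative real_differentiable_def by blast
  then have "(\<lambda>s. \<Sum>i\<le>m. coeff (q s) i * lin s (monom 1 i)) differentiable (at t)"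
    using assms(2) by (intro differentiable_sum differentiable_mult) auto
  then show ?thesis using assms(1) by (simp flip: lin_eq_moments_le)
qed

lemma differentiable_coeff_mult:
  assumes "\<And>i. (\<lambda>s. coeff (p s) i) differentiable (at (t :: real))"
    and "\<And>i. (\<lambda>s. coeff (q s) i) differentiable (at t)"
  shows "(\<lambda>s. coeff (p s * q s :: real poly) i) differentiable (at t)"
  unfolding coeff_mult using assms by (intro differentiable_sum differentiable_mult) auto

lemma differentiable_coeff_OP: "(\<lambda>s. coeff (OP s n) i) differentiable (at t)"
proof (induction n arbitrary: i rule: less_induct)
  case (less n)
  have "(\<lambda>s. coeff (monom 1 n) i - (\<Sum>j<n. lin s (monom 1 n * OP s j) / lin s (OP s j * OP s j) * coeff (OP s j) i))
    differentiable (at t)"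
  proof (intro differentiable_diff differentiable_const differentiable_sum differentiable_mult ballI differentiable_divide)
    fix j assume "j \<in> {..<n}"
    then have *: "(\<lambda>s. coeff (OP s j) i) differentiable (at t)" for i using less by simp
    then show "(\<lambda>s. coeff (OP s j) i) differentiable (at t)" .
    show "(\<lambda>s. lin s (monom 1 n * OP s j)) differentiable (at t)"
      by (rule differentiable_lin[where m = "n + j"], rule order.trans[OF degree_mult_le])
         (auto simp: degree_monom_eq intro!: differentiable_coeff_mult *)
    show "(\<lambda>s. lin s (OP s j * OP s j)) differentiable (at t)"
      by (rule differentiable_lin[where m = "j + j"], rule order.trans[OF degree_mult_le])
         (auto intro!: differentiable_coeff_mult *)
    show "lin t (OP t j * OP t j) \<noteq> 0" using H_neq_0[of t j] by (simp add: H_def)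
  qed simp
  then show ?case
    by (subst OP.simps) (simp add: coeff_sum)
qed

text \<open>\<open>r s\<close> has degree below n and is thus orthogonal to \<open>OP s n\<close>.
  By Pythagoras the norm at s is that of the fixed polynomial \<open>OP t n\<close> minus that of
  \<open>r s\<close>. The latter has a double zero at s = t, so only the explicit dependence of the
  weight contributes, and no formula for the derivatives of the coefficients enters.\<close>

lemma H_has_real_derivative:
  "((\<lambda>s. H s n) has_real_derivative H t n * (b t n + b t (Suc n))) (at t)"
proof -
  define r where "r = (\<lambda>s. OP s n - OP t n)"
  have H: "H s n = lin s (OP t n * OP t n) - lin s (r s * r s)" for s
  proof -
    have "lin s (OP s n * r s) = 0"
      by (rule lin_OP_mult_eq_0) (auto simp: r_def coeff_OP)
    moreover have "OP t n * OP t n = OP s n * OP s n - OP s n * r s - OP s n * r s + r s * r s"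
      by (simp add: r_def algebra_simps)
    ultimately show ?thesis by (simp only: H_def lin_add lin_diff diff_zero add_diff_cancel)
  qed
  have "\<exists>d. ((\<lambda>s. coeff (r s) i) has_real_derivative d) (at t)" for i
  proof -
    have "(\<lambda>s. coeff (r s) i) differentiable (at t)"
      unfolding r_def coeff_diff by (intro differentiable_diff differentiable_coeff_OP differentiable_const)
    then show ?thesis by (simp add: real_differentiable_def)
  qed
  then obtain d where d: "((\<lambda>s. coeff (r s) i) has_real_derivative d i) (at t)" for i by metis
  have "((\<lambda>s. \<Sum>i\<le>n + n. (\<Sum>k\<le>i. coeff (r s) k * coeff (r s) (i - k)) * lin s (monom 1 i))
     has_real_derivative (\<Sum>i\<le>n + n. (\<Sum>k\<le>i. d k * coeff (r t) (i - k) + d (i - k) * coeff (r t) k) * lin t (monom 1 i)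
        + lin t (monom 1 2 * monom 1 i) * (\<Sum>k\<le>i. coeff (r t) k * coeff (r t) (i - k)))) (at t)"
    by (intro DERIV_sum DERIV_mult d lin_has_real_derivative)
  moreover have "(\<Sum>i\<le>n + n. (\<Sum>k\<le>i. coeff (r s) k * coeff (r s) (i - k)) * lin s (monom 1 i)) = lin s (r s * r s)" for s
  proof -
    have "degree (r s) \<le> n" by (simp add: r_def degree_diff_le)
    then have "degree (r s * r s) \<le> n + n" by (intro order.trans[OF degree_mult_le] add_mono)
    then show ?thesis by (simp add: lin_eq_moments_le coeff_mult)
  qed
  ultimately have "((\<lambda>s. lin s (r s * r s)) has_real_derivative 0) (at t)"
    by (simp add: r_def)
  from DERIV_diff[OF lin_has_real_derivative[of "OP t n * OP t n" t] this]
  show ?thesis by (simp add: H lin_X2_OP_OP)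
qed

lemma ln_H_has_real_derivative:
  "((\<lambda>s. ln (H s n)) has_real_derivative (b t n + b t (Suc n))) (at t)"
  by (rule derivative_eq_intros H_has_real_derivative refl | simp)+

text \<open>The substitution x -> x / sqrt a turns the weight at -a into exp (-x^2 - x^6 / a^3),
  which is dominated by its Gaussian limit.\<close>

lemma H_0_at_bot: "((\<lambda>a. sqrt a * H (- a) 0) \<longlongrightarrow> sqrt pi) at_top"
proof -
  have OP0: "OP s 0 = 1" for s by (subst OP.simps) simp
  have eq: "sqrt a * H (- a) 0 = (\<integral>x. exp (- (x ^ 6 / a ^ 3) - x\<^sup>2) \<partial>lborel)" if "a > 0" for a
  proof -
    have "H (- a) 0 = (\<integral>x. weight (- a) x \<partial>lborel)" by (simp add: H_def OP0 lin_def)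
    also have "\<dots> = (1 / sqrt a) * (\<integral>x. weight (- a) (x / sqrt a) \<partial>lborel)"
      using lborel_integral_real_affine[of "1 / sqrt a" "weight (- a)" 0] that by simp
    also have "(\<lambda>x. weight (- a) (x / sqrt a)) = (\<lambda>x. exp (- (x ^ 6 / a ^ 3) - x\<^sup>2))"
    proof
      fix x
      have "sqrt a ^ 6 = (sqrt a ^ 2) ^ 3" by (simp flip: power_mult)
      then have "sqrt a ^ 6 = a ^ 3" using that by simp
      then show "weight (- a) (x / sqrt a) = exp (- (x ^ 6 / a ^ 3) - x\<^sup>2)"
        using that by (simp add: weight_def power_divide)
    qed
    finally show ?thesis using that by simp
  qed
  have "((\<lambda>a. \<integral>x. exp (- (x ^ 6 / a ^ 3) - x\<^sup>2) \<partial>lborel) \<longlongrightarrow> (\<integral>x. exp (- (x::real)\<^sup>2) \<partial>lborel)) at_top"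
  proof (rule integral_dominated_convergence_at_top[where w = "\<lambda>x. exp (- (x::real)\<^sup>2)"])
    show "AE x in lborel. ((\<lambda>a::real. exp (- (x ^ 6 / a ^ 3) - x\<^sup>2)) \<longlongrightarrow> exp (- x\<^sup>2)) at_top"
    proof (rule AE_I2)
      fix x :: real
      have "((\<lambda>a. - (x ^ 6 * (1 / a ^ 3)) - x\<^sup>2) \<longlongrightarrow> - (x ^ 6 * 0) - x\<^sup>2) at_top"
        by (intro tendsto_intros) real_asymp
      from tendsto_exp[OF this] show "((\<lambda>a. exp (- (x ^ 6 / a ^ 3) - x\<^sup>2)) \<longlongrightarrow> exp (- x\<^sup>2)) at_top" by simp
    qed
    show "\<forall>\<^sub>F a in at_top. AE x in lborel. norm (exp (- (x ^ 6 / a ^ 3) - x\<^sup>2)) \<le> exp (- (x::real)\<^sup>2)"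
      using eventually_gt_at_top[of "0::real"] by eventually_elim auto
  qed (use integrable_exp_minus_square in auto)
  then show ?thesis
    unfolding integral_exp_minus_square
    by (rule Lim_transform_eventually) (use eventually_gt_at_top[of "0::real"] in eventually_elim, simp add: eq)
qed

subsection \<open>The slowly varying solution and its stability\<close>

text \<open>The string equation with all five coefficients set equal to x: ten products times 6 give
  60 x^3. The second argument is real because half-integers and derivatives in it are used.\<close>

definition B :: "real \<Rightarrow> real \<Rightarrow> real" where
  "B t \<nu> = (THE x. x > 0 \<and> 60 * x ^ 3 - 2 * t * x = \<nu>)"

text \<open>For t > 0 the cubic is not monotone, but where it is positive both factors x and 60 x^2
  - 2 t are positive and increasing.\<close>

lemma cubic_strict_mono:
  fixes x y t :: real
  assumes "0 < x" "x < y" "60 * x ^ 3 - 2 * t * x > 0"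
  shows "60 * x ^ 3 - 2 * t * x < 60 * y ^ 3 - 2 * t * y"
proof -
  have x: "60 * x ^ 3 - 2 * t * x = x * (60 * x\<^sup>2 - 2 * t)" for x
    by (simp add: power2_eq_square power3_eq_cube algebra_simps)
  have "60 * x\<^sup>2 - 2 * t > 0" using assms by (simp add: x zero_less_mult_iff)
  moreover have "x\<^sup>2 < y\<^sup>2" using assms by (intro power_strict_mono) auto
  ultimately have "x * (60 * x\<^sup>2 - 2 * t) < y * (60 * y\<^sup>2 - 2 * t)"
    using assms by (intro mult_strict_mono) auto
  then show ?thesis by (simp add: x)
qed

lemma ex1_B:
  fixes t \<nu> :: real
  assumes "\<nu> > 0"
  shows "\<exists>!x. x > 0 \<and> 60 * x ^ 3 - 2 * t * x = \<nu>"
proof -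
  define y where "y = 1 + \<nu> + \<bar>t\<bar>"
  have "y \<ge> 1" using assms by (simp add: y_def)
  then have y2: "1 * y \<le> y * y" by (intro mult_right_mono) auto
  have "\<nu> * 1 \<le> y * (60 * y - 2 * t)"
    using \<open>y \<ge> 1\<close> assms by (intro mult_mono) (auto simp: y_def)
  also have "\<dots> \<le> y * (60 * (y * y) - 2 * t)"
    using \<open>y \<ge> 1\<close> y2 by (intro mult_left_mono) auto
  finally have "\<nu> \<le> 60 * y ^ 3 - 2 * t * y" by (simp add: power3_eq_cube algebra_simps)
  then have "\<exists>x. 0 \<le> x \<and> x \<le> y \<and> 60 * x ^ 3 - 2 * t * x = \<nu>"
    using assms \<open>y \<ge> 1\<close> by (intro IVT') (auto intro!: continuous_intros)
  then obtain x where "0 \<le> x" "60 * x ^ 3 - 2 * t * x = \<nu>" by blast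
  then have "x > 0 \<and> 60 * x ^ 3 - 2 * t * x = \<nu>" using assms by (cases "x = 0") auto
  then show ?thesis
    using cubic_strict_mono[of _ _ t] assms by (metis less_irrefl linorder_neqE_linordered_idom)
qed

lemma B_pos: "\<nu> > 0 \<Longrightarrow> B t \<nu> > 0"
  and B_eq: "\<nu> > 0 \<Longrightarrow> 60 * B t \<nu> ^ 3 - 2 * t * B t \<nu> = \<nu>"
  using theI'[OF ex1_B[of \<nu> t]] by (auto simp: B_def)

lemma B_eq': "\<nu> > 0 \<Longrightarrow> B t \<nu> * (60 * (B t \<nu>)\<^sup>2 - 2 * t) = \<nu>"
  using B_eq[of \<nu> t] by (simp add: power2_eq_square power3_eq_cube algebra_simps)

lemma B_coeff_pos: "\<nu> > 0 \<Longrightarrow> 60 * (B t \<nu>)\<^sup>2 - 2 * t > 0"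
  using B_eq'[of \<nu> t] B_pos[of \<nu> t] by (metis zero_less_mult_pos)

lemma B_unique: "x > 0 \<Longrightarrow> \<nu> > 0 \<Longrightarrow> 60 * x ^ 3 - 2 * t * x = \<nu> \<Longrightarrow> B t \<nu> = x"
  using ex1_B[of \<nu> t] B_pos[of \<nu> t] B_eq[of \<nu> t] by blast

lemma B_strict_mono:
  assumes "0 < \<nu>" "\<nu> < \<nu>'"
  shows "B t \<nu> < B t \<nu>'"
proof (rule ccontr)
  assume "\<not> B t \<nu> < B t \<nu>'"
  then consider "B t \<nu>' < B t \<nu>" | "B t \<nu>' = B t \<nu>" by linarith
  then show False
    using cubic_strict_mono[of "B t \<nu>'" "B t \<nu>" t] B_eq[of \<nu> t] B_eq[of \<nu>' t] B_pos[of \<nu>' t] assms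
    by cases auto
qed

lemma B_mono: "0 < \<nu> \<Longrightarrow> \<nu> \<le> \<nu>' \<Longrightarrow> B t \<nu> \<le> B t \<nu>'"
  using B_strict_mono[of \<nu> \<nu>' t] by (cases "\<nu> = \<nu>'") auto

text \<open>The quotient \<nu> / B equals 60 B^2 - 2 t, which increases with B and hence with
  \<nu>.\<close>

lemma B_ratio_mono:
  assumes "0 < \<nu>" "\<nu> \<le> \<nu>'"
  shows "B t \<nu>' * \<nu> \<le> B t \<nu> * \<nu>'"
proof -
  have "(B t \<nu>)\<^sup>2 \<le> (B t \<nu>')\<^sup>2"
    using assms B_mono B_pos[of \<nu> t] by (intro power_mono) auto
  then have "B t \<nu> * B t \<nu>' * (60 * (B t \<nu>)\<^sup>2 - 2 * t) \<le> B t \<nu> * B t \<nu>' * (60 * (B t \<nu>')\<^sup>2 - 2 * t)"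
    using B_pos[of \<nu> t] B_pos[of \<nu>' t] assms by (intro mult_left_mono) auto
  then have "B t \<nu>' * (B t \<nu> * (60 * (B t \<nu>)\<^sup>2 - 2 * t)) \<le> B t \<nu> * (B t \<nu>' * (60 * (B t \<nu>')\<^sup>2 - 2 * t))"
    by (simp only: mult_ac)
  then show ?thesis
    using B_eq'[of \<nu> t] B_eq'[of \<nu>' t] assms by simp
qed

text \<open>
  The increments \<open>p\<close> and \<open>q\<close> of the cubic's root on either side of \<open>\<nu>\<close> satisfy
  \<open>q (60 (Y\<^sup>2 + Y Z + Z\<^sup>2) - 2 t) = s = p (60 (X\<^sup>2 + X Z + Z\<^sup>2) - 2 t)\<close>, so \<open>p - q\<close> is of second order.
\<close>

lemma B_second_difference:
  assumes s: "0 \<le> s" "2 * s \<le> \<nu>" "0 < \<nu>"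
  shows "0 \<le> 2 * B t \<nu> - B t (\<nu> - s) - B t (\<nu> + s)"
    and "2 * B t \<nu> - B t (\<nu> - s) - B t (\<nu> + s) \<le> 6 * B t \<nu> * (s / \<nu>)\<^sup>2"
    and "0 \<le> B t \<nu> - B t (\<nu> - s)" and "B t \<nu> - B t (\<nu> - s) \<le> B t \<nu> * (s / \<nu>)"
    and "0 \<le> B t (\<nu> + s) - B t \<nu>" and "B t (\<nu> + s) - B t \<nu> \<le> B t \<nu> * (s / \<nu>)"
proof -
  define X Y Z where XYZ: "X = B t (\<nu> - s)" "Y = B t (\<nu> + s)" "Z = B t \<nu>"
  have pos: "0 < X" "0 < Y" "0 < Z" using s by (auto simp: XYZ intro!: B_pos)
  have le: "X \<le> Z" "Z \<le> Y" using s by (auto simp: XYZ intro!: B_mono)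
  define p q where pq: "p = Z - X" "q = Y - Z"
  have pq0: "0 \<le> p" "0 \<le> q" using le by (auto simp: pq)
  define D where "D = 60 * (Y\<^sup>2 + Y * Z + Z\<^sup>2) - 2 * t"
  have Zc: "60 * Z\<^sup>2 - 2 * t > 0" unfolding XYZ by (rule B_coeff_pos) (use s in auto)
  then have D: "D \<ge> 60 * (Y * Y)" "D > 0"
    using mult_pos_pos[OF pos(2,3)] mult_pos_pos[OF pos(2,2)] by (simp_all add: D_def power2_eq_square)
  have eqs: "60 * X ^ 3 - 2 * t * X = \<nu> - s" "60 * Y ^ 3 - 2 * t * Y = \<nu> + s" "60 * Z ^ 3 - 2 * t * Z = \<nu>"
    using s by (auto simp: XYZ intro!: B_eq)
  have "(p - q) * D = 60 * p * (p + q) * (X + Y + Z)"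
    using eqs unfolding D_def pq by algebra
  note key = this
  have "0 \<le> 60 * p * (p + q) * (X + Y + Z)" using pq0 pos by auto
  with key D have qp: "q \<le> p" by (metis diff_ge_0_iff_ge zero_le_mult_iff not_le)
  show "0 \<le> 2 * B t \<nu> - B t (\<nu> - s) - B t (\<nu> + s)" using qp by (simp add: pq flip: XYZ)
  have "Z * (\<nu> - s) \<le> X * \<nu>"
    unfolding XYZ using B_ratio_mono[of "\<nu> - s" \<nu> t] s by auto
  then have "p * \<nu> \<le> Z * s" by (simp add: pq algebra_simps)
  then have pZ: "p \<le> Z * (s / \<nu>)" using s by (simp add: field_simps)
  show "0 \<le> B t \<nu> - B t (\<nu> - s)" "B t \<nu> - B t (\<nu> - s) \<le> B t \<nu> * (s / \<nu>)"
    "0 \<le> B t (\<nu> + s) - B t \<nu>" "B t (\<nu> + s) - B t \<nu> \<le> B t \<nu> * (s / \<nu>)"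
    using pZ pq0 qp by (auto simp: pq simp flip: XYZ)
  \<comment> \<open>Origin of the constant 6: D is at least 60 Y^2, while p + q <= 2 p and X + Y + Z
    <= 3 Y.\<close>
  have "(p - q) * (60 * (Y * Y)) \<le> (p - q) * D"
    using qp D by (intro mult_left_mono) auto
  also have "\<dots> \<le> 60 * p * (p + p) * (Y + Y + Y)"
    unfolding key using qp pq0 pos le by (intro mult_mono add_mono) auto
  finally have "Y * ((p - q) * Y) \<le> Y * (6 * p\<^sup>2)" by (simp add: power2_eq_square algebra_simps)
  then have "(p - q) * Y \<le> 6 * p\<^sup>2" using pos by (simp only: mult_le_cancel_left_pos)
  moreover have "(p - q) * Z \<le> (p - q) * Y" using le qp by (intro mult_left_mono) auto
  moreover have "p\<^sup>2 \<le> (Z * (s / \<nu>))\<^sup>2" using pZ pq0 by (intro power_mono) auto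
  ultimately have "(p - q) * Z \<le> 6 * (Z * (s / \<nu>))\<^sup>2" by linarith
  also have "\<dots> = (6 * Z * (s / \<nu>)\<^sup>2) * Z" by (simp add: power2_eq_square mult_ac)
  finally have "p - q \<le> 6 * Z * (s / \<nu>)\<^sup>2" using pos by (simp only: mult_le_cancel_right_pos)
  then show "2 * B t \<nu> - B t (\<nu> - s) - B t (\<nu> + s) \<le> 6 * B t \<nu> * (s / \<nu>)\<^sup>2"
    by (simp add: pq flip: XYZ)
qed

text \<open>The quadratic part of the string equation, with arguments standing for the indices n -
  2, ..., n + 2. Counted with multiplicity it has ten monomials.\<close>

definition string_sum :: "real \<Rightarrow> real \<Rightarrow> real \<Rightarrow> real \<Rightarrow> real \<Rightarrow> real" where
  "string_sum x2 x1 x y1 y2 = x2 * x1 + x1 * x1 + 2 * (x1 * x) + x1 * y1 + x * x + 2 * (x * y1) + y1 * y1 + y1 * y2"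

lemma string_equation_string_sum:
  "n > 0 \<Longrightarrow> b t n * (6 * string_sum (b t (n - 2)) (b t (n - 1)) (b t n) (b t (n + 1)) (b t (n + 2)) - 2 * t) = real n"
  by (subst string_equation) (auto simp: string_sum_def algebra_simps)

text \<open>Two measures of size are kept apart: \<delta> is a fixed a priori bound, W the actual
  size of the perturbations. The nonlinear error is then a small multiple of W and can be absorbed
  by a contraction. The 15 covers 3 * 31/10 from M - 1 and 4 from the products in R.\<close>

lemma cubic_monomial_perturbation:
  fixes M x y z \<delta> W :: real
  assumes M: "\<bar>M - 1\<bar> \<le> 3 * \<delta>" and \<delta>: "0 \<le> \<delta>" "\<delta> \<le> 1/1000"
    and W: "\<bar>x\<bar> \<le> W" "\<bar>y\<bar> \<le> W" "\<bar>z\<bar> \<le> W" "\<bar>x\<bar> \<le> \<delta>" "\<bar>y\<bar> \<le> \<delta>" "\<bar>z\<bar> \<le> \<delta>"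
  shows "\<bar>M * ((1 + x) * (1 + y) * (1 + z) - 1) - (x + y + z)\<bar> \<le> 15 * \<delta> * W"
proof -
  define R where "R = x * y + x * z + y * z + x * y * z"
  have W0: "0 \<le> W" using W by linarith
  have m: "\<bar>u * v\<bar> \<le> \<delta> * W" if "\<bar>u\<bar> \<le> \<delta>" "\<bar>v\<bar> \<le> W" for u v
    unfolding abs_mult using that \<delta> by (intro mult_mono) auto
  have "\<bar>x * y\<bar> \<le> \<delta>"
    unfolding abs_mult using W \<delta> mult_mono[of "\<bar>x\<bar>" 1 "\<bar>y\<bar>" \<delta>] by simp
  then have "\<bar>(x * y) * z\<bar> \<le> \<delta> * W" using W by (intro m)
  then have R: "\<bar>R\<bar> \<le> 4 * (\<delta> * W)"
    unfolding R_def using m[of x y] m[of x z] m[of y z] W by linarith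
  have "\<delta> * W \<le> 1/1000 * W" using \<delta> W0 by (intro mult_right_mono) auto
  have xyz: "\<bar>x + y + z + R\<bar> \<le> 31/10 * W"
  proof (rule abs_leI)
    show "x + y + z + R \<le> 31/10 * W"
      using R[THEN abs_le_D1] W(1-3)[THEN abs_le_D1] \<open>\<delta> * W \<le> 1/1000 * W\<close> W0 by linarith
    show "- (x + y + z + R) \<le> 31/10 * W"
      using R[THEN abs_le_D2] W(1-3)[THEN abs_le_D2] \<open>\<delta> * W \<le> 1/1000 * W\<close> W0 by linarith
  qed
  have "\<bar>(M - 1) * (x + y + z + R)\<bar> \<le> 3 * \<delta> * (31/10 * W)"
    unfolding abs_mult using M xyz \<delta> by (intro mult_mono) auto
  moreover have "M * ((1 + x) * (1 + y) * (1 + z) - 1) - (x + y + z) = (M - 1) * (x + y + z + R) + R"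
    by (simp add: R_def algebra_simps)
  moreover have "0 \<le> \<delta> * W" using \<delta> W0 by simp
  ultimately show ?thesis using R by linarith
qed

text \<open>
  Linearising the string equation at a slowly varying sequence gives the weights
  \<open>1, 6, 16, 6, 1\<close>; the diagonal weight 16 exceeds the sum 14 of the others, which makes the
  equation a contraction in the sup norm.
\<close>

lemma string_stability:
  fixes a x1 x2 y1 y2 :: real
  defines "\<delta> \<equiv> 1/1000"
  assumes a: "a > 0" and n: "n > 0"
    and near: "\<bar>x2 - a\<bar> \<le> \<delta> * a" "\<bar>x1 - a\<bar> \<le> \<delta> * a" "\<bar>y1 - a\<bar> \<le> \<delta> * a" "\<bar>y2 - a\<bar> \<le> \<delta> * a"
    and e: "\<bar>e\<bar> \<le> \<delta>" "\<bar>e1\<bar> \<le> \<delta>" "\<bar>e2\<bar> \<le> \<delta>" "\<bar>f1\<bar> \<le> \<delta>" "\<bar>f2\<bar> \<le> \<delta>"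
    and E: "\<bar>e1\<bar> \<le> E" "\<bar>e2\<bar> \<le> E" "\<bar>f1\<bar> \<le> E" "\<bar>f2\<bar> \<le> E"
    and F: "a * (1 + e) * (6 * string_sum (x2 * (1 + e2)) (x1 * (1 + e1)) (a * (1 + e)) (y1 * (1 + f1)) (y2 * (1 + f2)) - 2 * t) = n"
    and \<rho>: "\<bar>a * (6 * string_sum x2 x1 a y1 y2 - 2 * t) - n\<bar> \<le> \<rho> * n" "\<rho> \<le> \<delta>"
    and \<kappa>: "60 * a ^ 3 \<le> (1 + \<delta>) * n"
  shows "\<bar>e\<bar> \<le> 19/20 * E + 2 * \<rho>"
proof -
  define W where "W = E + \<bar>e\<bar>"
  have WW: "\<bar>e\<bar> \<le> W" "\<bar>e1\<bar> \<le> W" "\<bar>e2\<bar> \<le> W" "\<bar>f1\<bar> \<le> W" "\<bar>f2\<bar> \<le> W" using E by (auto simp: W_def)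
  have E0: "0 \<le> E" using E by linarith
  define r where "r = (\<lambda>u. u / a)"
  have r: "\<bar>r x2 - 1\<bar> \<le> \<delta>" "\<bar>r x1 - 1\<bar> \<le> \<delta>" "\<bar>r y1 - 1\<bar> \<le> \<delta>" "\<bar>r y2 - 1\<bar> \<le> \<delta>" "\<bar>r a - 1\<bar> \<le> \<delta>"
  proof -
    have "\<bar>r u - 1\<bar> \<le> \<delta>" if "\<bar>u - a\<bar> \<le> \<delta> * a" for u
    proof -
      have "r u - 1 = (u - a) / a" using a by (simp add: r_def diff_divide_distrib)
      then show ?thesis using that a by (simp add: abs_divide pos_divide_le_eq)
    qed
    from near[THEN this] this[of a] show "\<bar>r x2 - 1\<bar> \<le> \<delta>" "\<bar>r x1 - 1\<bar> \<le> \<delta>" "\<bar>r y1 - 1\<bar> \<le> \<delta>"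
      "\<bar>r y2 - 1\<bar> \<le> \<delta>" "\<bar>r a - 1\<bar> \<le> \<delta>" using a by (simp_all add: \<delta>_def)
  qed
  have ra: "r a = 1" using a by (simp add: r_def)
  have rr: "u = a * r u" for u using a by (simp add: r_def)
  have M: "\<bar>r u * r v - 1\<bar> \<le> 3 * \<delta>" if "\<bar>r u - 1\<bar> \<le> \<delta>" "\<bar>r v - 1\<bar> \<le> \<delta>" for u v
  proof -
    have "r u * r v - 1 = (r u - 1) * (r v - 1) + (r u - 1) + (r v - 1)" by (simp add: algebra_simps)
    moreover have "\<bar>(r u - 1) * (r v - 1)\<bar> \<le> \<delta> * 1"
      unfolding abs_mult using that by (intro mult_mono) (auto simp: \<delta>_def)
    ultimately show ?thesis using that by linarith
  qed
  let ?P = "\<lambda>u v x y. r u * r v * ((1 + e) * (1 + x) * (1 + y) - 1)"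
  have P: "\<bar>?P u v x y - (e + x + y)\<bar> \<le> 15 * \<delta> * W"
    if "\<bar>r u - 1\<bar> \<le> \<delta>" "\<bar>r v - 1\<bar> \<le> \<delta>" "\<bar>x\<bar> \<le> W" "\<bar>y\<bar> \<le> W" "\<bar>x\<bar> \<le> \<delta>" "\<bar>y\<bar> \<le> \<delta>" for u v x y
    by (rule cubic_monomial_perturbation[OF M[OF that(1,2)] _ _ WW(1) that(3,4) e(1) that(5,6)])
       (simp_all add: \<delta>_def)
  define V where "V = ?P x2 x1 e2 e1 + ?P x1 x1 e1 e1 + 2 * ?P x1 a e1 e + ?P x1 y1 e1 f1 + ?P a a e e
     + 2 * ?P a y1 e f1 + ?P y1 y1 f1 f1 + ?P y1 y2 f1 f2"
  have sum8: "\<bar>p1 + p2 + 2 * p3 + p4 + p5 + 2 * p6 + p7 + p8 - (l1 + l2 + 2 * l3 + l4 + l5 + 2 * l6 + l7 + l8)\<bar> \<le> 10 * c"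
    if "\<bar>p1 - l1\<bar> \<le> c" "\<bar>p2 - l2\<bar> \<le> c" "\<bar>p3 - l3\<bar> \<le> c" "\<bar>p4 - l4\<bar> \<le> c"
      "\<bar>p5 - l5\<bar> \<le> c" "\<bar>p6 - l6\<bar> \<le> c" "\<bar>p7 - l7\<bar> \<le> c" "\<bar>p8 - l8\<bar> \<le> c"
    for p1 p2 p3 p4 p5 p6 p7 p8 l1 l2 l3 l4 l5 l6 l7 l8 c :: real
  proof (rule abs_leI)
    show "p1 + p2 + 2 * p3 + p4 + p5 + 2 * p6 + p7 + p8 - (l1 + l2 + 2 * l3 + l4 + l5 + 2 * l6 + l7 + l8) \<le> 10 * c"
      using that[THEN abs_le_D1] by linarith
    show "- (p1 + p2 + 2 * p3 + p4 + p5 + 2 * p6 + p7 + p8 - (l1 + l2 + 2 * l3 + l4 + l5 + 2 * l6 + l7 + l8)) \<le> 10 * c"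
      using that[THEN abs_le_D2] by linarith
  qed
  have "\<bar>V - ((e + e2 + e1) + (e + e1 + e1) + 2 * (e + e1 + e) + (e + e1 + f1) + (e + e + e)
      + 2 * (e + e + f1) + (e + f1 + f1) + (e + f1 + f2))\<bar> \<le> 10 * (15 * \<delta> * W)"
    unfolding V_def
    by (rule sum8[OF P[OF r(1,2) WW(3,2) e(3,2)] P[OF r(2,2) WW(2,2) e(2,2)] P[OF r(2,5) WW(2,1) e(2,1)]
      P[OF r(2,3) WW(2,4) e(2,4)] P[OF r(5,5) WW(1,1) e(1,1)] P[OF r(5,3) WW(1,4) e(1,4)]
      P[OF r(3,3) WW(4,4) e(4,4)] P[OF r(3,4) WW(4,5) e(4,5)]])
  also have "(e + e2 + e1) + (e + e1 + e1) + 2 * (e + e1 + e) + (e + e1 + f1) + (e + e + e)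
      + 2 * (e + e + f1) + (e + f1 + f1) + (e + f1 + f2) = 16 * e + 6 * e1 + 6 * f1 + e2 + f2" by simp
  finally have V: "\<bar>V - (16 * e + 6 * e1 + 6 * f1 + e2 + f2)\<bar> \<le> 150 * \<delta> * W" by simp
  define Q where "Q = string_sum (r x2) (r x1) (r a) (r y1) (r y2)"
  have "\<bar>Q - (1 + 1 + 2 * 1 + 1 + 1 + 2 * 1 + 1 + 1)\<bar> \<le> 10 * (3 * \<delta>)"
    unfolding Q_def string_sum_def
    by (rule sum8[OF M[OF r(1,2)] M[OF r(2,2)] M[OF r(2,5)] M[OF r(2,3)] M[OF r(5,5)] M[OF r(5,3)]
      M[OF r(3,3)] M[OF r(3,4)]])
  then have Q: "\<bar>Q - 10\<bar> \<le> 30 * \<delta>" by simp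
  have hom: "string_sum (a * u2) (a * u1) (a * u) (a * v1) (a * v2) = a\<^sup>2 * string_sum u2 u1 u v1 v2" for u2 u1 u v1 v2
    by (simp add: string_sum_def power2_eq_square algebra_simps)
  let ?Z = "string_sum (r x2 * (1 + e2)) (r x1 * (1 + e1)) (1 + e) (r y1 * (1 + f1)) (r y2 * (1 + f2))"
  have FA: "a * (6 * string_sum x2 x1 a y1 y2 - 2 * t) = 6 * a ^ 3 * Q - 2 * t * a"
    unfolding Q_def using hom[of "r x2" "r x1" "r a" "r y1" "r y2"]
    by (simp add: rr[symmetric] power2_eq_square power3_eq_cube algebra_simps)
  have "string_sum (x2 * (1 + e2)) (x1 * (1 + e1)) (a * (1 + e)) (y1 * (1 + f1)) (y2 * (1 + f2))
      = a\<^sup>2 * ?Z"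
    unfolding hom[symmetric] mult.assoc[symmetric] rr[symmetric] ..
  then have "n = 6 * a ^ 3 * ((1 + e) * ?Z)
       - 2 * t * a * (1 + e)"
    using F by (simp add: power2_eq_square power3_eq_cube algebra_simps)
  also have "(1 + e) * ?Z = Q + V"
    unfolding Q_def V_def string_sum_def ra by (simp add: algebra_simps)
  finally have n_eq: "n = 6 * a ^ 3 * Q - 2 * t * a + (6 * a ^ 3 * V - 2 * t * a * e)"
    by (simp add: algebra_simps)
  \<comment> \<open>Shares of the cubic and the linear term relative to n; their sum is nearly 1. As
    t -> -infinity the share \<kappa> may become arbitrarily small, so no lower bound for it can be
    used. The diagonal weight 8/5 \<kappa> + \<tau> is about 1 + 3/5 \<kappa>, against 7/5 \<kappa>
    off the diagonal: the ratio is at most about 7/8, and 19/20 leaves room for the errors.\<close>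
  define \<kappa> where "\<kappa> = 60 * a ^ 3 / n"
  let ?k = "1 - \<delta> + 582/1000 * \<kappa>"
  define \<tau> where "\<tau> = - 2 * t * a / n"
  have \<kappa>': "0 < \<kappa>" "\<kappa> \<le> 1 + \<delta>" using a n \<kappa> by (auto simp: \<kappa>_def field_simps)
  have "\<bar>6 * a ^ 3 * V - 2 * t * a * e\<bar> \<le> \<rho> * n"
    using \<rho>(1) n_eq unfolding FA by linarith
  then have "\<bar>(6 * a ^ 3 * V - 2 * t * a * e) / n\<bar> \<le> \<rho>" using n by (simp add: abs_divide field_simps)
  also have "(6 * a ^ 3 * V - 2 * t * a * e) / n = \<kappa> * (V / 10) + \<tau> * e"
    by (simp add: \<kappa>_def \<tau>_def diff_divide_distrib)
  finally have main: "\<bar>\<kappa> * (V / 10) + \<tau> * e\<bar> \<le> \<rho>" .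
  have "\<bar>(6 * a ^ 3 * Q - 2 * t * a - n) / n\<bar> \<le> \<rho>"
    using \<rho>(1) n unfolding FA by (simp add: abs_divide field_simps)
  also have "(6 * a ^ 3 * Q - 2 * t * a - n) / n = \<kappa> * (Q / 10) + \<tau> - 1"
    using n by (simp add: \<kappa>_def \<tau>_def diff_divide_distrib)
  finally have \<tau>: "\<tau> \<ge> 1 - \<rho> - \<kappa> * (Q / 10)" by linarith
  have "\<kappa> * (Q / 10) \<le> \<kappa> * (1 + 3 * \<delta>)" using Q \<kappa>' by (intro mult_left_mono) auto
  with \<tau> have \<tau>': "\<tau> \<ge> 1 - \<rho> - \<kappa> * (1 + 3 * \<delta>)" by linarith
  have VV: "\<bar>V / 10 - 8/5 * e\<bar> \<le> 7/5 * E + 15 * \<delta> * W"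
  proof -
    have "\<bar>V - 16 * e\<bar> \<le> 14 * E + 150 * \<delta> * W"
    proof (rule abs_leI)
      show "V - 16 * e \<le> 14 * E + 150 * \<delta> * W"
        using V[THEN abs_le_D1] E[THEN abs_le_D1] by linarith
      show "- (V - 16 * e) \<le> 14 * E + 150 * \<delta> * W"
        using V[THEN abs_le_D2] E[THEN abs_le_D2] by linarith
    qed
    moreover have "V / 10 - 8/5 * e = (V - 16 * e) / 10" by simp
    ultimately show ?thesis by simp
  qed
  have "\<bar>\<kappa> * (V / 10 - 8/5 * e)\<bar> \<le> \<kappa> * (7/5 * E + 15 * \<delta> * W)"
    unfolding abs_mult using \<kappa>' VV by (intro mult_mono) auto
  moreover have "(8/5 * \<kappa> + \<tau>) * e = (\<kappa> * (V / 10) + \<tau> * e) - \<kappa> * (V / 10 - 8/5 * e)"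
    by (simp add: algebra_simps)
  ultimately have "\<bar>(8/5 * \<kappa> + \<tau>) * e\<bar> \<le> \<rho> + \<kappa> * (7/5 * E + 15 * \<delta> * W)"
    using main by linarith
  \<comment> \<open>Here 597/1000 = 8/5 - (1 + 3 \<delta>). Below, 582 = 597 - 15 and 1415 = 1400 +
    15 account for the nonlinear error 15 \<delta> W, split into its parts E and |e|.\<close>
  moreover have "(1 - \<rho> + 597/1000 * \<kappa>) * \<bar>e\<bar> \<le> \<bar>(8/5 * \<kappa> + \<tau>) * e\<bar>"
    unfolding abs_mult using \<tau>' by (intro mult_right_mono) (auto simp: \<delta>_def algebra_simps)
  moreover have "\<rho> + \<kappa> * (7/5 * E + 15 * \<delta> * W) = \<rho> + 1415/1000 * (\<kappa> * E) + 15/1000 * (\<kappa> * \<bar>e\<bar>)"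
    by (simp add: \<delta>_def W_def field_simps)
  moreover have "(1 - \<rho> + 597/1000 * \<kappa>) * \<bar>e\<bar> = (1 - \<rho> + 582/1000 * \<kappa>) * \<bar>e\<bar> + 15/1000 * (\<kappa> * \<bar>e\<bar>)"
    by (simp add: algebra_simps)
  ultimately have "(1 - \<rho> + 582/1000 * \<kappa>) * \<bar>e\<bar> \<le> \<rho> + 1415/1000 * (\<kappa> * E)"
    by linarith
  moreover have "\<rho> * \<bar>e\<bar> \<le> \<delta> * \<bar>e\<bar>" using \<rho> by (intro mult_right_mono) auto
  moreover have "?k * \<bar>e\<bar> = (1 - \<rho> + 582/1000 * \<kappa>) * \<bar>e\<bar> + \<rho> * \<bar>e\<bar> - \<delta> * \<bar>e\<bar>"
    by (simp add: algebra_simps)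
  ultimately have fin: "?k * \<bar>e\<bar> \<le> \<rho> + 1415/1000 * (\<kappa> * E)"
    by linarith
  have "\<kappa> * E \<le> 1001/1000 * E" using \<kappa>' E0 by (intro mult_right_mono) (auto simp: \<delta>_def)
  moreover have "?k * (19/20 * E) = 94905/100000 * E + 5529/10000 * (\<kappa> * E)"
    by (simp add: \<delta>_def field_simps)
  ultimately have "1415/1000 * (\<kappa> * E) \<le> ?k * (19/20 * E)"
    using E0 by linarith
  with fin have bound: "?k * (\<bar>e\<bar> - 19/20 * E) \<le> \<rho>" unfolding right_diff_distrib by linarith
  have half: "1/2 * (\<bar>e\<bar> - 19/20 * E) \<le> ?k * (\<bar>e\<bar> - 19/20 * E)" if "\<bar>e\<bar> - 19/20 * E \<ge> 0"
  proof (rule mult_right_mono)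
    show "1/2 \<le> 1 - \<delta> + 582/1000 * \<kappa>" using \<kappa>' unfolding \<delta>_def by linarith
  qed (rule that)
  have \<rho>0: "0 \<le> \<rho>"
  proof -
    have "0 \<le> \<rho> * n" using \<rho>(1) by linarith
    then show ?thesis using n by (simp add: zero_le_mult_iff)
  qed
  have "\<bar>e\<bar> - 19/20 * E \<le> 2 * \<rho>"
  proof (cases "\<bar>e\<bar> - 19/20 * E \<ge> 0")
    case True
    from order.trans[OF half[OF True] bound] show ?thesis by simp
  next
    case False
    with \<rho>0 show ?thesis by linarith
  qed
  then show ?thesis by linarith
qed

subsection \<open>Asymptotics of the recurrence coefficients, uniformly in \<open>t \<le> T\<close>\<close>

text \<open>With s the p-th root of q, the expression is the p-th power of (k + 1) s^k, which tends
  to 0.\<close>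

lemma power_times_geometric_bounded:
  fixes q :: real
  assumes "0 \<le> q" "q < 1"
  shows "\<exists>C. \<forall>k. real (Suc k) ^ p * q ^ k \<le> C"
proof (cases "p = 0")
  case True
  then show ?thesis using assms by (auto intro!: exI[of _ 1] power_le_one)
next
  case False
  define s where "s = root p q"
  have s: "0 \<le> s" "s < 1" "s ^ p = q"
    using False assms by (auto simp: s_def real_root_lt_1_iff real_root_pow_pos2)
  have "(\<lambda>k. (real k * s ^ k + s ^ k) ^ p) \<longlonglongrightarrow> (0 + 0) ^ p"
    using s by (intro tendsto_power tendsto_add powser_times_n_limit_0 LIMSEQ_realpow_zero) auto
  then have "Bseq (\<lambda>k. (real k * s ^ k + s ^ k) ^ p)" by (intro convergent_imp_Bseq convergentI)
  then obtain C where C: "norm ((real k * s ^ k + s ^ k) ^ p) \<le> C" for k by (auto simp: Bseq_def)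
  have "real (Suc k) ^ p * q ^ k = (real k * s ^ k + s ^ k) ^ p" for k
  proof -
    have "real k * s ^ k + s ^ k = real (Suc k) * s ^ k" by (simp add: algebra_simps)
    then show ?thesis
      by (simp only: power_mult_distrib s(3)[symmetric] power_mult[symmetric] mult.commute[of k p])
  qed
  then show ?thesis using C by (metis abs_ge_self order.trans real_norm_def)
qed

text \<open>
  Iterating the contraction \<open>n div 4\<close> times stays within indices \<open>\<ge> n div 2\<close>, so the
  a priori bound 1 is damped exponentially while the inhomogeneity keeps its order.
\<close>

lemma contraction_decay:
  fixes q K :: real
  assumes q: "0 \<le> q" "q < 1" and K: "K \<ge> 0"
  obtains C where "\<And>u n. (\<And>n. n \<ge> N \<Longrightarrow> u n \<le> 1) \<Longrightarrow>
     (\<And>n E. n \<ge> N + 2 \<Longrightarrow> (\<And>j. n \<le> j + 2 \<Longrightarrow> j \<le> n + 2 \<Longrightarrow> u j \<le> E) \<Longrightarrow> u n \<le> q * E + K / real n ^ p) \<Longrightarrow>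
     n \<ge> 4 * (N + 2) \<Longrightarrow> u n \<le> C / real n ^ p"
proof -
  obtain C0 where C0: "real (Suc k) ^ p * q ^ k \<le> C0" for k
    using power_times_geometric_bounded[OF q] by blast
  show thesis
  proof (rule that[of "4 ^ p * C0 + K * 2 ^ p / (1 - q)"])
    fix u :: "nat \<Rightarrow> real" and n :: nat
    assume u1: "u n \<le> 1" if "n \<ge> N" for n
    assume step: "u n \<le> q * E + K / real n ^ p"
      if "n \<ge> N + 2" "\<And>j. n \<le> j + 2 \<Longrightarrow> j \<le> n + 2 \<Longrightarrow> u j \<le> E" for n E
    assume n: "n \<ge> 4 * (N + 2)"
    define k where "k = n div 4"
    define m where "m = n - 2 * k"
    have m: "m \<ge> N + 2" "n \<le> 2 * m" "m + 2 * k = n" using n by (auto simp: m_def k_def)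
    \<comment> \<open>The fixed point of c -> q c + K / m^p, so that iterating the contraction
      leaves only the geometric term on top of it.\<close>
    define c where "c = K / real m ^ p / (1 - q)"
    have c: "c \<ge> 0" "q * c + K / real m ^ p = c"
    proof -
      show "c \<ge> 0" using q K by (simp add: c_def)
      define d where "d = K / real m ^ p"
      have "q * (d / (1 - q)) + d = d / (1 - q)" using q by (simp add: field_simps)
      then show "q * c + K / real m ^ p = c" by (simp add: c_def flip: d_def)
    qed
    have "\<forall>n\<ge>m + 2 * i. u n \<le> q ^ i + c" for i
    proof (induction i)
      case 0
      then show ?case using u1 m c by (auto intro: order.trans[OF u1])
    next
      case (Suc i)
      show ?case
      proof (intro allI impI)
        fix n assume n: "m + 2 * Suc i \<le> n"
        have "u n \<le> q * (q ^ i + c) + K / real n ^ p"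
          using n m Suc.IH by (intro step) auto
        also have "K / real n ^ p \<le> K / real m ^ p"
          using K n m by (intro divide_left_mono power_mono mult_pos_pos) auto
        finally show "u n \<le> q ^ Suc i + c" using c by (simp add: algebra_simps)
      qed
    qed
    then have "u n \<le> q ^ k + c" using m by auto
    also have "q ^ k \<le> 4 ^ p * C0 / real n ^ p"
    proof -
      have "n \<le> 4 * Suc k" unfolding k_def by simp
      then have "real n \<le> 4 * real (Suc k)" by linarith
      then have "real n ^ p \<le> (4 * real (Suc k)) ^ p" by (intro power_mono) auto
      then have "real n ^ p * q ^ k \<le> (4 * real (Suc k)) ^ p * q ^ k"
        using q by (intro mult_right_mono) auto
      also have "\<dots> = 4 ^ p * (real (Suc k) ^ p * q ^ k)" by (simp only: power_mult_distrib mult.assoc)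
      also have "\<dots> \<le> 4 ^ p * C0" by (intro mult_left_mono C0) auto
      finally show ?thesis using n by (simp add: field_simps)
    qed
    also have "c \<le> K * 2 ^ p / (1 - q) / real n ^ p"
    proof -
      have "real n ^ p \<le> (2 * real m) ^ p" using m by (intro power_mono) auto
      then have "1 / real m ^ p \<le> 2 ^ p / real n ^ p"
        using m n by (simp add: field_simps power_mult_distrib)
      then have "K / (1 - q) * (1 / real m ^ p) \<le> K / (1 - q) * (2 ^ p / real n ^ p)"
        using q K by (intro mult_left_mono) auto
      then show ?thesis by (simp add: c_def mult_ac)
    qed
    finally show "u n \<le> (4 ^ p * C0 + K * 2 ^ p / (1 - q)) / real n ^ p"
      by (simp add: add_divide_distrib)
  qed
qed

text \<open>Only this one-sided bound is uniform in t <= T, since 60 B^3 / \<nu> tends to 0 as t ->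
  -infinity. For t <= 0 it is immediate; for 0 < t <= T the choice of K makes B^2 so large that 2 t
  is at most \<epsilon> times 60 B^2 - 2 t.\<close>

lemma sixty_B_cube_le:
  assumes "\<epsilon> > 0"
  obtains N where "\<And>\<nu> t. \<nu> \<ge> N \<Longrightarrow> t \<le> T \<Longrightarrow> 60 * B t \<nu> ^ 3 \<le> (1 + \<epsilon>) * \<nu>"
proof -
  define T' where "T' = max T 0"
  define K where "K = 1 + T' + T' / \<epsilon>"
  have T': "T' \<ge> 0" by (simp add: T'_def)
  have K: "K \<ge> 1" using T' assms by (simp add: K_def)
  show thesis
  proof (rule that[of "60 * K ^ 3"])
    fix \<nu> t assume \<nu>: "\<nu> \<ge> 60 * K ^ 3" and t: "t \<le> T"
    have "60 * K ^ 3 > 0" using K by simp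
    then have \<nu>0: "\<nu> > 0" using \<nu> by linarith
    note B = B_pos[OF \<nu>0, of t] B_eq[OF \<nu>0, of t]
    show "60 * B t \<nu> ^ 3 \<le> (1 + \<epsilon>) * \<nu>"
    proof (cases "t \<le> 0")
      case True
      then have "2 * t * B t \<nu> \<le> 0" using B by (simp add: mult_le_0_iff)
      moreover have "0 \<le> \<epsilon> * \<nu>" using assms \<nu>0 by simp
      ultimately show ?thesis using B by (simp add: distrib_right)
    next
      case False
      then have "0 \<le> 2 * t * B t \<nu>" using B by simp
      then have "\<nu> \<le> 60 * B t \<nu> ^ 3" using B by linarith
      then have "K ^ 3 \<le> B t \<nu> ^ 3" using \<nu> by linarith
      then have KB: "K \<le> B t \<nu>" using B K power_mono_iff[of K "B t \<nu>" 3] by simp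
      have "K * K \<le> B t \<nu> * B t \<nu>" using KB K by (intro mult_mono) auto
      moreover have "1 * K \<le> K * K" using K by (intro mult_right_mono) auto
      ultimately have KB2: "K \<le> (B t \<nu>)\<^sup>2" by (simp add: power2_eq_square)
      have tT: "t \<le> T'" using t by (simp add: T'_def)
      have "2 * t * (1 + \<epsilon>) \<le> \<epsilon> * (60 * K)"
      proof -
        have "\<epsilon> * (60 * K) = 60 * \<epsilon> + 60 * (\<epsilon> * T') + 60 * T'" using assms by (simp add: K_def field_simps)
        moreover have "t * (1 + \<epsilon>) \<le> T' * (1 + \<epsilon>)" using tT assms by (intro mult_right_mono) auto
        moreover have "0 \<le> \<epsilon> * T'" using T' assms by simp
        moreover have "2 * t * (1 + \<epsilon>) = 2 * (t * (1 + \<epsilon>))" "T' * (1 + \<epsilon>) = T' + \<epsilon> * T'"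
          by (simp_all add: algebra_simps)
        ultimately show ?thesis using assms T' by linarith
      qed
      also have "\<dots> \<le> \<epsilon> * (60 * (B t \<nu>)\<^sup>2)" using KB2 assms by (intro mult_left_mono) auto
      finally have "2 * t \<le> \<epsilon> * (60 * (B t \<nu>)\<^sup>2 - 2 * t)" by (simp add: algebra_simps)
      then have "B t \<nu> * (2 * t) \<le> B t \<nu> * (\<epsilon> * (60 * (B t \<nu>)\<^sup>2 - 2 * t))"
        using B by (intro mult_left_mono) auto
      also have "\<dots> = \<epsilon> * \<nu>" using B_eq'[OF \<nu>0, of t] by (simp add: mult_ac)
      finally show ?thesis using B by (simp add: algebra_simps)
    qed
  qed
qed

section \<open>Slow variation of \<open>B\<close> and Freud's comparison of upper and lower
  limits\<close>

lemma B_window: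
  assumes "n \<ge> 4" "n \<le> j + 2" "j \<le> n + 2"
  shows "\<bar>B t (real j) - B t (real n)\<bar> \<le> 2 / real n * B t (real n)"
proof -
  define s where "s = \<bar>real j - real n\<bar>"
  have s: "0 \<le> s" "s \<le> 2" unfolding s_def using assms by linarith+
  then have s4: "2 * s \<le> real n" using assms by linarith
  have "B t (real n) * (s / real n) \<le> B t (real n) * (2 / real n)"
    using s assms B_pos[of "real n" t] by (intro mult_left_mono divide_right_mono) auto
  moreover have "real j = real n + s \<or> real j = real n - s" by (auto simp: s_def)
  ultimately show ?thesis
    using B_second_difference(3-6)[of s "real n" t] s s4 assms by (auto simp: mult.commute)
qed

text \<open>Equals x * \<open>string_sum m m x m m\<close> / 10: the cubic part of the string
  equation with middle value x and all neighbours m, normalised to 1 at x = m = 1.\<close>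

definition freud :: "real \<Rightarrow> real \<Rightarrow> real" where
  "freud x m = (x ^ 3 + 4 * x\<^sup>2 * m + 5 * x * m\<^sup>2) / 10"

lemma freud_mono: "0 \<le> x \<Longrightarrow> x \<le> x' \<Longrightarrow> 0 \<le> m \<Longrightarrow> m \<le> m' \<Longrightarrow> freud x m \<le> freud x' m'"
  unfolding freud_def by (intro divide_right_mono add_mono mult_mono power_mono) auto

lemma string_sum_mono:
  assumes "0 \<le> l" "0 \<le> x" "l \<le> x2" "l \<le> x1" "l \<le> y1" "l \<le> y2"
  shows "string_sum l l x l l \<le> string_sum x2 x1 x y1 y2"
  unfolding string_sum_def using assms by (intro add_mono mult_mono mult_left_mono) auto

lemma string_sum_mono':
  assumes "0 \<le> x" "0 \<le> x2" "0 \<le> x1" "0 \<le> y1" "0 \<le> y2" "x2 \<le> l" "x1 \<le> l" "y1 \<le> l" "y2 \<le> l"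
  shows "string_sum x2 x1 x y1 y2 \<le> string_sum l l x l l"
  unfolding string_sum_def using assms by (intro add_mono mult_mono mult_left_mono) auto

lemma string_sum_const: "string_sum l l x l l = 5 * l\<^sup>2 + 4 * (l * x) + x\<^sup>2"
  by (simp add: string_sum_def power2_eq_square)

text \<open>All neighbours in the string equation are replaced by their lower bound, and the result
  is divided by n. The factor (1 - \<epsilon>)^2 pays for the variation of \<open>B\<close> over the
  window. The linear term has weight 1 - \<kappa> because -2 t B / n = 1 - \<kappa> by the equation
  defining \<open>B\<close>.\<close>

lemma freud_lower_ineq:
  assumes n: "n \<ge> 4" and \<epsilon>: "2 / real n \<le> \<epsilon>" "\<epsilon> \<le> 1" and m: "0 \<le> m"
    and x: "\<And>j. n \<le> j + 2 \<Longrightarrow> j \<le> n + 2 \<Longrightarrow> m * B t (real j) \<le> b t j"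
  defines "\<kappa> \<equiv> 60 * B t (real n) ^ 3 / real n" and "X \<equiv> b t n / B t (real n)"
  shows "\<kappa> * ((1 - \<epsilon>)\<^sup>2 * freud X m) + (1 - \<kappa>) * X \<le> 1"
proof -
  let ?S = "string_sum (b t (n - 2)) (b t (n - 1)) (b t n) (b t (n + 1)) (b t (n + 2))"
  define a where "a = B t (real n)"
  have n0: "real n > 0" using n by simp
  have a: "a > 0" using n by (simp add: a_def B_pos)
  have bX: "b t n = a * X" using a by (simp add: X_def a_def)
  have X0: "X \<ge> 0" using a b_nonneg[of t n] by (simp add: X_def a_def)
  let ?C = "(1 - \<epsilon>)\<^sup>2 * (a\<^sup>2 * (5 * m\<^sup>2 + 4 * (m * X) + X\<^sup>2))"
  define l where "l = (1 - \<epsilon>) * a * m"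
  have l0: "0 \<le> l" using \<epsilon> a m by (simp add: l_def)
  have l: "l \<le> b t j" if j: "n \<le> j + 2" "j \<le> n + 2" for j
  proof -
    have "2 / real n * a \<le> \<epsilon> * a" using \<epsilon> a by (intro mult_right_mono) auto
    then have "(1 - \<epsilon>) * a \<le> B t (real j)"
      using B_window[OF n j, of t] unfolding a_def by (simp add: algebra_simps)
    then have "l \<le> B t (real j) * m" unfolding l_def using m by (intro mult_right_mono)
    then show ?thesis using x[OF j] by (simp add: mult.commute)
  qed
  have "?C \<le> string_sum l l (b t n) l l"
  proof -
    have e: "(1 - \<epsilon>)\<^sup>2 \<le> 1 - \<epsilon>" "(1 - \<epsilon>)\<^sup>2 \<le> 1"
    proof -
      have "0 < 2 / real n" using n0 by simp
      then have e0: "0 \<le> 1 - \<epsilon>" "1 - \<epsilon> \<le> 1" using \<epsilon> by linarith+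
      then have "(1 - \<epsilon>) * (1 - \<epsilon>) \<le> (1 - \<epsilon>) * 1" by (intro mult_left_mono) auto
      then show "(1 - \<epsilon>)\<^sup>2 \<le> 1 - \<epsilon>" by (simp add: power2_eq_square)
      then show "(1 - \<epsilon>)\<^sup>2 \<le> 1" using e0 by linarith
    qed
    have "(1 - \<epsilon>)\<^sup>2 * (4 * (a\<^sup>2 * (m * X))) \<le> (1 - \<epsilon>) * (4 * (a\<^sup>2 * (m * X)))"
      using e m X0 by (intro mult_right_mono) auto
    moreover have "(1 - \<epsilon>)\<^sup>2 * (a\<^sup>2 * X\<^sup>2) \<le> 1 * (a\<^sup>2 * X\<^sup>2)"
      using e by (intro mult_right_mono) auto
    moreover have "string_sum l l (b t n) l l = (1 - \<epsilon>)\<^sup>2 * (a\<^sup>2 * (5 * m\<^sup>2)) + (1 - \<epsilon>) * (4 * (a\<^sup>2 * (m * X))) + 1 * (a\<^sup>2 * X\<^sup>2)"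
      unfolding string_sum_const l_def bX by (simp add: power2_eq_square algebra_simps)
    ultimately show ?thesis by (simp add: distrib_left mult_ac)
  qed
  also have "\<dots> \<le> ?S"
    using n by (intro string_sum_mono l0 b_nonneg l) auto
  finally have S: "?C
     \<le> ?S" .
  have eq: "60 * a ^ 3 - 2 * t * a = real n" unfolding a_def by (rule B_eq) (use n in auto)
  have "a * X * (6 * (?C) - 2 * t) \<le> real n"
  proof -
    have "a * X * (6 * (?C) - 2 * t) \<le> a * X * (6 * ?S - 2 * t)"
      using S a X0 by (intro mult_left_mono) auto
    then show ?thesis using string_equation_string_sum[of n t] n by (simp flip: bX)
  qed
  also have "a * X * (6 * (?C) - 2 * t)
     = 60 * a ^ 3 * ((1 - \<epsilon>)\<^sup>2 * freud X m) + (real n - 60 * a ^ 3) * X"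
    unfolding eq[symmetric] freud_def by (simp add: power2_eq_square power3_eq_cube algebra_simps)
  also have "60 * a ^ 3 * ((1 - \<epsilon>)\<^sup>2 * freud X m) + (real n - 60 * a ^ 3) * X = (\<kappa> * ((1 - \<epsilon>)\<^sup>2 * freud X m) + (1 - \<kappa>) * X) * real n"
  proof -
    have "60 * a ^ 3 = \<kappa> * real n" using n0 by (simp add: \<kappa>_def a_def)
    then show ?thesis by (simp only:) (simp add: algebra_simps)
  qed
  finally show ?thesis using n0 by (simp add: pos_le_divide_eq[symmetric])
qed

lemma freud_upper_ineq:
  assumes n: "n \<ge> 4" and \<epsilon>: "2 / real n \<le> \<epsilon>" and M: "0 \<le> M"
    and x: "\<And>j. n \<le> j + 2 \<Longrightarrow> j \<le> n + 2 \<Longrightarrow> b t j \<le> M * B t (real j)"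
  defines "\<kappa> \<equiv> 60 * B t (real n) ^ 3 / real n" and "X \<equiv> b t n / B t (real n)"
  shows "1 \<le> \<kappa> * ((1 + \<epsilon>)\<^sup>2 * freud X M) + (1 - \<kappa>) * X"
proof -
  let ?S = "string_sum (b t (n - 2)) (b t (n - 1)) (b t n) (b t (n + 1)) (b t (n + 2))"
  define a where "a = B t (real n)"
  have n0: "real n > 0" using n by simp
  have "0 < 2 / real n" using n0 by simp
  then have \<epsilon>0: "\<epsilon> > 0" using \<epsilon> by linarith
  have a: "a > 0" using n by (simp add: a_def B_pos)
  have bX: "b t n = a * X" using a by (simp add: X_def a_def)
  have X0: "X \<ge> 0" using a b_nonneg[of t n] by (simp add: X_def a_def)
  let ?C = "(1 + \<epsilon>)\<^sup>2 * (a\<^sup>2 * (5 * M\<^sup>2 + 4 * (M * X) + X\<^sup>2))"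
  define l where "l = (1 + \<epsilon>) * a * M"
  have l: "b t j \<le> l" if j: "n \<le> j + 2" "j \<le> n + 2" for j
  proof -
    have "2 / real n * a \<le> \<epsilon> * a" using \<epsilon> a by (intro mult_right_mono) auto
    then have "B t (real j) \<le> (1 + \<epsilon>) * a"
      using B_window[OF n j, of t] unfolding a_def by (simp add: algebra_simps)
    then have "B t (real j) * M \<le> l" unfolding l_def using M by (intro mult_right_mono)
    then show ?thesis using x[OF j] by (simp add: mult.commute)
  qed
  have S: "?S \<le> string_sum l l (b t n) l l"
    using n by (intro string_sum_mono' b_nonneg l) auto
  also have "\<dots> \<le> ?C"
  proof -
    have e: "1 + \<epsilon> \<le> (1 + \<epsilon>)\<^sup>2" "1 \<le> (1 + \<epsilon>)\<^sup>2"
      using \<epsilon>0 by (auto simp: power2_eq_square algebra_simps)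
    have "(1 + \<epsilon>) * (4 * (a\<^sup>2 * (M * X))) \<le> (1 + \<epsilon>)\<^sup>2 * (4 * (a\<^sup>2 * (M * X)))"
      using e M X0 by (intro mult_right_mono) auto
    moreover have "1 * (a\<^sup>2 * X\<^sup>2) \<le> (1 + \<epsilon>)\<^sup>2 * (a\<^sup>2 * X\<^sup>2)"
      using e by (intro mult_right_mono) auto
    moreover have "string_sum l l (b t n) l l = (1 + \<epsilon>)\<^sup>2 * (a\<^sup>2 * (5 * M\<^sup>2)) + (1 + \<epsilon>) * (4 * (a\<^sup>2 * (M * X))) + 1 * (a\<^sup>2 * X\<^sup>2)"
      unfolding string_sum_const l_def bX by (simp add: power2_eq_square algebra_simps)
    ultimately show ?thesis by (simp add: distrib_left mult_ac)
  qed
  finally have S: "?S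
    \<le> ?C" .
  have eq: "60 * a ^ 3 - 2 * t * a = real n" unfolding a_def by (rule B_eq) (use n in auto)
  have "real n \<le> a * X * (6 * (?C) - 2 * t)"
  proof -
    have "a * X * (6 * ?S - 2 * t) \<le> a * X * (6 * (?C) - 2 * t)"
      using S a X0 by (intro mult_left_mono) auto
    then show ?thesis using string_equation_string_sum[of n t] n by (simp flip: bX)
  qed
  also have "a * X * (6 * (?C) - 2 * t)
     = 60 * a ^ 3 * ((1 + \<epsilon>)\<^sup>2 * freud X M) + (real n - 60 * a ^ 3) * X"
    unfolding eq[symmetric] freud_def by (simp add: power2_eq_square power3_eq_cube algebra_simps)
  also have "60 * a ^ 3 * ((1 + \<epsilon>)\<^sup>2 * freud X M) + (real n - 60 * a ^ 3) * X = (\<kappa> * ((1 + \<epsilon>)\<^sup>2 * freud X M) + (1 - \<kappa>) * X) * real n"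
  proof -
    have "60 * a ^ 3 = \<kappa> * real n" using n0 by (simp add: \<kappa>_def a_def)
    then show ?thesis by (simp only:) (simp add: algebra_simps)
  qed
  finally show ?thesis using n0 by (simp add: mult_le_cancel_right1)
qed

text \<open>The limit superior of the supremum over A, obtained as the infimum of all eventual
  uniform bounds. The near-extremal parameter may move with n, so no compactness of A
  enters.\<close>

lemma uniform_limsup:
  fixes x :: "nat \<Rightarrow> 'a \<Rightarrow> real"
  assumes A: "A \<noteq> {}" and bdd: "\<And>n t. n \<ge> N0 \<Longrightarrow> t \<in> A \<Longrightarrow> \<bar>x n t\<bar> \<le> C"
  obtains U where "\<And>\<epsilon>. \<epsilon> > 0 \<Longrightarrow> \<exists>N. \<forall>n\<ge>N. \<forall>t\<in>A. x n t \<le> U + \<epsilon>"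
    and "\<And>\<epsilon> N. \<epsilon> > 0 \<Longrightarrow> \<exists>n\<ge>N. \<exists>t\<in>A. x n t > U - \<epsilon>"
proof -
  define S where "S = {M. \<exists>N. \<forall>n\<ge>N. \<forall>t\<in>A. x n t \<le> M}"
  obtain t0 where t0: "t0 \<in> A" using A by blast
  have "C \<in> S" unfolding S_def using bdd by (auto simp: abs_le_iff intro!: exI[of _ N0])
  have bddS: "bdd_below S"
  proof (rule bdd_belowI)
    fix M assume "M \<in> S"
    then obtain N where "\<forall>n\<ge>N. \<forall>t\<in>A. x n t \<le> M" by (auto simp: S_def)
    then have "x (max N N0) t0 \<le> M" using t0 by auto
    moreover have "\<bar>x (max N N0) t0\<bar> \<le> C" using t0 by (intro bdd) auto
    ultimately show "- C \<le> M" by linarith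
  qed
  show thesis
  proof (rule that[of "Inf S"])
    fix \<epsilon> :: real assume "\<epsilon> > 0"
    then have "\<exists>M\<in>S. M < Inf S + \<epsilon>" using \<open>C \<in> S\<close> bddS by (subst cInf_less_iff[symmetric]) auto
    then show "\<exists>N. \<forall>n\<ge>N. \<forall>t\<in>A. x n t \<le> Inf S + \<epsilon>" unfolding S_def by force
  next
    fix \<epsilon> :: real and N assume "\<epsilon> > 0"
    show "\<exists>n\<ge>N. \<exists>t\<in>A. x n t > Inf S - \<epsilon>"
    proof (rule ccontr)
      assume "\<not> ?thesis"
      then have "Inf S - \<epsilon> \<in> S" unfolding S_def by (auto simp: not_less)
      then have "Inf S \<le> Inf S - \<epsilon>" using bddS by (rule cInf_lower)
      then show False using \<open>\<epsilon> > 0\<close> by simp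
    qed
  qed
qed

lemma isCont_pos_right:
  fixes g :: "real \<Rightarrow> real"
  assumes g: "isCont g 0" and d: "0 < d" "0 < g 0"
  obtains e where "e > 0" "e < d" "g e > 0"
proof -
  have "(g \<longlongrightarrow> g 0) (at_right 0)" using g by (simp add: isCont_def filterlim_at_split)
  then have "\<forall>\<^sub>F e in at_right 0. g e > 0" using d(2) by (rule order_tendstoD)
  moreover have "\<forall>\<^sub>F e in at_right 0. e \<in> {0<..<d}" using d by (intro eventually_at_right_real)
  ultimately have "\<forall>\<^sub>F e in at_right 0. g e > 0 \<and> 0 < e \<and> e < d" by eventually_elim auto
  then obtain e where "g e > 0 \<and> 0 < e \<and> e < d"
    using eventually_happens'[OF trivial_limit_at_right_real] by blast
  then show thesis using that by blast
qed

lemma freud_diff: "10 * freud x y - 10 * freud y x = (x - y) * (x\<^sup>2 + y\<^sup>2)"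
  by (simp add: freud_def field_simps power2_eq_square power3_eq_cube)

text \<open>
  Freud's argument: with \<open>U\<close> and \<open>L\<close> the upper and lower limit of \<open>b/B\<close>, uniformly in
  \<open>t \<le> T\<close>, the string equation at near-extremal indices gives \<open>freud U L \<le> 1 \<le> freud L U\<close>,
  which forces \<open>U = L\<close>.
\<close>

theorem b_asymp_B:
  assumes \<epsilon>: "\<epsilon> > 0"
  shows "\<exists>N. \<forall>n\<ge>N. \<forall>t\<le>T. \<bar>b t n / B t (real n) - 1\<bar> \<le> \<epsilon>"
proof -
  define x where "x = (\<lambda>n t. b t n / B t (real n))"
  define \<kappa> where "\<kappa> = (\<lambda>n t. 60 * B t (real n) ^ 3 / real n)"
  have x0: "x n t \<ge> 0" if "n > 0" for n t
    using that b_nonneg[of t n] B_pos[of "real n" t] by (simp add: x_def)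
  have xB: "b t n = x n t * B t (real n)" if "n > 0" for n t
    using that B_pos[of "real n" t] by (simp add: x_def)
  have \<kappa>0: "\<kappa> n t > 0" if "n > 0" for n t
    using that B_pos[of "real n" t] by (simp add: \<kappa>_def)
  have ev: "\<exists>N. \<forall>n\<ge>N. \<forall>t\<le>T. n \<ge> 4 \<and> 2 / real n \<le> e \<and> \<kappa> n t \<le> 1 + e" if e: "e > 0" for e
  proof -
    obtain N where N: "\<And>\<nu> t. \<nu> \<ge> N \<Longrightarrow> t \<le> T \<Longrightarrow> 60 * B t \<nu> ^ 3 \<le> (1 + e) * \<nu>"
      using sixty_B_cube_le[OF e, of T] by blast
    show ?thesis
    proof (intro exI[of _ "4 + nat \<lceil>2 / e\<rceil> + nat \<lceil>N\<rceil>"] allI impI)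
      fix n :: nat and t assume n: "4 + nat \<lceil>2 / e\<rceil> + nat \<lceil>N\<rceil> \<le> n" and t: "t \<le> T"
      have "real n \<ge> N" "real n \<ge> 2 / e" using n by linarith+
      then show "n \<ge> 4 \<and> 2 / real n \<le> e \<and> \<kappa> n t \<le> 1 + e"
        using n N[of "real n" t] t e by (auto simp: \<kappa>_def field_simps)
    qed
  qed
  \<comment> \<open>An a priori bound, without which the upper limit might be infinite: all
    neighbours are dropped by taking m = 0, and the remaining cube of X alone exceeds the right
    side.\<close>
  have x3: "\<exists>N. \<forall>n\<ge>N. \<forall>t\<le>T. x n t \<le> 3"
  proof -
    obtain N where N: "\<forall>n\<ge>N. \<forall>t\<le>T. n \<ge> 4 \<and> 2 / real n \<le> 1/10 \<and> \<kappa> n t \<le> 1 + 1/10"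
      using ev[of "1/10"] by auto
    show ?thesis
    proof (intro exI[of _ N] allI impI, rule ccontr)
      fix n t assume n: "N \<le> n" "t \<le> T" and "\<not> x n t \<le> 3"
      then have X: "x n t > 3" by simp
      define X k where "X = x n t" "k = \<kappa> n t"
      have n4: "n \<ge> 4" using N n by blast
      have "0 < \<kappa> n t" using n4 by (intro \<kappa>0) simp
      then have k: "0 < k" "k \<le> 11/10" using N n by (auto simp: X_k_def)
      have "k * ((1 - 1/10)\<^sup>2 * freud X 0) + (1 - k) * X \<le> 1"
        unfolding X_k_def x_def \<kappa>_def using N n by (intro freud_lower_ineq b_nonneg) (auto simp: b_nonneg)
      then have "X * (k * (81/1000 * X\<^sup>2) + (1 - k)) \<le> 1"
        by (simp add: freud_def power2_eq_square power3_eq_cube algebra_simps)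
      moreover have "3 * (7/10) \<le> X * (k * (81/1000 * X\<^sup>2) + (1 - k))"
      proof (rule mult_mono)
        have "3\<^sup>2 \<le> X\<^sup>2" using X by (intro power_mono) (auto simp: X_k_def)
        then have "k * (729/1000) \<le> k * (81/1000 * X\<^sup>2)" using k by (intro mult_left_mono) auto
        then show "7/10 \<le> k * (81/1000 * X\<^sup>2) + (1 - k)" using k by linarith
      qed (use X in \<open>auto simp: X_k_def\<close>)
      ultimately show False by simp
    qed
  qed
  then obtain N3 where N3: "\<And>n t. n \<ge> N3 \<Longrightarrow> t \<le> T \<Longrightarrow> x n t \<le> 3" by blast
  have bdd: "\<bar>x n t\<bar> \<le> 3" if "n \<ge> Suc N3" "t \<in> {..T}" for n t
    using N3[of n t] x0[of n t] that by simp
  obtain U where U1: "\<And>\<epsilon>. \<epsilon> > 0 \<Longrightarrow> \<exists>N. \<forall>n\<ge>N. \<forall>t\<in>{..T}. x n t \<le> U + \<epsilon>"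
    and U2: "\<And>\<epsilon> N. \<epsilon> > 0 \<Longrightarrow> \<exists>n\<ge>N. \<exists>t\<in>{..T}. x n t > U - \<epsilon>"
    by (rule uniform_limsup[of "{..T}" "Suc N3" x 3]) (use bdd in auto)
  obtain L' where L1': "\<And>\<epsilon>. \<epsilon> > 0 \<Longrightarrow> \<exists>N. \<forall>n\<ge>N. \<forall>t\<in>{..T}. - x n t \<le> L' + \<epsilon>"
    and L2': "\<And>\<epsilon> N. \<epsilon> > 0 \<Longrightarrow> \<exists>n\<ge>N. \<exists>t\<in>{..T}. - x n t > L' - \<epsilon>"
    by (rule uniform_limsup[of "{..T}" "Suc N3" "\<lambda>n t. - x n t" 3]) (use bdd in auto)
  define L where "L = - L'"
  have L1: "\<exists>N. \<forall>n\<ge>N. \<forall>t\<le>T. L - e \<le> x n t" if "e > 0" for e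
    using L1'[OF that] unfolding L_def by (force simp: algebra_simps)
  have L2: "\<exists>n\<ge>N. \<exists>t\<le>T. x n t < L + e" if "e > 0" for e N
    using L2'[OF that, of N] unfolding L_def by (force simp: algebra_simps)
  have L0: "0 \<le> L"
  proof (rule field_le_epsilon)
    fix e :: real assume "e > 0"
    then obtain n t where "n \<ge> 1" "x n t < L + e" using L2[of e 1] by blast
    then show "0 \<le> L + e" using x0[of n t] by simp
  qed
  have LU: "L \<le> U"
  proof (rule field_le_epsilon)
    fix e :: real assume e: "e > 0"
    obtain N where N: "\<forall>n\<ge>N. \<forall>t\<le>T. L - e / 2 \<le> x n t" using L1[of "e / 2"] e by auto
    obtain N' where N': "\<forall>n\<ge>N'. \<forall>t\<in>{..T}. x n t \<le> U + e / 2" using U1[of "e / 2"] e by auto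
    have "L - e / 2 \<le> x (max N N') T" "x (max N N') T \<le> U + e / 2" using N N' by auto
    then show "L \<le> U + e" by linarith
  qed
  have upper: "U \<le> 1 \<or> freud U L \<le> 1"
  proof (rule ccontr)
    assume "\<not> ?thesis"
    then have U: "U > 1" "freud U L > 1" by auto
    \<comment> \<open>All slack is collected in one continuous function that is positive at 0, which
      yields a suitable e. The term 3 e pays for the case \<kappa> > 1, where (1 - \<kappa>) X is
      negative but at least -3 e because X <= 3.\<close>
    define g where "g = (\<lambda>e. (1 - e)\<^sup>2 * freud (U - e) (max 0 (L - e)) - (1 + 3 * e))"
    have "isCont g 0" unfolding g_def freud_def by (intro continuous_intros) auto
    moreover have "0 < min 1 (U - 1)" "0 < g 0" using U L0 by (simp_all add: g_def)
    ultimately obtain e where "e > 0" "e < min 1 (U - 1)" "g e > 0" by (rule isCont_pos_right)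
    then have e: "g e > 0" "e < 1" "e < U - 1" "e > 0" by auto
    define m where "m = max 0 (L - e)"
    obtain N1 where N1: "\<forall>n\<ge>N1. \<forall>t\<le>T. n \<ge> 4 \<and> 2 / real n \<le> e \<and> \<kappa> n t \<le> 1 + e" using ev e by blast
    obtain N2 where N2: "\<forall>n\<ge>N2. \<forall>t\<le>T. L - e \<le> x n t" using L1 e by blast
    obtain n t where n: "n \<ge> N1 + N2 + N3 + 4" "t \<le> T" "x n t > U - e"
      using U2[of e "N1 + N2 + N3 + 4"] e by auto
    define X k where "X = x n t" "k = \<kappa> n t"
    have k: "0 < k" "k \<le> 1 + e" using N1 n \<kappa>0[of n t] by (auto simp: X_k_def)
    have X: "1 < X" "U - e < X" "X \<le> 3" using n e N3[of n t] by (auto simp: X_k_def)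
    define G where "G = (1 - e)\<^sup>2 * freud X m"
    have ineq: "k * G + (1 - k) * X \<le> 1"
      unfolding X_k_def x_def \<kappa>_def G_def
    proof (intro freud_lower_ineq)
      fix j assume j: "n \<le> j + 2" "j \<le> n + 2"
      then have "L - e \<le> x j t" "0 \<le> x j t" "j > 0" using N2 n x0[of j t] by auto
      then have "m \<le> x j t" by (simp add: m_def)
      then show "m * B t (real j) \<le> b t j"
        using xB[of j t] B_pos[of "real j" t] \<open>j > 0\<close> by (auto intro: mult_right_mono)
    qed (use N1 n e in \<open>auto simp: m_def\<close>)
    have "freud (U - e) m \<le> freud X m" using X e by (intro freud_mono) (auto simp: m_def)
    then have "(1 - e)\<^sup>2 * freud (U - e) m \<le> G" unfolding G_def by (intro mult_left_mono) auto
    then have G: "G > 1 + 3 * e" using e(1) by (simp add: g_def m_def)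
    show False
    proof (cases "k \<le> 1")
      case True
      have "k * 1 < k * G" using G k e by (intro mult_strict_left_mono) auto
      moreover have "(1 - k) * 1 \<le> (1 - k) * X" using True X by (intro mult_left_mono) auto
      ultimately show False using ineq by simp
    next
      case False
      have "1 * G \<le> k * G" using False G e by (intro mult_right_mono) auto
      moreover have "(k - 1) * X \<le> e * 3" using False X k by (intro mult_mono) auto
      ultimately show False using ineq G by (simp add: left_diff_distrib)
    qed
  qed
  have lower: "L \<ge> 1 \<or> freud L U \<ge> 1"
  proof (rule ccontr)
    assume "\<not> ?thesis"
    then have U: "L < 1" "freud L U < 1" by auto
    define g where "g = (\<lambda>e. (1 + e) * ((1 + e)\<^sup>2 * freud (L + e) (U + e)) - 1)"
    have "isCont g 0" unfolding g_def freud_def by (intro continuous_intros) auto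
    then have "isCont (\<lambda>e. - g e) 0" by (rule continuous_minus)
    moreover have "0 < min 1 (1 - L)" "0 < - g 0" using U L0 by (simp_all add: g_def)
    ultimately obtain e where "e > 0" "e < min 1 (1 - L)" "- g e > 0" by (rule isCont_pos_right)
    then have e: "g e < 0" "e < 1" "e < 1 - L" "e > 0" by auto
    define M where "M = U + e"
    obtain N1 where N1: "\<forall>n\<ge>N1. \<forall>t\<le>T. n \<ge> 4 \<and> 2 / real n \<le> e \<and> \<kappa> n t \<le> 1 + e" using ev e by blast
    obtain N2 where N2: "\<forall>n\<ge>N2. \<forall>t\<in>{..T}. x n t \<le> U + e" using U1 e by blast
    obtain n t where n: "n \<ge> N1 + N2 + 4" "t \<le> T" "x n t < L + e"
      using L2[of e "N1 + N2 + 4"] e by auto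
    define X k where "X = x n t" "k = \<kappa> n t"
    have k: "0 < k" "k \<le> 1 + e" using N1 n \<kappa>0[of n t] by (auto simp: X_k_def)
    have X: "X < 1" "X < L + e" "0 \<le> X" using n e x0[of n t] by (auto simp: X_k_def)
    define G where "G = (1 + e)\<^sup>2 * freud X M"
    have ineq: "1 \<le> k * G + (1 - k) * X"
      unfolding X_k_def x_def \<kappa>_def G_def
    proof (intro freud_upper_ineq)
      fix j assume j: "n \<le> j + 2" "j \<le> n + 2"
      then have "x j t \<le> M" "j > 0" using N2 n by (auto simp: M_def)
      then show "b t j \<le> M * B t (real j)"
        using xB[of j t] B_pos[of "real j" t] by (auto intro: mult_right_mono)
    qed (use N1 n e L0 LU in \<open>auto simp: M_def\<close>)
    have "0 \<le> freud X M" unfolding freud_def using X L0 LU e by (auto simp: M_def)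
    then have G0: "0 \<le> G" by (simp add: G_def)
    have "freud X M \<le> freud (L + e) (U + e)" using X e L0 LU by (intro freud_mono) (auto simp: M_def)
    then have "(1 + e) * G \<le> (1 + e) * ((1 + e)\<^sup>2 * freud (L + e) (U + e))"
      unfolding G_def using e by (intro mult_left_mono) auto
    then have G: "(1 + e) * G < 1" using e(1) by (simp add: g_def)
    show False
    proof (cases "k \<le> 1")
      case True
      have "0 \<le> e * G" using e G0 by simp
      then have "G < 1" using G by (simp add: algebra_simps)
      then have "k * G < k * 1" using k by (intro mult_strict_left_mono) auto
      moreover have "(1 - k) * X \<le> (1 - k) * 1" using True X by (intro mult_left_mono) auto
      ultimately show False using ineq by simp
    next
      case False
      have "k * G \<le> (1 + e) * G" using k G0 by (intro mult_right_mono) auto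
      moreover have "(1 - k) * X \<le> 0" using False X by (auto intro: mult_nonpos_nonneg)
      ultimately show False using ineq G by linarith
    qed
  qed
  have f11: "freud 1 1 = 1" by (simp add: freud_def)
  \<comment> \<open>These two facts settle the cases where U and L lie on the same side of 1. The
    remaining case L < 1 < U is excluded by \<open>freud_diff\<close>.\<close>
  have gt1: "freud U L > 1" if "U > 1" "L \<ge> 1"
  proof -
    have "freud U 1 > 1"
    proof -
      have "U * 1 < U * U" "1 < U ^ 3" using that by (auto simp: one_less_power)
      moreover have "10 * freud U 1 = U ^ 3 + 4 * (U * U) + 5 * U"
        by (simp add: freud_def power2_eq_square)
      ultimately show ?thesis using that by linarith
    qed
    also have "freud U 1 \<le> freud U L" using that by (intro freud_mono) auto
    finally show ?thesis .
  qed
  have lt1: "freud L U < 1" if "U \<le> 1" "L < 1"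
  proof -
    have "freud L U \<le> freud L 1" using that L0 LU by (intro freud_mono) auto
    also have "\<dots> < 1"
    proof -
      have "L ^ 3 \<le> 1" "L\<^sup>2 \<le> 1" using that L0 by (auto intro: power_le_one)
      then show ?thesis using that by (simp add: freud_def)
    qed
    finally show ?thesis .
  qed
  have "U \<le> 1"
  proof (rule ccontr)
    assume "\<not> U \<le> 1"
    then have U: "U > 1" "freud U L \<le> 1" using upper by auto
    then have "L < 1" using gt1 by linarith
    then have "freud L U \<ge> 1" using lower by auto
    then have "(U - L) * (U\<^sup>2 + L\<^sup>2) \<le> 0" using U freud_diff[of U L] by linarith
    moreover have "(U - L) * (U\<^sup>2 + L\<^sup>2) > 0" using U \<open>L < 1\<close> by (intro mult_pos_pos add_pos_nonneg) auto
    ultimately show False by simp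
  qed
  moreover have "L \<ge> 1" using lower lt1 \<open>U \<le> 1\<close> by force
  ultimately have UL: "U = 1" "L = 1" using LU by auto
  obtain N where N: "\<forall>n\<ge>N. \<forall>t\<le>T. L - \<epsilon> \<le> x n t" using L1 \<epsilon> by blast
  obtain N' where N': "\<forall>n\<ge>N'. \<forall>t\<in>{..T}. x n t \<le> U + \<epsilon>" using U1 \<epsilon> by blast
  show ?thesis
  proof (intro exI[of _ "max N N'"] allI impI)
    fix n t assume "max N N' \<le> n" "t \<le> T"
    then have "1 - \<epsilon> \<le> x n t" "x n t \<le> 1 + \<epsilon>" using N N' UL by auto
    then show "\<bar>b t n / B t (real n) - 1\<bar> \<le> \<epsilon>" unfolding x_def by linarith
  qed
qed

text \<open>Turns mere closeness into a rate: the relative errors satisfy the contraction of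
  \<open>string_stability\<close>, and \<open>contraction_decay\<close> converts a residual of
  relative order n^-p into an error of the same order. It is applied to A = \<open>B\<close> with p
  = 2 on all t <= T, and to the formal solution with p = 3 on the single point t. The constants are
  uniform on I because those of \<open>contraction_decay\<close> do not depend on the
  sequence.\<close>

lemma string_refine:
  fixes A :: "real \<Rightarrow> nat \<Rightarrow> real" and K :: real
  defines "\<delta> \<equiv> 1/1000"
  assumes pos: "\<And>n t. n \<ge> N \<Longrightarrow> t \<in> I \<Longrightarrow> A t n > 0"
    and win: "\<And>n j t. n \<ge> N \<Longrightarrow> t \<in> I \<Longrightarrow> n \<le> j + 2 \<Longrightarrow> j \<le> n + 2 \<Longrightarrow> \<bar>A t j - A t n\<bar> \<le> \<delta> * A t n"
    and cube: "\<And>n t. n \<ge> N \<Longrightarrow> t \<in> I \<Longrightarrow> 60 * A t n ^ 3 \<le> (1 + \<delta>) * real n"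
    and close: "\<And>n t. n \<ge> N \<Longrightarrow> t \<in> I \<Longrightarrow> \<bar>b t n / A t n - 1\<bar> \<le> \<delta>"
    and res: "\<And>n t. n \<ge> N \<Longrightarrow> t \<in> I \<Longrightarrow>
       \<bar>A t n * (6 * string_sum (A t (n - 2)) (A t (n - 1)) (A t n) (A t (n + 1)) (A t (n + 2)) - 2 * t) - real n\<bar>
         \<le> K / real n ^ p * real n"
    and p: "p > 0" and K: "K \<ge> 0"
  shows "\<exists>C N'. \<forall>n\<ge>N'. \<forall>t\<in>I. \<bar>b t n / A t n - 1\<bar> \<le> C / real n ^ p"
proof -
  \<comment> \<open>Two extra indices keep the neighbours of n above N; beyond 1000 K the residual
    falls below the 1/1000 demanded by the stability lemma.\<close>
  define N1 where "N1 = N + 2 + nat \<lceil>1000 * K\<rceil>"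
  obtain C where C: "\<And>u n. (\<And>n. n \<ge> N1 \<Longrightarrow> u n \<le> 1) \<Longrightarrow>
     (\<And>n E. n \<ge> N1 + 2 \<Longrightarrow> (\<And>j. n \<le> j + 2 \<Longrightarrow> j \<le> n + 2 \<Longrightarrow> u j \<le> E) \<Longrightarrow> u n \<le> 19/20 * E + 2 * K / real n ^ p) \<Longrightarrow>
     n \<ge> 4 * (N1 + 2) \<Longrightarrow> u n \<le> C / real n ^ p"
    by (rule contraction_decay[of "19/20" "2 * K" N1 p]) (use K in auto)
  show ?thesis
  proof (intro exI[of _ C] exI[of _ "4 * (N1 + 2)"] allI impI ballI)
    fix n t assume n: "4 * (N1 + 2) \<le> n" and t: "t \<in> I"
    define e where "e = (\<lambda>n. b t n / A t n - 1)"
    have be: "b t n = A t n * (1 + e n)" if "n \<ge> N" for n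
      using pos[OF that t] by (simp add: e_def)
    have "\<bar>e n\<bar> \<le> C / real n ^ p"
    proof (rule C[of "\<lambda>n. \<bar>e n\<bar>" n])
      fix n assume "n \<ge> N1"
      then show "\<bar>e n\<bar> \<le> 1" using close[of n t] t by (auto simp: e_def N1_def \<delta>_def)
    next
      fix n and E :: real assume n: "n \<ge> N1 + 2" and E: "\<And>j. n \<le> j + 2 \<Longrightarrow> j \<le> n + 2 \<Longrightarrow> \<bar>e j\<bar> \<le> E"
      define \<rho> where "\<rho> = K / real n ^ p"
      have nN: "n \<ge> N" "n - 1 \<ge> N" "n - 2 \<ge> N" "n + 1 \<ge> N" "n + 2 \<ge> N" "n > 0" using n by (auto simp: N1_def)
      have "real n \<ge> 1" using n by simp
      then have "real n ^ 1 \<le> real n ^ p" using p by (intro power_increasing) auto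
      moreover have "1000 * K \<le> real n" using n unfolding N1_def by linarith
      ultimately have "1000 * K \<le> real n ^ p" unfolding power_one_right by (rule order.trans[rotated])
      then have \<rho>: "\<rho> \<le> 1/1000" using nN by (simp add: \<rho>_def field_simps)
      have "\<bar>e n\<bar> \<le> 19/20 * E + 2 * \<rho>"
      proof (rule string_stability[of "A t n" "real n"])
        show "0 < A t n" "0 < real n" using pos[of n t] nN t by auto
        show "\<bar>A t (n - 2) - A t n\<bar> \<le> 1/1000 * A t n" "\<bar>A t (n - 1) - A t n\<bar> \<le> 1/1000 * A t n"
          "\<bar>A t (n + 1) - A t n\<bar> \<le> 1/1000 * A t n" "\<bar>A t (n + 2) - A t n\<bar> \<le> 1/1000 * A t n"
          using win[OF nN(1) t] by (auto simp: \<delta>_def)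
        show "\<bar>e n\<bar> \<le> 1/1000" "\<bar>e (n - 1)\<bar> \<le> 1/1000" "\<bar>e (n - 2)\<bar> \<le> 1/1000"
          "\<bar>e (n + 1)\<bar> \<le> 1/1000" "\<bar>e (n + 2)\<bar> \<le> 1/1000"
          using close[OF _ t] nN by (auto simp: \<delta>_def e_def)
        show "\<bar>e (n - 1)\<bar> \<le> E" "\<bar>e (n - 2)\<bar> \<le> E" "\<bar>e (n + 1)\<bar> \<le> E" "\<bar>e (n + 2)\<bar> \<le> E"
          by (rule E; simp)+
        show "A t n * (1 + e n) * (6 * string_sum (A t (n - 2) * (1 + e (n - 2))) (A t (n - 1) * (1 + e (n - 1)))
            (A t n * (1 + e n)) (A t (n + 1) * (1 + e (n + 1))) (A t (n + 2) * (1 + e (n + 2))) - 2 * t) = real n"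
          using string_equation_string_sum[of n t] nN by (simp add: be)
        show "\<bar>A t n * (6 * string_sum (A t (n - 2)) (A t (n - 1)) (A t n) (A t (n + 1)) (A t (n + 2)) - 2 * t) - real n\<bar> \<le> \<rho> * real n"
          unfolding \<rho>_def by (rule res) (use nN t in auto)
        show "60 * A t n ^ 3 \<le> (1 + 1/1000) * real n" using cube[OF nN(1) t] by (simp add: \<delta>_def)
      qed (rule \<rho>)
      then show "\<bar>e n\<bar> \<le> 19/20 * E + 2 * K / real n ^ p" by (simp add: \<rho>_def)
    qed (rule n)
    then show "\<bar>b t n / A t n - 1\<bar> \<le> C / real n ^ p" by (simp add: e_def)
  qed
qed

text \<open>The weights of the linearised equation are symmetric about n, so the first-order
  variation of \<open>B\<close> over the window cancels. Only second differences and products of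
  first differences remain, all of relative order n^-2 uniformly in t.\<close>

theorem b_refined_B:
  "\<exists>C N. \<forall>n\<ge>N. \<forall>t\<le>T. \<bar>b t n / B t (real n) - 1\<bar> \<le> C / (real n)\<^sup>2"
proof -
  let ?S = "\<lambda>n t. string_sum (B t (real (n - 2))) (B t (real (n - 1))) (B t (real n)) (B t (real (n + 1))) (B t (real (n + 2)))"
  obtain N1 where N1: "\<forall>n\<ge>N1. \<forall>t\<le>T. \<bar>b t n / B t (real n) - 1\<bar> \<le> 1/1000"
    using b_asymp_B[of "1/1000" T] by auto
  obtain N2 where N2: "\<And>\<nu> t. \<nu> \<ge> N2 \<Longrightarrow> t \<le> T \<Longrightarrow> 60 * B t \<nu> ^ 3 \<le> (1 + 1/1000) * \<nu>"
    using sixty_B_cube_le[of "1/1000" T] by auto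
  define N where "N = N1 + nat \<lceil>N2\<rceil> + 2000"
  have "\<exists>C N'. \<forall>n\<ge>N'. \<forall>t\<in>{..T}. \<bar>b t n / B t (real n) - 1\<bar> \<le> C / real n ^ 2"
  proof (rule string_refine[of N "{..T}" "\<lambda>t n. B t (real n)" 9])
    fix n t assume n: "N \<le> n" and t: "t \<in> {..T}"
    have n0: "n \<ge> 2000" "n \<ge> N1" "real n \<ge> N2" using n unfolding N_def by linarith+
    define a where "a = B t (real n)"
    show a0: "B t (real n) > 0" using n0 by (simp add: B_pos)
    show "\<bar>b t n / B t (real n) - 1\<bar> \<le> 1 / 1000" using N1 n0 t by auto
    show cube: "60 * B t (real n) ^ 3 \<le> (1 + 1 / 1000) * real n" using N2 n0 t by auto
    show "\<bar>B t (real j) - B t (real n)\<bar> \<le> 1 / 1000 * B t (real n)" if j: "n \<le> j + 2" "j \<le> n + 2" for j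
    proof -
      have "2 / real n \<le> 1/1000" using n0 by (simp add: field_simps)
      then have "2 / real n * a \<le> 1/1000 * a" using a0 by (intro mult_right_mono) (auto simp: a_def)
      then show ?thesis using B_window[of n j t] n0 j by (simp add: a_def)
    qed
    define d where "d = (\<lambda>s. B t (real n + s) / a - 1)"
    define \<eta> where "\<eta> = 1 / real n"
    have \<eta>: "\<eta> > 0" using n0 by (simp add: \<eta>_def)
    have Ba: "B t (real n + s) = a * (1 + d s)" for s using a0 by (simp add: d_def a_def)
    have dd: "\<bar>d s + d (- s)\<bar> \<le> 6 * (s * \<eta>)\<^sup>2" "\<bar>d s\<bar> \<le> s * \<eta>" "\<bar>d (- s)\<bar> \<le> s * \<eta>" if "s = 1 \<or> s = 2" for s
    proof -
      have s: "0 \<le> s" "2 * s \<le> real n" "0 < real n" using that n0 by auto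
      note sd = B_second_difference[OF s, of t, folded a_def]
      have "B t (real n - s) = a * (1 + d (- s))" using Ba[of "- s"] by simp
      then have "a * 0 \<le> a * (- d (- s) - d s)" "a * (- d (- s) - d s) \<le> a * (6 * (s * \<eta>)\<^sup>2)"
        "a * 0 \<le> a * - d (- s)" "a * - d (- s) \<le> a * (s * \<eta>)" "a * 0 \<le> a * d s" "a * d s \<le> a * (s * \<eta>)"
        using sd unfolding Ba by (simp_all add: algebra_simps \<eta>_def)
      then have "0 \<le> - d (- s) - d s" "- d (- s) - d s \<le> 6 * (s * \<eta>)\<^sup>2" "0 \<le> - d (- s)" "- d (- s) \<le> s * \<eta>"
        "0 \<le> d s" "d s \<le> s * \<eta>"
        using a0 unfolding a_def[symmetric] mult_le_cancel_left_pos[OF a0[folded a_def]] by auto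
      then show "\<bar>d s + d (- s)\<bar> \<le> 6 * (s * \<eta>)\<^sup>2" "\<bar>d s\<bar> \<le> s * \<eta>" "\<bar>d (- s)\<bar> \<le> s * \<eta>" by linarith+
    qed
    \<comment> \<open>The part of the quadratic form left after removing its value at equal
      arguments: second differences, then products. The bounds add up to 80 = 36 + 24 + 5 *
      4.\<close>
    define D where "D = 6 * (d 1 + d (- 1)) + (d 2 + d (- 2)) + (d (- 2) * d (- 1) + d (- 1) * d (- 1)
        + d (- 1) * d 1 + d 1 * d 1 + d 1 * d 2)"
    have "\<bar>D\<bar> \<le> 80 * \<eta>\<^sup>2"
    proof -
      have d2: "\<bar>d u * d v\<bar> \<le> 4 * \<eta>\<^sup>2" if "\<bar>d u\<bar> \<le> 2 * \<eta>" "\<bar>d v\<bar> \<le> 2 * \<eta>" for u v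
        using mult_mono[OF that] \<eta> by (simp add: abs_mult power2_eq_square)
      have b1: "\<bar>d 1\<bar> \<le> 2 * \<eta>" "\<bar>d (- 1)\<bar> \<le> 2 * \<eta>" "\<bar>d 2\<bar> \<le> 2 * \<eta>" "\<bar>d (- 2)\<bar> \<le> 2 * \<eta>"
        using dd(2,3)[of 1] dd(2,3)[of 2] \<eta> by auto
      have q: "\<bar>p0 + p1 + (q1 + q2 + q3 + q4 + q5)\<bar> \<le> 80 * z"
        if "\<bar>p0\<bar> \<le> 36 * z" "\<bar>p1\<bar> \<le> 24 * z" "\<bar>q1\<bar> \<le> 4 * z" "\<bar>q2\<bar> \<le> 4 * z" "\<bar>q3\<bar> \<le> 4 * z" "\<bar>q4\<bar> \<le> 4 * z" "\<bar>q5\<bar> \<le> 4 * z"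
        for p0 p1 q1 q2 q3 q4 q5 z :: real
      proof (rule abs_leI)
        show "p0 + p1 + (q1 + q2 + q3 + q4 + q5) \<le> 80 * z" using that[THEN abs_le_D1] by linarith
        show "- (p0 + p1 + (q1 + q2 + q3 + q4 + q5)) \<le> 80 * z" using that[THEN abs_le_D2] by linarith
      qed
      show ?thesis unfolding D_def
      proof (rule q[OF _ _ d2[OF b1(4,2)] d2[OF b1(2,2)] d2[OF b1(2,1)] d2[OF b1(1,1)] d2[OF b1(1,3)]])
        show "\<bar>6 * (d 1 + d (- 1))\<bar> \<le> 36 * \<eta>\<^sup>2" using dd(1)[of 1] by (simp add: abs_mult)
        show "\<bar>d 2 + d (- 2)\<bar> \<le> 24 * \<eta>\<^sup>2" using dd(1)[of 2] by (simp add: power_mult_distrib)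
      qed
    qed
    have eqn: "a * (60 * a\<^sup>2 - 2 * t) = real n" unfolding a_def by (rule B_eq') (use n0 in auto)
    have "B t (real (n - 2)) = a * (1 + d (- 2))" "B t (real (n - 1)) = a * (1 + d (- 1))"
      "B t (real (n + 1)) = a * (1 + d 1)" "B t (real (n + 2)) = a * (1 + d 2)"
      using n0 by (simp_all add: Ba[symmetric] of_nat_diff add.commute)
    then have "B t (real n) * (6 * ?S n t - 2 * t)
       = a * (6 * string_sum (a * (1 + d (- 2))) (a * (1 + d (- 1))) a (a * (1 + d 1)) (a * (1 + d 2)) - 2 * t)"
      by (simp only: a_def[symmetric])
    moreover have "a * (6 * string_sum (a * (1 + d (- 2))) (a * (1 + d (- 1))) a (a * (1 + d 1)) (a * (1 + d 2)) - 2 * t)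
       - a * (60 * a\<^sup>2 - 2 * t) = 6 * a ^ 3 * D"
      by (simp add: string_sum_def D_def power2_eq_square power3_eq_cube algebra_simps)
    ultimately have "B t (real n) * (6 * ?S n t - 2 * t) - real n
       = 6 * a ^ 3 * D"
      unfolding eqn by simp
    also have "\<bar>6 * a ^ 3 * D\<bar> \<le> (1/9 * real n) * (80 * \<eta>\<^sup>2)"
      unfolding abs_mult[of _ D]
    proof (rule mult_mono)
      have "0 < a ^ 3" using a0 by (simp add: a_def)
      moreover have "60 * a ^ 3 \<le> (1 + 1/1000) * real n" using cube by (simp add: a_def)
      ultimately show "\<bar>6 * a ^ 3\<bar> \<le> 1/9 * real n" by (simp add: abs_mult)
    qed (use \<open>\<bar>D\<bar> \<le> 80 * \<eta>\<^sup>2\<close> in auto)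
    also have "\<dots> = 80/9 * (\<eta>\<^sup>2 * real n)" by simp
    also have "\<dots> \<le> 9 * (\<eta>\<^sup>2 * real n)" by (intro mult_right_mono) auto
    also have "\<dots> = 9 / (real n)\<^sup>2 * real n" by (simp add: \<eta>_def power_divide)
    finally show "\<bar>B t (real n) * (6 * ?S n t - 2 * t) - real n\<bar>
       \<le> 9 / (real n)\<^sup>2 * real n" .
  qed auto
  then show ?thesis by auto
qed

subsection \<open>The additive constant\<close>

definition G :: "real \<Rightarrow> real \<Rightarrow> real" where
  "G t \<nu> = \<nu> * ln (B t \<nu>) - 20 * B t \<nu> ^ 3 + 2 * t * B t \<nu>"

text \<open>
  \<open>G\<close> is a Legendre-type transform: a maximum over \<open>x\<close> of functions affine in \<open>(t, \<nu>)\<close>.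
  Hence it is convex with gradient \<open>(2 B, ln B)\<close>, and it is insensitive to first-order
  errors in \<open>B\<close>.
\<close>

lemma G_ge:
  assumes x: "x > 0" and \<nu>: "\<nu> > 0"
  shows "\<nu> * ln x - 20 * x ^ 3 + 2 * t * x \<le> G t \<nu>"
proof -
  define a where "a = B t \<nu>"
  have a: "a > 0" using \<nu> by (simp add: a_def B_pos)
  \<comment> \<open>Two tangent-line bounds at the maximiser a are combined: one for the concave
    logarithm, one for the cube.\<close>
  have "ln (x / a) \<le> x / a - 1" using x a by (intro ln_le_minus_one) auto
  then have "\<nu> * (ln x - ln a) \<le> \<nu> * (x / a - 1)"
    using x a \<nu> by (simp add: ln_div)
  also have "\<nu> * (x / a - 1) = (60 * a\<^sup>2 - 2 * t) * (x - a)"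
  proof -
    have "\<nu> = a * (60 * a\<^sup>2 - 2 * t)" using B_eq'[OF \<nu>, of t] by (simp add: a_def)
    then have "\<nu> * (x / a - 1) = (60 * a\<^sup>2 - 2 * t) * (a * (x / a - 1))" by (simp add: mult_ac)
    also have "a * (x / a - 1) = x - a" using a by (simp add: right_diff_distrib)
    finally show ?thesis .
  qed
  also have "\<dots> = 20 * (x ^ 3 - a ^ 3) - 2 * t * (x - a) - 20 * ((x - a)\<^sup>2 * (x + 2 * a))"
    by (simp add: power2_eq_square power3_eq_cube algebra_simps)
  also have "\<dots> \<le> 20 * (x ^ 3 - a ^ 3) - 2 * t * (x - a)" using x a by simp
  finally show ?thesis by (simp add: G_def a_def algebra_simps)
qed

lemma G_convex_nu: "\<nu> > 0 \<Longrightarrow> \<nu>' > 0 \<Longrightarrow> G t \<nu> + (\<nu>' - \<nu>) * ln (B t \<nu>) \<le> G t \<nu>'"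
  using G_ge[OF B_pos, of \<nu> \<nu>' t t] by (simp add: G_def algebra_simps)

lemma G_convex_t: "\<nu> > 0 \<Longrightarrow> G t \<nu> + 2 * B t \<nu> * (s - t) \<le> G s \<nu>"
  using G_ge[OF B_pos, of \<nu> \<nu> t s] by (simp add: G_def algebra_simps)

lemma ln_B_diff:
  assumes "0 < \<nu>" "\<nu> \<le> \<nu>'"
  shows "0 \<le> ln (B t \<nu>') - ln (B t \<nu>)" "ln (B t \<nu>') - ln (B t \<nu>) \<le> (\<nu>' - \<nu>) / \<nu>"
proof -
  have pos: "B t \<nu> > 0" "B t \<nu>' > 0" "\<nu>' > 0" using assms by (auto intro: B_pos)
  show "0 \<le> ln (B t \<nu>') - ln (B t \<nu>)" using B_mono[OF assms, of t] pos by simp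
  have "B t \<nu>' / B t \<nu> \<le> \<nu>' / \<nu>" using B_ratio_mono[OF assms, of t] pos assms by (simp add: field_simps)
  moreover have "ln (B t \<nu>' / B t \<nu>) \<le> B t \<nu>' / B t \<nu> - 1" using pos by (intro ln_le_minus_one) auto
  ultimately have "ln (B t \<nu>' / B t \<nu>) \<le> \<nu>' / \<nu> - 1" by linarith
  then show "ln (B t \<nu>') - ln (B t \<nu>) \<le> (\<nu>' - \<nu>) / \<nu>" using pos assms by (simp add: ln_div diff_divide_distrib)
qed

text \<open>Convexity used from both ends squeezes the remainder between 0 and (s - \<nu>) (ln B(s)
  - ln B(\<nu>)), which is quadratic. The root \<open>B\<close> need not be differentiated.\<close>

lemma G_has_real_derivative:
  assumes \<nu>: "\<nu> \<ge> 2"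
  shows "((\<lambda>\<nu>. G t \<nu>) has_real_derivative ln (B t \<nu>)) (at \<nu>)"
proof (rule has_real_derivative_quadratic)
  fix s assume s: "\<bar>s - \<nu>\<bar> \<le> 1"
  then have s0: "s > 0" "\<nu> > 0" "s \<ge> 1" using \<nu> by linarith+
  have 1: "G t \<nu> + (s - \<nu>) * ln (B t \<nu>) \<le> G t s" using s0 by (intro G_convex_nu)
  have "G t s + (\<nu> - s) * ln (B t s) \<le> G t \<nu>" using s0 by (intro G_convex_nu)
  then have 2: "G t s - G t \<nu> - (s - \<nu>) * ln (B t \<nu>) \<le> (s - \<nu>) * (ln (B t s) - ln (B t \<nu>))"
    by (simp add: algebra_simps)
  have "(s - \<nu>) * (ln (B t s) - ln (B t \<nu>)) \<le> \<bar>s - \<nu>\<bar> * \<bar>ln (B t s) - ln (B t \<nu>)\<bar>"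
    by (metis abs_ge_self abs_mult)
  also have "\<bar>ln (B t s) - ln (B t \<nu>)\<bar> \<le> \<bar>s - \<nu>\<bar>"
  proof (cases "s \<le> \<nu>")
    case True
    have "(\<nu> - s) / s \<le> (\<nu> - s) / 1" using True s0 by (intro divide_left_mono) auto
    then show ?thesis using ln_B_diff[of s \<nu> t] True s0 by auto
  next
    case False
    have "(s - \<nu>) / \<nu> \<le> (s - \<nu>) / 1" using False s0 \<nu> by (intro divide_left_mono) auto
    then show ?thesis using ln_B_diff[of \<nu> s t] False s0 by auto
  qed
  finally have "(s - \<nu>) * (ln (B t s) - ln (B t \<nu>)) \<le> 1 * (s - \<nu>)\<^sup>2"
    by (simp add: power2_eq_square mult_left_mono flip: abs_mult)
  with 1 2 show "\<bar>G t s - G t \<nu> - (s - \<nu>) * ln (B t \<nu>)\<bar> \<le> 1 * (s - \<nu>)\<^sup>2" by linarith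
qed

lemma abs_ln_one_plus_le:
  fixes z :: real
  assumes "\<bar>z\<bar> \<le> 1/2"
  shows "\<bar>ln (1 + z)\<bar> \<le> 2 * \<bar>z\<bar>"
proof -
  have "\<bar>ln (1 + z) - z\<bar> \<le> 2 * z\<^sup>2" using assms by (rule abs_ln_one_plus_x_minus_x_bound)
  moreover have "2 * z\<^sup>2 \<le> \<bar>z\<bar>"
    using mult_right_mono[OF assms, of "\<bar>z\<bar>"] by (simp add: power2_eq_square)
  ultimately show ?thesis by linarith
qed

text \<open>Multiplying the two outer values turns the logarithms into ln (1 + z) with z = d + d' +
  d d'. The sum d + d' is a second difference, so z is of order \<nu>^-2.\<close>

lemma ln_B_second_difference:
  assumes s: "0 \<le> s" "s \<le> 1/2" and \<nu>: "\<nu> \<ge> 2"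
  shows "\<bar>ln (B t (\<nu> + s)) + ln (B t (\<nu> - s)) - 2 * ln (B t \<nu>)\<bar> \<le> 4 / \<nu>\<^sup>2"
proof -
  define a where "a = B t \<nu>"
  define d d' where "d = B t (\<nu> + s) / a - 1" "d' = B t (\<nu> - s) / a - 1"
  have a: "a > 0" unfolding a_def by (rule B_pos) (use \<nu> in auto)
  have Ba: "B t (\<nu> + s) = a * (1 + d)" "B t (\<nu> - s) = a * (1 + d')" using a by (auto simp: d_d'_def)
  have pos: "B t (\<nu> + s) > 0" "B t (\<nu> - s) > 0" by (rule B_pos; use s \<nu> in auto)+
  note sd = B_second_difference[of s \<nu> t, folded a_def]
  have "a * 0 \<le> a * (- d' - d)" "a * (- d' - d) \<le> a * (6 * (s / \<nu>)\<^sup>2)"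
    "a * 0 \<le> a * - d'" "a * - d' \<le> a * (s / \<nu>)" "a * 0 \<le> a * d" "a * d \<le> a * (s / \<nu>)"
    using sd s \<nu> unfolding Ba by (simp_all add: algebra_simps)
  then have d: "0 \<le> - d' - d" "- d' - d \<le> 6 * (s / \<nu>)\<^sup>2" "0 \<le> - d'" "- d' \<le> s / \<nu>" "0 \<le> d" "d \<le> s / \<nu>"
    unfolding mult_le_cancel_left_pos[OF a] by auto
  define z where "z = d + d' + d * d'"
  have "d * (- d') \<le> s / \<nu> * (s / \<nu>)" using d by (intro mult_mono) auto
  moreover have "0 \<le> d * (- d')" using d by (intro mult_nonneg_nonneg) auto
  ultimately have z: "\<bar>z\<bar> \<le> 7 * (s / \<nu>)\<^sup>2" using d unfolding z_def power2_eq_square by auto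
  have "(s / \<nu>)\<^sup>2 \<le> (1/2 / \<nu>)\<^sup>2" using s \<nu> by (intro power_mono divide_right_mono) auto
  with z have z2: "\<bar>z\<bar> \<le> 7/4 * (1 / \<nu>\<^sup>2)" by (simp add: power_divide)
  have "1 / \<nu>\<^sup>2 \<le> 1 / 2\<^sup>2" using \<nu> by (intro divide_left_mono power_mono) auto
  with z2 have "\<bar>z\<bar> \<le> 1/2" by simp
  have "ln (B t (\<nu> + s)) + ln (B t (\<nu> - s)) - 2 * ln a = ln (B t (\<nu> + s) * B t (\<nu> - s) / (a * a))"
    using pos a by (simp add: ln_div ln_mult)
  also have "B t (\<nu> + s) * B t (\<nu> - s) / (a * a) = 1 + z"
    using a unfolding Ba z_def by (simp add: field_simps)
  also have "\<bar>ln (1 + z)\<bar> \<le> 2 * \<bar>z\<bar>" by (rule abs_ln_one_plus_le) fact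
  finally show ?thesis using z2 by (simp add: a_def)
qed

text \<open>The midpoint rule for ln \<open>B\<close>, whose antiderivative is \<open>G\<close>. The
  mean value theorem for the symmetrised function h reduces the error to a second difference, so the
  bound is uniform in t.\<close>

lemma G_midpoint:
  assumes n: "n \<ge> 3"
  shows "\<bar>G t (n + 1/2) - G t (n - 1/2) - ln (B t n)\<bar> \<le> 2 / n\<^sup>2"
proof -
  define h where "h = (\<lambda>s. G t (n + s) - G t (n - s) - 2 * s * ln (B t n))"
  have "\<exists>z. 0 < z \<and> z < 1/2 \<and> h (1/2) - h 0 = (1/2 - 0) * (ln (B t (n + z)) + ln (B t (n - z)) - 2 * ln (B t n))"
  proof (rule MVT2)
    fix x :: real assume x: "0 \<le> x" "x \<le> 1/2"
    have 1: "((\<lambda>s. G t (n + s)) has_real_derivative ln (B t (n + x)) * (0 + 1)) (at x)"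
      by (rule DERIV_chain'[where f = "\<lambda>s. n + s"]) (use n x in \<open>auto intro!: derivative_eq_intros G_has_real_derivative\<close>)
    have 2: "((\<lambda>s. G t (n - s)) has_real_derivative ln (B t (n - x)) * (0 - 1)) (at x)"
      by (rule DERIV_chain'[where f = "\<lambda>s. n - s"]) (use n x in \<open>auto intro!: derivative_eq_intros G_has_real_derivative\<close>)
    show "(h has_real_derivative ln (B t (n + x)) + ln (B t (n - x)) - 2 * ln (B t n)) (at x)"
      unfolding h_def by (rule derivative_eq_intros 1 2 refl)+ auto
  qed simp
  then obtain z where z: "0 < z" "z < 1/2"
    and eq: "h (1/2) - h 0 = 1/2 * (ln (B t (n + z)) + ln (B t (n - z)) - 2 * ln (B t n))" by auto
  have "\<bar>ln (B t (n + z)) + ln (B t (n - z)) - 2 * ln (B t n)\<bar> \<le> 4 / n\<^sup>2"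
    using z n by (intro ln_B_second_difference) auto
  then have "\<bar>h (1/2) - h 0\<bar> \<le> 2 / n\<^sup>2" unfolding eq by (simp add: abs_mult)
  then show ?thesis by (simp add: h_def)
qed

text \<open>The increments of \<open>G\<close> at half-integers approximate ln \<open>B\<close>,
  hence the increments of ln \<open>H\<close>; the constant ln(2 pi) is chosen to make the limit
  0.\<close>

definition E :: "real \<Rightarrow> nat \<Rightarrow> real" where
  "E t n = ln (H t n) - G t (real n + 1/2) - ln (2 * pi)"

text \<open>An increment of \<open>E\<close> is ln (b / B) minus the midpoint error. Both are
  O(n^-2) uniformly in t <= T and are summed against 1/n - 1/m.\<close>

lemma E_cauchy:
  "\<exists>C N. \<forall>n\<ge>N. \<forall>m\<ge>n. \<forall>t\<le>T. \<bar>E t m - E t n\<bar> \<le> C / real n"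
proof -
  obtain C0 N0 where C0: "\<forall>n\<ge>N0. \<forall>t\<le>T. \<bar>b t n / B t (real n) - 1\<bar> \<le> C0 / (real n)\<^sup>2"
    using b_refined_B[of T] by auto
  define C where "C = 2 * \<bar>C0\<bar> + 2"
  define N where "N = N0 + 3 + nat \<lceil>2 * \<bar>C0\<bar>\<rceil>"
  have step: "\<bar>E t (Suc n) - E t n\<bar> \<le> C / (real (Suc n))\<^sup>2" if n: "n \<ge> N" and t: "t \<le> T" for n t
  proof -
    define m where "m = Suc n"
    have m: "m \<ge> N0" "m \<ge> 3" "real m \<ge> 2 * \<bar>C0\<bar>" "m > 0" using n unfolding N_def m_def by linarith+
    define z where "z = b t m / B t (real m) - 1"
    have Bp: "B t (real m) > 0" using m by (intro B_pos) auto
    have bp: "b t m > 0" using m by (intro b_pos) auto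
    have "\<bar>z\<bar> \<le> C0 / (real m)\<^sup>2" using C0 m t by (simp add: z_def)
    also have "\<dots> \<le> \<bar>C0\<bar> / (real m)\<^sup>2" by (intro divide_right_mono) auto
    finally have z: "\<bar>z\<bar> \<le> \<bar>C0\<bar> / (real m)\<^sup>2" .
    have "\<bar>C0\<bar> / (real m)\<^sup>2 \<le> 1/2"
    proof -
      have "2 * \<bar>C0\<bar> * 1 \<le> real m * real m" using m by (intro mult_mono) auto
      then show ?thesis using m by (simp add: power2_eq_square field_simps)
    qed
    with z have "\<bar>z\<bar> \<le> 1/2" by linarith
    then have lz: "\<bar>ln (1 + z)\<bar> \<le> 2 * \<bar>z\<bar>" by (rule abs_ln_one_plus_le)
    have "ln (b t m) = ln (1 + z) + ln (B t (real m))"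
      using Bp bp by (simp add: z_def ln_div)
    moreover have "ln (H t m) = ln (b t m) + ln (H t n)"
      using bp unfolding m_def by (simp add: H_Suc ln_mult)
    moreover have "G t (real m - 1/2) = G t (real n + 1/2)" by (rule arg_cong) (simp add: m_def)
    ultimately have "E t m - E t n = ln (1 + z) - (G t (real m + 1/2) - G t (real m - 1/2) - ln (B t (real m)))"
      by (simp add: E_def)
    moreover have "\<bar>G t (real m + 1/2) - G t (real m - 1/2) - ln (B t (real m))\<bar> \<le> 2 / (real m)\<^sup>2"
      using m by (intro G_midpoint) auto
    ultimately have "\<bar>E t m - E t n\<bar> \<le> 2 * (\<bar>C0\<bar> / (real m)\<^sup>2) + 2 / (real m)\<^sup>2" using lz z by linarith
    also have "\<dots> = C / (real m)\<^sup>2" by (simp add: C_def add_divide_distrib)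
    finally show ?thesis by (simp add: m_def)
  qed
  have "\<bar>E t m - E t n\<bar> \<le> C * (1 / real n - 1 / real m)" if "n \<ge> N" "m \<ge> n" "t \<le> T" for n m t
    using that(2)
  proof (induction m rule: dec_induct)
    case (step m)
    have m: "m \<ge> N" "real m > 0" using step that by (auto simp: N_def)
    have "1 / (real (Suc m))\<^sup>2 \<le> 1 / real m - 1 / real (Suc m)"
    proof -
      have "1 / (real (Suc m))\<^sup>2 \<le> 1 / (real m * real (Suc m))"
        unfolding power2_eq_square using m by (intro divide_left_mono mult_right_mono) auto
      also have "\<dots> = 1 / real m - 1 / real (Suc m)" using m by (simp add: field_simps)
      finally show ?thesis .
    qed
    then have "C * (1 / (real (Suc m))\<^sup>2) \<le> C * (1 / real m - 1 / real (Suc m))"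
      by (intro mult_left_mono) (auto simp: C_def)
    moreover have "\<bar>E t (Suc m) - E t m\<bar> \<le> C / (real (Suc m))\<^sup>2"
      using m that by (intro \<open>\<And>t n. n \<ge> N \<Longrightarrow> t \<le> T \<Longrightarrow> \<bar>E t (Suc n) - E t n\<bar> \<le> C / (real (Suc n))\<^sup>2\<close>) auto
    moreover have "C * (1 / real n - 1 / real (Suc m)) = C * (1 / real n - 1 / real m) + C * (1 / real m - 1 / real (Suc m))"
      by (simp only: right_diff_distrib)
    ultimately show ?case using step.IH by simp
  qed simp
  moreover have "C * (1 / real n - 1 / real m) \<le> C / real n" for n m
    by (simp add: C_def right_diff_distrib)
  ultimately show ?thesis by (intro exI[of _ C] exI[of _ N]) (blast intro: order.trans)
qed

text \<open>The uniform rate is kept together with the limit because it must survive t -> -infinity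
  at fixed n.\<close>

lemma E_limit:
  obtains Einf C N where "\<And>t. t \<le> T \<Longrightarrow> E t \<longlonglongrightarrow> Einf t"
    and "\<And>t n. t \<le> T \<Longrightarrow> n \<ge> N \<Longrightarrow> \<bar>Einf t - E t n\<bar> \<le> C / real n"
proof -
  obtain C N where CN: "\<And>n m t. n \<ge> N \<Longrightarrow> m \<ge> n \<Longrightarrow> t \<le> T \<Longrightarrow> \<bar>E t m - E t n\<bar> \<le> C / real n"
    using E_cauchy[of T] by blast
  have conv: "convergent (E t)" if t: "t \<le> T" for t
  proof (rule Cauchy_convergent, rule metric_CauchyI)
    fix e :: real assume e: "e > 0"
    define M where "M = N + 1 + nat \<lceil>2 * \<bar>C\<bar> / e\<rceil>"
    have M: "real M > 2 * \<bar>C\<bar> / e" "M \<ge> N" "M > 0" unfolding M_def by linarith+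
    then have "2 * \<bar>C\<bar> < e * real M" using e by (simp add: field_simps)
    then have "2 * (\<bar>C\<bar> / real M) < e" using M by (simp add: field_simps)
    moreover have "C / real M \<le> \<bar>C\<bar> / real M" by (intro divide_right_mono) auto
    ultimately have "2 * (C / real M) < e" by linarith
    then have "dist (E t m) (E t n) < e" if "m \<ge> M" "n \<ge> M" for m n
      using CN[of M m t] CN[of M n t] that M t unfolding dist_real_def by linarith
    then show "\<exists>M. \<forall>m\<ge>M. \<forall>n\<ge>M. dist (E t m) (E t n) < e" by blast
  qed
  show thesis
  proof (rule that[of "\<lambda>t. lim (E t)" N C])
    show lim: "E t \<longlonglongrightarrow> lim (E t)" if "t \<le> T" for t using conv[OF that] by (simp add: convergent_LIMSEQ_iff)
    fix t n assume t: "t \<le> T" and n: "n \<ge> N"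
    have "(\<lambda>m. \<bar>E t m - E t n\<bar>) \<longlonglongrightarrow> \<bar>lim (E t) - E t n\<bar>"
      by (intro tendsto_intros lim t)
    then show "\<bar>lim (E t) - E t n\<bar> \<le> C / real n"
      by (rule LIMSEQ_le_const2) (use CN n t in blast)
  qed
qed

section \<open>The Gaussian limit t -> -infinity and Stirling's formula\<close>

lemma B_at_bot:
  assumes \<nu>: "\<nu> > 0"
  shows "((\<lambda>a. 2 * a * B (- a) \<nu>) \<longlongrightarrow> \<nu>) at_top" and "((\<lambda>a. B (- a) \<nu>) \<longlongrightarrow> 0) at_top"
proof -
  have eq: "60 * B (- a) \<nu> ^ 3 + 2 * a * B (- a) \<nu> = \<nu>" for a
    using B_eq[OF \<nu>, of "- a"] by simp
  have pos: "B (- a) \<nu> > 0" for a using \<nu> by (rule B_pos)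
  have le: "B (- a) \<nu> \<le> \<nu> / (2 * a)" if "a > 0" for a
  proof -
    have "0 < 60 * B (- a) \<nu> ^ 3" using pos[of a] by simp
    then have "2 * a * B (- a) \<nu> \<le> \<nu>" using eq[of a] by linarith
    then show ?thesis using that by (simp add: field_simps)
  qed
  show lim: "((\<lambda>a. B (- a) \<nu>) \<longlongrightarrow> 0) at_top"
  proof (rule tendsto_sandwich)
    show "\<forall>\<^sub>F a in at_top. 0 \<le> B (- a) \<nu>" using pos by (simp add: less_imp_le)
    show "\<forall>\<^sub>F a in at_top. B (- a) \<nu> \<le> \<nu> / (2 * a)"
      using eventually_gt_at_top[of 0] by eventually_elim (rule le)
    show "((\<lambda>a. \<nu> / (2 * a)) \<longlongrightarrow> 0) at_top" by real_asymp
  qed simp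
  have "((\<lambda>a. \<nu> - 60 * B (- a) \<nu> ^ 3) \<longlongrightarrow> \<nu> - 60 * 0 ^ 3) at_top"
    by (intro tendsto_intros lim)
  moreover have "\<nu> - 60 * B (- a) \<nu> ^ 3 = 2 * a * B (- a) \<nu>" for a using eq[of a] by linarith
  ultimately show "((\<lambda>a. 2 * a * B (- a) \<nu>) \<longlongrightarrow> \<nu>) at_top" by simp
qed

text \<open>For t = -a < 0 every term of the string equation is nonnegative, which gives b <= j / (2
  a). Inserting this again makes the cubic part vanish in the limit.\<close>

lemma b_at_bot:
  assumes k: "k > 0"
  shows "((\<lambda>a. 2 * a * b (- a) k) \<longlongrightarrow> real k) at_top"
proof -
  let ?S = "\<lambda>a j. string_sum (b (- a) (j - 2)) (b (- a) (j - 1)) (b (- a) j) (b (- a) (j + 1)) (b (- a) (j + 2))"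
  have S0: "?S a j \<ge> 0" for a j unfolding string_sum_def by (simp add: b_nonneg)
  have eq: "6 * (b (- a) j * ?S a j) + 2 * a * b (- a) j = real j" if "j > 0" for a j
    using string_equation_string_sum[OF that, of "- a"] by (simp add: algebra_simps)
  have le: "b (- a) j \<le> real j / (2 * a)" if "a > 0" for a j
  proof (cases "j = 0")
    case False
    have "0 \<le> 6 * (b (- a) j * ?S a j)" using S0[of a j] by (simp add: b_nonneg)
    then have "2 * a * b (- a) j \<le> real j" using eq[of j a] False by simp
    then show ?thesis using that by (simp add: field_simps)
  qed simp
  have lim: "((\<lambda>a. b (- a) j) \<longlongrightarrow> 0) at_top" for j
  proof (rule tendsto_sandwich)
    show "\<forall>\<^sub>F a in at_top. 0 \<le> b (- a) j" by (simp add: b_nonneg)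
    show "\<forall>\<^sub>F a in at_top. b (- a) j \<le> real j / (2 * a)"
      using eventually_gt_at_top[of 0] by eventually_elim (rule le)
    show "((\<lambda>a. real j / (2 * a)) \<longlongrightarrow> 0) at_top" by real_asymp
  qed simp
  have "((\<lambda>a. real k - 6 * (b (- a) k * ?S a k)) \<longlongrightarrow> real k - 6 * (0 * string_sum 0 0 0 0 0)) at_top"
    unfolding string_sum_def by (intro tendsto_intros lim)
  moreover have "real k - 6 * (b (- a) k * ?S a k) = 2 * a * b (- a) k" for a using eq[OF k, of a] by linarith
  ultimately show ?thesis by simp
qed

lemma ln_H_prod: "ln (H t n) = ln (H t 0) + (\<Sum>k=1..n. ln (b t k))"
proof (induction n)
  case (Suc n)
  then show ?case using b_pos[of "Suc n" t] by (simp add: H_Suc ln_mult)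
qed simp

text \<open>The error in Stirling's formula written with \<nu> = n + 1/2 as \<nu> ln \<nu> - \<nu> +
  ln(2 pi) / 2. That it tends to 0 is derived here, its convergence coming from the bounds on
  \<open>E\<close>.\<close>

definition stirling_error :: "nat \<Rightarrow> real" where
  "stirling_error n = ln (fact n) - (real n + 1/2) * ln (real n + 1/2) + (real n + 1/2) - ln (2 * pi) / 2"

text \<open>As \<open>t \<rightarrow> -\<infinity>\<close> the rescaled weight becomes Gaussian, with norms \<open>\<surd>\<pi> n! / 2\<^sup>n\<close>.\<close>

lemma E_at_bot: "((\<lambda>a. E (- a) n) \<longlongrightarrow> stirling_error n) at_top"
proof -
  define \<nu> where "\<nu> = real n + 1/2"
  have \<nu>: "\<nu> > 0" by (simp add: \<nu>_def)
  \<comment> \<open>Every factor is rescaled to have a limit, and the powers of a cancel: sqrt a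
    from \<open>H_0_at_bot\<close>, n factors 2 a from the \<open>b\<close>, and n + 1/2 logarithms
    of 2 a from \<open>B\<close>. What is left over is ln 2 / 2.\<close>
  let ?e = "\<lambda>a. ln (sqrt a * H (- a) 0) + (\<Sum>k=1..n. ln (2 * a * b (- a) k)) - \<nu> * ln (2 * a * B (- a) \<nu>)
      + 20 * B (- a) \<nu> ^ 3 + 2 * a * B (- a) \<nu> + ln 2 / 2 - ln (2 * pi)"
  have lims: "(?e
    \<longlongrightarrow> ln (sqrt pi) + (\<Sum>k=1..n. ln (real k)) - \<nu> * ln \<nu> + 20 * 0 ^ 3 + \<nu> + ln 2 / 2 - ln (2 * pi)) at_top"
    by (intro tendsto_add tendsto_diff tendsto_sum tendsto_ln tendsto_mult[OF tendsto_const] tendsto_const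
        tendsto_power H_0_at_bot b_at_bot B_at_bot \<nu>) (use \<nu> in auto)
  have lim_eq: "ln (sqrt pi) + (\<Sum>k=1..n. ln (real k)) - \<nu> * ln \<nu> + 20 * 0 ^ 3 + \<nu> + ln 2 / 2 - ln (2 * pi) = stirling_error n"
  proof -
    have 1: "(\<Sum>k=1..n. ln (real k)) = ln (fact n)"
      by (induction n) (auto simp: ln_mult)
    have 2: "ln (sqrt pi) = ln pi / 2" by (simp add: ln_sqrt)
    have 3: "ln (2 * pi) = ln 2 + ln pi" by (simp add: ln_mult)
    have 4: "20 * 0 ^ 3 = (0 :: real)" by simp
    show ?thesis unfolding stirling_error_def \<nu>_def 1 2 3 4 add_divide_distrib by linarith
  qed
  have eqE: "E (- a) n = ?e a" if a: "a > 0" for a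
  proof -
    have "(\<Sum>k=1..n. ln (2 * a * b (- a) k)) = (\<Sum>k=1..n. ln (2 * a) + ln (b (- a) k))"
    proof (intro sum.cong refl)
      fix k assume "k \<in> {1..n}"
      then have "b (- a) k > 0" by (intro b_pos) simp
      then show "ln (2 * a * b (- a) k) = ln (2 * a) + ln (b (- a) k)" using a by (simp add: ln_mult)
    qed
    also have "\<dots> = real n * ln (2 * a) + (\<Sum>k=1..n. ln (b (- a) k))" by (simp add: sum.distrib)
    finally have 1: "(\<Sum>k=1..n. ln (2 * a * b (- a) k)) = real n * ln (2 * a) + (\<Sum>k=1..n. ln (b (- a) k))" .
    have 2: "ln (2 * a * B (- a) \<nu>) = ln (2 * a) + ln (B (- a) \<nu>)"
      using a B_pos[OF \<nu>, of "- a"] by (simp add: ln_mult)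
    have 3: "ln (sqrt a * H (- a) 0) = ln a / 2 + ln (H (- a) 0)"
      using a by (simp add: ln_mult ln_sqrt)
    have 4: "ln (2 * a) = ln 2 + ln a" using a by (simp add: ln_mult)
    show ?thesis
      unfolding E_def ln_H_prod[of "- a" n] G_def 1 2 3 \<nu>_def[symmetric]
      unfolding 4 by (simp add: \<nu>_def algebra_simps)
  qed
  then have "\<forall>\<^sub>F a in at_top. ?e a = E (- a) n"
    by (intro eventually_mono[OF eventually_gt_at_top[of "0::real"]]) (rule eqE[symmetric])
  with lims show ?thesis unfolding lim_eq by (rule Lim_transform_eventually)
qed

text \<open>Wallis' product identifies the limit once convergence is known.\<close>

lemma stirling_error_limit:
  assumes "stirling_error \<longlonglongrightarrow> c"
  shows "c = 0"
proof -
  let ?T = "\<lambda>n::nat. 4 * real n * ln 2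
      + 4 * ((real n + 1/2) * ln (real n + 1/2) - (real n + 1/2))
      - 2 * ((2 * real n + 1/2) * ln (2 * real n + 1/2) - (2 * real n + 1/2)) - ln (2 * real n + 1)"
  let ?W = "\<lambda>n. \<Prod>k=1..n. (4 * real k ^ 2) / (4 * real k ^ 2 - 1)"
  \<comment> \<open>The closed form of the partial Wallis products, (2^n n!)^4 / ((2n)!^2 (2n + 1)),
    with the denominator cleared.\<close>
  have W: "?W n * ((fact (2 * n))\<^sup>2 * (2 * real n + 1)) = (2 ^ n * fact n) ^ 4" for n
  proof (induction n)
    case (Suc n)
    define w w' m F where "w = ?W n" "w' = ?W (Suc n)" "m = real n + 1" "F = (fact (2 * n) :: real)"
    have "w' = w * (4 * m ^ 2 / (4 * m ^ 2 - 1))" by (simp add: w_w'_m_F_def add.commute)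
    also have "4 * m ^ 2 - 1 = (2 * m - 1) * (2 * m + 1)" by (simp add: power2_eq_square algebra_simps)
    finally have w': "w' * ((2 * m - 1) * (2 * m + 1)) = w * (4 * m\<^sup>2)"
      by (simp add: w_w'_m_F_def)
    have IH: "w * (F\<^sup>2 * (2 * m - 1)) = (2 ^ n * fact n) ^ 4"
    proof -
      have "2 * m - 1 = 2 * real n + 1" by (simp add: w_w'_m_F_def)
      then show ?thesis using Suc.IH by (simp only: w_w'_m_F_def)
    qed
    have "fact (2 * Suc n) = 2 * m * (2 * m - 1) * F"
      by (simp add: w_w'_m_F_def algebra_simps)
    then have "?W (Suc n) * ((fact (2 * Suc n))\<^sup>2 * (2 * real (Suc n) + 1)) = w' * ((2 * m * (2 * m - 1) * F)\<^sup>2 * (2 * m + 1))"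
      by (simp add: w_w'_m_F_def)
    also have "\<dots> = (w' * ((2 * m - 1) * (2 * m + 1))) * (4 * m\<^sup>2 * (F\<^sup>2 * (2 * m - 1)))"
    proof -
      have "w' * ((2 * m * p * F)\<^sup>2 * q) = (w' * (p * q)) * (4 * m\<^sup>2 * (F\<^sup>2 * p))" for p q
        by (simp add: power2_eq_square mult_ac)
      then show ?thesis .
    qed
    also have "\<dots> = 16 * m ^ 4 * (w * (F\<^sup>2 * (2 * m - 1)))"
      unfolding w' by (simp add: power2_eq_square power4_eq_xxxx mult_ac)
    also have "\<dots> = (2 ^ Suc n * fact (Suc n)) ^ 4"
      unfolding IH by (simp add: w_w'_m_F_def power_mult_distrib add.commute)
    finally show ?case .
  qed simp
  have Wpos: "?W n > 0" for n
  proof -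
    have "0 < ?W n * ((fact (2 * n))\<^sup>2 * (2 * real n + 1))" unfolding W by simp
    moreover have "0 < (fact (2 * n))\<^sup>2 * (2 * real n + 1)" by (intro mult_pos_pos) auto
    ultimately show ?thesis by (rule zero_less_mult_pos2)
  qed
  have lnW: "ln (?W n) = 4 * (real n * ln 2 + ln (fact n)) - (2 * ln (fact (2 * n)) + ln (2 * real n + 1))" for n
  proof -
    have "ln (?W n) + (2 * ln (fact (2 * n)) + ln (2 * real n + 1)) = ln (?W n * ((fact (2 * n))\<^sup>2 * (2 * real n + 1)))"
    proof -
      have "ln w + (2 * ln x + ln y) = ln (w * (x\<^sup>2 * y))" if "w > 0" "x > 0" "y > 0" for w x y :: real
        using that by (simp add: ln_mult ln_realpow)
      then show ?thesis using Wpos[of n] by simp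
    qed
    also have "\<dots> = 4 * (real n * ln 2 + ln (fact n))" unfolding W by (simp add: ln_mult ln_realpow)
    finally show ?thesis by linarith
  qed
  have "(\<lambda>n. ln (?W n)) \<longlonglongrightarrow> ln (pi / 2)"
    by (intro tendsto_ln wallis) auto
  \<comment> \<open>In this combination the Stirling errors tend to 4 c - 2 c, and the elementary
    part \<open>?T\<close> tends to -2 ln 2. Comparison with ln (pi / 2) leaves 2 c = 0.\<close>
  moreover have "ln (?W n) = 4 * stirling_error n - 2 * stirling_error (2 * n) + ?T n + ln (2 * pi)" for n
  proof -
    have "4 * stirling_error n = 4 * ln (fact n) - 4 * ((real n + 1/2) * ln (real n + 1/2) - (real n + 1/2)) - 2 * ln (2 * pi)"
      by (simp add: stirling_error_def)
    moreover have "2 * stirling_error (2 * n) = 2 * ln (fact (2 * n))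
        - 2 * ((2 * real n + 1/2) * ln (2 * real n + 1/2) - (2 * real n + 1/2)) - ln (2 * pi)"
      by (simp add: stirling_error_def)
    moreover have "4 * (real n * ln 2 + ln (fact n)) = 4 * real n * ln 2 + 4 * ln (fact n)" by simp
    ultimately show ?thesis using lnW[of n] by linarith
  qed
  moreover have "(\<lambda>n. 4 * stirling_error n - 2 * stirling_error (2 * n) + ?T n + ln (2 * pi))
     \<longlonglongrightarrow> 4 * c - 2 * c + (- 2 * ln 2) + ln (2 * pi)"
  proof (intro tendsto_add tendsto_diff tendsto_mult[OF tendsto_const] tendsto_const assms)
    have "filterlim (\<lambda>n::nat. 2 * n) at_top sequentially" by (rule filterlim_subseq) (auto simp: strict_mono_def)
    from filterlim_compose[OF assms this] show "(\<lambda>n. stirling_error (2 * n)) \<longlonglongrightarrow> c" .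
    show "?T \<longlonglongrightarrow> - 2 * ln 2"
      by real_asymp
  qed
  ultimately have "ln (pi / 2) = 4 * c - 2 * c + (- 2 * ln 2) + ln (2 * pi)"
    by (simp add: LIMSEQ_unique)
  then show ?thesis by (simp add: ln_mult ln_div)
qed

section \<open>Increments in t of ln \<open>H\<close> and of \<open>G\<close>\<close>

lemma B_cube_root:
  assumes \<nu>: "\<nu> > 0"
  shows "\<bar>B t \<nu> - root 3 (\<nu> / 60)\<bar> \<le> \<bar>t\<bar> / root 3 (\<nu> / 60)"
proof -
  define a x where "a = root 3 (\<nu> / 60)" "x = B t \<nu>"
  have a: "a > 0" "60 * a ^ 3 = \<nu>" using \<nu> by (auto simp: a_x_def)
  have x: "x > 0" "60 * x ^ 3 - 2 * t * x = \<nu>" using \<nu> by (auto simp: a_x_def B_pos B_eq)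
  \<comment> \<open>The equation 60 a^3 = \<nu> is subtracted from the cubic and the difference of
    cubes is factored.\<close>
  have "(x - a) * (30 * (x\<^sup>2 + a * x + a\<^sup>2)) = t * x"
  proof -
    have "(x - a) * (30 * (x\<^sup>2 + a * x + a\<^sup>2)) = 30 * x ^ 3 - 30 * a ^ 3"
      by (simp add: power2_eq_square power3_eq_cube algebra_simps)
    then show ?thesis using a x by linarith
  qed
  then have "\<bar>x - a\<bar> * \<bar>30 * (x\<^sup>2 + a * x + a\<^sup>2)\<bar> = \<bar>t\<bar> * \<bar>x\<bar>"
    by (simp only: abs_mult[symmetric])
  moreover have "0 \<le> 30 * (x\<^sup>2 + a * x + a\<^sup>2)" using a x by simp
  ultimately have "\<bar>x - a\<bar> * (30 * (x\<^sup>2 + a * x + a\<^sup>2)) = \<bar>t\<bar> * x"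
    using x by (simp only: abs_of_nonneg abs_of_pos)
  moreover have "\<bar>x - a\<bar> * (a * x) \<le> \<bar>x - a\<bar> * (30 * (x\<^sup>2 + a * x + a\<^sup>2))"
  proof (rule mult_left_mono)
    have "0 \<le> a * x" using a x by simp
    then show "a * x \<le> 30 * (x\<^sup>2 + a * x + a\<^sup>2)" using zero_le_power2[of x] zero_le_power2[of a] by simp
  qed simp
  ultimately have "x * (\<bar>x - a\<bar> * a) \<le> x * \<bar>t\<bar>" by (simp add: mult_ac)
  then have "\<bar>x - a\<bar> * a \<le> \<bar>t\<bar>" using x by simp
  then show ?thesis using a unfolding a_x_def by (simp add: pos_le_divide_eq)
qed

lemma B_asymp:
  "((\<lambda>n. B t (real n + 1/2) - root 3 (real n / 60)) \<longlongrightarrow> 0) sequentially"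
proof -
  let ?e = "\<lambda>n. \<bar>t\<bar> * (1 / root 3 ((real n + 1/2) / 60)) + \<bar>root 3 ((real n + 1/2) / 60) - root 3 (real n / 60)\<bar>"
  have "?e
      \<longlonglongrightarrow> \<bar>t\<bar> * 0 + \<bar>0\<bar>"
    by (intro tendsto_add tendsto_mult tendsto_const tendsto_rabs) real_asymp+
  then have lim: "?e
      \<longlonglongrightarrow> 0" by simp
  have "norm (B t (real n + 1/2) - root 3 (real n / 60))
      \<le> ?e n" for n
    using B_cube_root[of "real n + 1/2" t]
      abs_triangle_ineq[of "B t (real n + 1/2) - root 3 ((real n + 1/2) / 60)" "root 3 ((real n + 1/2) / 60) - root 3 (real n / 60)"]
    by simp
  then show ?thesis by (intro Lim_null_comparison[OF _ lim] always_eventually allI)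
qed

text \<open>Toda flow: \<open>\<partial>\<^sub>t ln h\<^sub>n = b\<^sub>n + b\<^sub>n\<^sub>+\<^sub>1 \<approx> 2 (n/60)\<^sup>1\<^sup>/\<^sup>3\<close>, up to an error vanishing uniformly on compact sets.\<close>

lemma ln_H_increment:
  assumes "s \<le> t"
  shows "(\<lambda>n. ln (H t n) - ln (H s n) - 2 * (t - s) * root 3 (real n / 60)) \<longlonglongrightarrow> 0"
proof -
  obtain C N where CN: "\<forall>n\<ge>N. \<forall>u\<le>t. \<bar>b u n / B u (real n) - 1\<bar> \<le> C / (real n)\<^sup>2"
    using b_refined_B[of t] by auto
  define M where "M = \<bar>s\<bar> + \<bar>t\<bar>"
  define r where "r = (\<lambda>n. root 3 (real n / 60))"
  define g where "g = (\<lambda>n. \<bar>C\<bar> / (real n)\<^sup>2 * (r n + M / r n) + M / r n)"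
  have bb: "\<bar>b u n - r n\<bar> \<le> g n" if n: "n \<ge> N" "n > 0" and u: "s \<le> u" "u \<le> t" for u n
  proof -
    have r0: "r n > 0" using n by (simp add: r_def)
    have Bp: "B u (real n) > 0" using n by (intro B_pos) auto
    have uM: "\<bar>u\<bar> \<le> M" using u by (simp add: M_def)
    have "\<bar>u\<bar> / r n \<le> M / r n" using uM r0 by (intro divide_right_mono) auto
    then have B: "\<bar>B u (real n) - r n\<bar> \<le> M / r n"
      using B_cube_root[of "real n" u] n by (simp add: r_def)
    have "\<bar>b u n / B u (real n) - 1\<bar> \<le> C / (real n)\<^sup>2" using CN n u by auto
    also have "\<dots> \<le> \<bar>C\<bar> / (real n)\<^sup>2" by (intro divide_right_mono) auto
    finally have "\<bar>b u n / B u (real n) - 1\<bar> * B u (real n) \<le> \<bar>C\<bar> / (real n)\<^sup>2 * (r n + M / r n)"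
      using B Bp by (intro mult_mono) auto
    moreover have "\<bar>b u n - B u (real n)\<bar> = \<bar>b u n / B u (real n) - 1\<bar> * B u (real n)"
    proof -
      have "b u n - B u (real n) = (b u n / B u (real n) - 1) * B u (real n)"
        using Bp by (simp add: left_diff_distrib)
      then show ?thesis using Bp by (simp only: abs_mult abs_of_pos)
    qed
    ultimately show ?thesis
      using B abs_triangle_ineq[of "b u n - B u (real n)" "B u (real n) - r n"] unfolding g_def by simp
  qed
  let ?b = "\<lambda>n. (t - s) * (g n + g (Suc n) + \<bar>r (Suc n) - r n\<bar>)"
  have main: "\<bar>ln (H t n) - ln (H s n) - 2 * (t - s) * r n\<bar> \<le> ?b n"
    if n: "n \<ge> N" "n > 0" for n
  proof (cases "s = t")
    case False
    then have st: "s < t" using assms by simp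
    \<comment> \<open>The intermediate point z is unknown and varies with n; hence the bound g above
      is independent of the parameter in [s, t].\<close>
    have "\<exists>z. s < z \<and> z < t \<and> (ln (H t n) - 2 * t * r n) - (ln (H s n) - 2 * s * r n) = (t - s) * (b z n + b z (Suc n) - 2 * r n)"
    proof (rule MVT2[OF st])
      fix x
      have "((\<lambda>u. 2 * u * r n) has_real_derivative 2 * r n) (at x)" by (auto intro!: derivative_eq_intros)
      from DERIV_diff[OF ln_H_has_real_derivative this]
      show "((\<lambda>u. ln (H u n) - 2 * u * r n) has_real_derivative b x n + b x (Suc n) - 2 * r n) (at x)" .
    qed
    then obtain z where z: "s < z" "z < t"
      and eq: "(ln (H t n) - 2 * t * r n) - (ln (H s n) - 2 * s * r n) = (t - s) * (b z n + b z (Suc n) - 2 * r n)" by blast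
    have "\<bar>b z n + b z (Suc n) - 2 * r n\<bar> \<le> g n + g (Suc n) + \<bar>r (Suc n) - r n\<bar>"
    proof -
      have 1: "\<bar>b z n - r n\<bar> \<le> g n" "\<bar>b z (Suc n) - r (Suc n)\<bar> \<le> g (Suc n)"
        using n z by (auto intro!: bb)
      show ?thesis
      proof (rule abs_leI)
        show "b z n + b z (Suc n) - 2 * r n \<le> g n + g (Suc n) + \<bar>r (Suc n) - r n\<bar>"
          using 1[THEN abs_le_D1] abs_ge_self[of "r (Suc n) - r n"] by linarith
        show "- (b z n + b z (Suc n) - 2 * r n) \<le> g n + g (Suc n) + \<bar>r (Suc n) - r n\<bar>"
          using 1[THEN abs_le_D2] abs_ge_minus_self[of "r (Suc n) - r n"] by linarith
      qed
    qed
    then have "(t - s) * \<bar>b z n + b z (Suc n) - 2 * r n\<bar> \<le> ?b n"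
      using st by (intro mult_left_mono) auto
    moreover have "ln (H t n) - ln (H s n) - 2 * (t - s) * r n = (t - s) * (b z n + b z (Suc n) - 2 * r n)"
      using eq by (simp add: algebra_simps)
    ultimately show ?thesis using st by (simp add: abs_mult)
  qed simp
  have g: "g \<longlonglongrightarrow> 0"
  proof -
    have "(\<lambda>n. \<bar>C\<bar> * (1 / (real n)\<^sup>2 * root 3 (real n / 60)) + \<bar>C\<bar> * M * (1 / (real n)\<^sup>2 * (1 / root 3 (real n / 60)))
        + M * (1 / root 3 (real n / 60))) \<longlonglongrightarrow> \<bar>C\<bar> * 0 + \<bar>C\<bar> * M * 0 + M * 0"
      by (intro tendsto_add tendsto_mult[OF tendsto_const]) real_asymp+
    then show ?thesis unfolding g_def r_def by (simp add: algebra_simps)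
  qed
  have r: "(\<lambda>n. r (Suc n) - r n) \<longlonglongrightarrow> 0" unfolding r_def by real_asymp
  have "?b \<longlonglongrightarrow> (t - s) * (0 + 0 + \<bar>0\<bar>)"
    by (intro tendsto_mult tendsto_const tendsto_add tendsto_rabs g r LIMSEQ_Suc)
  then have lim: "?b \<longlonglongrightarrow> 0" by simp
  show ?thesis
    by (rule Lim_null_comparison[OF _ lim], rule eventually_sequentiallyI[of "Suc N"])
       (use main in \<open>simp add: r_def\<close>)
qed

text \<open>Convexity in t with gradient 2 \<open>B\<close> traps the increment between its tangents
  at s and t, and both slopes have the same leading term.\<close>

lemma G_increment:
  assumes "s \<le> t"
  shows "(\<lambda>n. G t (real n + 1/2) - G s (real n + 1/2) - 2 * (t - s) * root 3 (real n / 60)) \<longlonglongrightarrow> 0"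
proof (rule tendsto_sandwich)
  have *: "(\<lambda>n. 2 * (t - s) * (B u (real n + 1/2) - root 3 (real n / 60))) \<longlonglongrightarrow> 0" for u
    using tendsto_mult[OF tendsto_const[of "2 * (t - s)"] B_asymp[of u]] by simp
  show "(\<lambda>n. 2 * (t - s) * (B s (real n + 1/2) - root 3 (real n / 60))) \<longlonglongrightarrow> 0"
    "(\<lambda>n. 2 * (t - s) * (B t (real n + 1/2) - root 3 (real n / 60))) \<longlonglongrightarrow> 0" by (rule *)+
  show "\<forall>\<^sub>F n in sequentially. 2 * (t - s) * (B s (real n + 1/2) - root 3 (real n / 60))
      \<le> G t (real n + 1/2) - G s (real n + 1/2) - 2 * (t - s) * root 3 (real n / 60)"
    using G_convex_t[of "real _ + 1/2" s t] by (intro always_eventually allI) (simp add: algebra_simps)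
  show "\<forall>\<^sub>F n in sequentially. G t (real n + 1/2) - G s (real n + 1/2) - 2 * (t - s) * root 3 (real n / 60)
      \<le> 2 * (t - s) * (B t (real n + 1/2) - root 3 (real n / 60))"
    using G_convex_t[of "real _ + 1/2" t s] by (intro always_eventually allI) (simp add: algebra_simps)
qed

text \<open>The limits are interchanged through the rate C / n: at fixed n, letting the parameter go
  to -infinity gives the same bound for the distance of \<open>stirling_error n\<close> from the
  common limit. So the Stirling errors converge to that limit, which must be 0.\<close>

theorem E_tendsto_0: "E t \<longlonglongrightarrow> 0"
proof -
  obtain Einf C N where lim: "\<And>s. s \<le> t \<Longrightarrow> E s \<longlonglongrightarrow> Einf s"
    and CN: "\<And>s n. s \<le> t \<Longrightarrow> n \<ge> N \<Longrightarrow> \<bar>Einf s - E s n\<bar> \<le> C / real n"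
    by (rule E_limit[of t]) blast
  have const: "Einf s = Einf t" if "s \<le> t" for s
  proof -
    have "(\<lambda>n. E t n - E s n) = (\<lambda>n. (ln (H t n) - ln (H s n) - 2 * (t - s) * root 3 (real n / 60))
        - (G t (real n + 1/2) - G s (real n + 1/2) - 2 * (t - s) * root 3 (real n / 60)))"
      by (simp add: E_def fun_eq_iff)
    then have "(\<lambda>n. E t n - E s n) \<longlonglongrightarrow> 0 - 0"
      using tendsto_diff[OF ln_H_increment[OF that] G_increment[OF that]] by simp
    moreover have "(\<lambda>n. E t n - E s n) \<longlonglongrightarrow> Einf t - Einf s"
      by (intro tendsto_diff lim that) auto
    ultimately have "0 - 0 = Einf t - Einf s" by (rule LIMSEQ_unique)
    then show ?thesis by simp
  qed
  have bound: "\<bar>Einf t - stirling_error n\<bar> \<le> C / real n" if n: "n \<ge> N" for n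
  proof (rule tendsto_upperbound)
    show "((\<lambda>a. \<bar>Einf t - E (- a) n\<bar>) \<longlongrightarrow> \<bar>Einf t - stirling_error n\<bar>) at_top"
      by (intro tendsto_intros E_at_bot)
    show "\<forall>\<^sub>F a in at_top. \<bar>Einf t - E (- a) n\<bar> \<le> C / real n"
      using eventually_ge_at_top[of "- t"]
    proof eventually_elim
      case (elim a)
      then have a: "- a \<le> t" by simp
      show ?case using CN[OF a n] const[OF a] by simp
    qed
  qed simp
  have "(\<lambda>n. stirling_error n - Einf t) \<longlonglongrightarrow> 0"
  proof (rule Lim_null_comparison)
    show "\<forall>\<^sub>F n in sequentially. norm (stirling_error n - Einf t) \<le> C / real n"
      using bound by (auto simp: abs_minus_commute intro: eventually_sequentiallyI[of N])
    show "(\<lambda>n. C / real n) \<longlonglongrightarrow> 0" by real_asymp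
  qed
  then have "stirling_error \<longlonglongrightarrow> Einf t" by (rule LIM_zero_cancel)
  then have "Einf t = 0" by (rule stirling_error_limit)
  then show ?thesis using lim[of t] by simp
qed

subsection \<open>The expansion for fixed \<open>t\<close>\<close>

text \<open>Reduces asymptotic claims in n to checking coefficients of polynomials in z =
  n^(-2/3).\<close>

lemma poly_bigo_monom:
  fixes p :: "real poly" and z :: "'a \<Rightarrow> real"
  assumes "\<And>i. i < k \<Longrightarrow> coeff p i = 0" and z: "(z \<longlongrightarrow> 0) F"
  shows "(\<lambda>n. poly p (z n)) \<in> O[F](\<lambda>n. z n ^ k)"
proof -
  have "monom 1 k dvd p" using assms(1) by (simp add: monom_1_dvd_iff')
  then obtain q where q: "p = monom 1 k * q" by (elim dvdE)
  have "((\<lambda>n. poly q (z n)) \<longlongrightarrow> poly q 0) F" by (intro tendsto_intros z)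
  then have "(\<lambda>n. poly q (z n)) \<in> O[F](\<lambda>_. 1)" by (intro bigoI_tendsto[where c = "poly q 0"]) simp_all
  then have "(\<lambda>n. z n ^ k * poly q (z n)) \<in> O[F](\<lambda>n. z n ^ k * 1)"
    by (intro landau_o.big.mult) auto
  then show ?thesis by (simp add: q poly_monom)
qed

lemma bigo_tendsto_0:
  fixes f g :: "'a \<Rightarrow> real"
  assumes "f \<in> O[F](g)" "(g \<longlongrightarrow> 0) F"
  shows "(f \<longlongrightarrow> 0) F"
proof -
  obtain c where "\<forall>\<^sub>F n in F. norm (f n) \<le> c * norm (g n)" using assms(1) by (elim landau_o.bigE)
  moreover have "((\<lambda>n. c * norm (g n)) \<longlongrightarrow> 0) F"
    using tendsto_mult_right_zero[OF tendsto_norm_zero[OF assms(2)]] .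
  ultimately show ?thesis by (rule Lim_null_comparison)
qed

text \<open>Order four is the right cut-off, as z^5 = n^(-10/3) is smaller than the target
  n^-3.\<close>

lemma ln_taylor_4_bigo:
  assumes z: "(z \<longlongrightarrow> (0::real)) F" and w: "w \<in> O[F](z)"
  shows "(\<lambda>n. ln (1 + w n) - (w n - w n ^ 2 / 2 + w n ^ 3 / 3 - w n ^ 4 / 4)) \<in> O[F](\<lambda>n. z n ^ 5)"
proof -
  have w0: "(w \<longlongrightarrow> 0) F" by (rule bigo_tendsto_0[OF w z])
  let ?f = "\<lambda>x::real. ln (1 + x) - (x - x ^ 2 / 2 + x ^ 3 / 3 - x ^ 4 / 4)"
  have "?f \<in> O[at 0](\<lambda>x. x ^ 5)" by real_asymp
  then obtain c where "\<forall>\<^sub>F x in at 0. norm (?f x) \<le> c * norm (x ^ 5)" by (elim landau_o.bigE)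
  then have "\<forall>\<^sub>F x in nhds 0. norm (?f x) \<le> c * norm (x ^ 5)"
    by (auto simp: eventually_at_filter elim: eventually_mono)
  then have "\<forall>\<^sub>F n in F. norm (?f (w n)) \<le> c * norm (w n ^ 5)"
    using w0 by (rule eventually_compose_filterlim)
  then have "(\<lambda>n. ?f (w n)) \<in> O[F](\<lambda>n. w n ^ 5)" by (rule bigoI)
  also have "(\<lambda>n. w n ^ 5) \<in> O[F](\<lambda>n. z n ^ 5)" by (rule landau_o.big_power[OF w])
  finally show ?thesis .
qed

text \<open>
  With \<open>c = 60\<^sup>1\<^sup>/\<^sup>3\<close>, \<open>\<tau> = 2 t / c\<close> and \<open>z = n\<^sup>-\<^sup>2\<^sup>/\<^sup>3\<close>, the formal solution of the string equation is
  \<open>\<alpha>(n) / c\<close> with \<open>\<alpha>(n) = n\<^sup>1\<^sup>/\<^sup>3 (1 + a1 z + a3 z\<^sup>3 + a4 z\<^sup>4)\<close>; the coefficient of \<open>z\<^sup>2\<close> vanishes.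
  \<open>\<alpha>1\<close> and \<open>\<alpha>2\<close> are the leading parts of \<open>\<alpha>'\<close> and \<open>\<alpha>'' / 2\<close>.
\<close>

definition \<alpha> :: "real \<Rightarrow> real \<Rightarrow> real \<Rightarrow> real \<Rightarrow> real" where
  "\<alpha> a1 a3 a4 x = x powr (1/3) + a1 * x powr (-1/3) + a3 * x powr (-5/3) + a4 * x powr (-7/3)"

definition \<alpha>1 :: "real \<Rightarrow> real \<Rightarrow> real" where
  "\<alpha>1 a1 x = 1/3 * x powr (-2/3) - a1 / 3 * x powr (-4/3)"

definition \<alpha>2 :: "real \<Rightarrow> real \<Rightarrow> real" where
  "\<alpha>2 a1 x = - 1/9 * x powr (-5/3) + 2 * a1 / 9 * x powr (-7/3)"

text \<open>Taylor expansion at n. Odd first-order terms cancel by symmetry; 20 = 6 + 6 + 4 + 4 sums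
  the squared shifts of the linear part, and 5 = 2 + 1 - 1 + 1 + 2 sums the products of shifts in
  the quadratic part.\<close>

lemma string_sum_\<alpha>_bigo:
  fixes a1 a3 a4 :: real
  defines "f \<equiv> \<alpha> a1 a3 a4"
  shows "(\<lambda>n::nat. string_sum (f (real n - 2)) (f (real n - 1)) (f (real n)) (f (real n + 1)) (f (real n + 2))
     - (10 * f (real n) ^ 2 + 20 * (f (real n) * \<alpha>2 a1 (real n)) + 5 * \<alpha>1 a1 (real n) ^ 2))
     \<in> O(\<lambda>n. real n powr (-7/3))" (is "?lhs \<in> _")
proof -
  let ?O = "\<lambda>r. O(\<lambda>n::nat. real n powr r)"
  define g g1 g2 where "g = (\<lambda>n::nat. f (real n))" and "g1 = (\<lambda>n::nat. \<alpha>1 a1 (real n))" and "g2 = (\<lambda>n::nat. \<alpha>2 a1 (real n))"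
  define p where "p = (\<lambda>j (n::nat). f (real n + j) - f (real n))"
  define s where "s = (\<lambda>j (n::nat). p j n - j * g1 n)"
  define q where "q = (\<lambda>j (n::nat). s j n - j\<^sup>2 * g2 n)"
  note defs = q_def s_def p_def g_def g1_def g2_def f_def \<alpha>_def \<alpha>1_def \<alpha>2_def
  have prodO: "(\<lambda>n. u n * v n) \<in> ?O (r + r')" if "u \<in> ?O r" "v \<in> ?O r'" for u v r r'
    using landau_o.big.mult[OF that] by (simp add: powr_add)
  have g: "g \<in> ?O (1/3)" unfolding defs by real_asymp
  have g1: "g1 \<in> ?O (-2/3)" unfolding defs by real_asymp
  have p: "p 1 \<in> ?O (-2/3)" "p (-1) \<in> ?O (-2/3)" "p 2 \<in> ?O (-2/3)" "p (-2) \<in> ?O (-2/3)"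
    unfolding defs by real_asymp+
  have s: "s 1 \<in> ?O (-5/3)" "s (-1) \<in> ?O (-5/3)" "s 2 \<in> ?O (-5/3)" "s (-2) \<in> ?O (-5/3)"
    unfolding defs by real_asymp+
  \<comment> \<open>The leading coefficient of q depends on a3 and may vanish; the added term has
    exactly the claimed order and is subtracted again afterwards.\<close>
  have "(\<lambda>n. q 1 n + real n powr (-8/3)) \<in> ?O (-8/3)" "(\<lambda>n. q (-1) n + real n powr (-8/3)) \<in> ?O (-8/3)"
    "(\<lambda>n. q 2 n + real n powr (-8/3)) \<in> ?O (-8/3)" "(\<lambda>n. q (-2) n + real n powr (-8/3)) \<in> ?O (-8/3)"
    unfolding defs by real_asymp+
  from this[THEN sum_in_bigo(2)[OF _ landau_o.big_refl]]
  have q: "q 1 \<in> ?O (-8/3)" "q (-1) \<in> ?O (-8/3)" "q 2 \<in> ?O (-8/3)" "q (-2) \<in> ?O (-8/3)"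
    by simp_all
  have pp: "(\<lambda>n. p i n * p j n - i * j * g1 n ^ 2) \<in> ?O (-7/3)"
    if "s i \<in> ?O (-5/3)" "s j \<in> ?O (-5/3)" "p j \<in> ?O (-2/3)" for i j
  proof -
    have "(\<lambda>n. i * (g1 n * s j n)) \<in> ?O (-7/3)"
      using prodO[OF g1 that(2)] by (cases "i = 0") simp_all
    then have "(\<lambda>n. s i n * p j n + i * (g1 n * s j n)) \<in> ?O (-7/3)"
      using prodO[OF that(1,3)] by (intro sum_in_bigo) simp_all
    then show ?thesis by (simp add: s_def power2_eq_square algebra_simps)
  qed
  let ?R = "\<lambda>n. g n * (6 * q 1 n + 6 * q (-1) n + q 2 n + q (-2) n)
      + (p (-2) n * p (-1) n - (-2) * (-1) * g1 n ^ 2) + (p (-1) n * p (-1) n - (-1) * (-1) * g1 n ^ 2)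
      + (p (-1) n * p 1 n - (-1) * 1 * g1 n ^ 2) + (p 1 n * p 1 n - 1 * 1 * g1 n ^ 2) + (p 1 n * p 2 n - 1 * 2 * g1 n ^ 2)"
  have "?R
     \<in> ?O (-7/3)"
  proof (intro sum_in_bigo(1) pp s p)
    have "(\<lambda>n. 6 * q 1 n + 6 * q (-1) n + q 2 n + q (-2) n) \<in> ?O (-8/3)"
      by (intro sum_in_bigo q landau_o.big.cmult_in_iff[THEN iffD2]) (auto intro: q)
    from prodO[OF g this] show "(\<lambda>n. g n * (6 * q 1 n + 6 * q (-1) n + q 2 n + q (-2) n)) \<in> ?O (-7/3)" by simp
  qed
  also have "?R = ?lhs"
  proof
    fix n
    have f: "f (real n - 2) = g n + p (-2) n" "f (real n - 1) = g n + p (-1) n" "f (real n) = g n"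
      "f (real n + 1) = g n + p 1 n" "f (real n + 2) = g n + p 2 n"
      by (simp_all add: g_def p_def)
    have q: "q 1 n = p 1 n - g1 n - g2 n" "q (-1) n = p (-1) n + g1 n - g2 n"
      "q 2 n = p 2 n - 2 * g1 n - 4 * g2 n" "q (-2) n = p (-2) n + 2 * g1 n - 4 * g2 n"
      by (simp_all add: q_def s_def)
    have g12: "\<alpha>1 a1 (real n) = g1 n" "\<alpha>2 a1 (real n) = g2 n" by (simp_all add: g1_def g2_def)
    show "?R n = ?lhs n"
      unfolding f q g12 string_sum_def by (simp add: power2_eq_square algebra_simps)
  qed
  finally show ?thesis .
qed

section \<open>The formal solution for fixed t and its residual\<close>

context
  fixes t c \<tau> a1 a3 a4 :: real
  defines "c \<equiv> root 3 60" and "\<tau> \<equiv> 2 * t / root 3 60"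
    and "a1 \<equiv> 2 * t / root 3 60 / 3" and "a3 \<equiv> 1/18 - (2 * t / root 3 60) ^ 3 / 81"
    and "a4 \<equiv> - (2 * t / root 3 60) / 81 + (2 * t / root 3 60) ^ 4 / 243"
begin

lemma c_pos: "c > 0" and c_cube: "c ^ 3 = 60" and t_eq: "2 * t = c * \<tau>"
  by (simp_all add: c_def \<tau>_def)

lemma a_eqs: "a1 = \<tau> / 3" "a3 = 1/18 - \<tau> ^ 3 / 81" "a4 = - \<tau> / 81 + \<tau> ^ 4 / 243"
  by (simp_all add: a1_def a3_def a4_def \<tau>_def)

definition u_poly :: "real poly" where "u_poly = [:1, a1, 0, a3, a4:]"

text \<open>The residual of \<alpha> divided by n, as a polynomial in z, once the neighbours are
  replaced by their Taylor terms: the middle summands are 2 \<alpha>^2 \<alpha>2 and \<alpha>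
  \<alpha>1^2 / 2. The values of a1, a3, a4 come from making its coefficients below z^5
  vanish.\<close>

definition res_poly :: "real poly" where
  "res_poly = u_poly ^ 3 + u_poly ^ 2 * [:0, 0, 0, -2/9, 4 * a1 / 9:]
     + smult (1/18) (u_poly * [:0, 0, 0, 1:] * [:1, - a1:] ^ 2) - [:0, \<tau>:] * u_poly - 1"

lemma powr_third:
  fixes x :: real
  assumes "x > 0"
  defines "q \<equiv> x powr (1/3)"
  shows "q > 0" "x = q ^ 3" "x powr (-1/3) = 1 / q" "x powr (-2/3) = 1 / q ^ 2" "x powr (-4/3) = 1 / q ^ 4"
    "x powr (-5/3) = 1 / q ^ 5" "x powr (-7/3) = 1 / q ^ 7" "x powr (-8/3) = 1 / q ^ 8"
proof -
  show "q > 0" using assms by simp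
  have "q ^ k = x powr (real k / 3)" for k
    using assms by (simp add: q_def powr_powr flip: powr_realpow)
  from this[of 1] this[of 2] this[of 3] this[of 4] this[of 5] this[of 7] this[of 8]
  show "x = q ^ 3" "x powr (-1/3) = 1 / q" "x powr (-2/3) = 1 / q ^ 2" "x powr (-4/3) = 1 / q ^ 4"
    "x powr (-5/3) = 1 / q ^ 5" "x powr (-7/3) = 1 / q ^ 7" "x powr (-8/3) = 1 / q ^ 8"
    using assms by (simp_all add: powr_minus_divide)
qed

lemma \<alpha>_eq:
  assumes "x > 0"
  shows "\<alpha> a1 a3 a4 x = x powr (1/3) * poly u_poly (x powr (-2/3))"
proof -
  define q where "q = x powr (1/3)"
  note q = powr_third[OF assms, folded q_def]
  show ?thesis
    unfolding \<alpha>_def q(3-8) q_def[symmetric] using q(1)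
    by (simp add: u_poly_def field_simps power_numeral_reduce)
qed

lemma residual_eq:
  assumes "x > 0"
  shows "\<alpha> a1 a3 a4 x * ((10 * \<alpha> a1 a3 a4 x ^ 2 + 20 * (\<alpha> a1 a3 a4 x * \<alpha>2 a1 x) + 5 * \<alpha>1 a1 x ^ 2) / 10 - \<tau>) - x
    = x * poly res_poly (x powr (-2/3))"
proof -
  define q where "q = x powr (1/3)"
  note q = powr_third[OF assms, folded q_def]
  define u where "u = poly u_poly (x powr (-2/3))"
  have 1: "\<alpha> a1 a3 a4 x = q * u" unfolding u_def q_def by (rule \<alpha>_eq[OF assms])
  have 2: "\<alpha>1 a1 x = (1 - a1 / q ^ 2) / (3 * q ^ 2)"
    unfolding \<alpha>1_def q(4,5) using q(1) by (simp add: field_simps power_numeral_reduce)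
  have 3: "\<alpha>2 a1 x = (-1/9 + 2 * a1 / 9 / q ^ 2) / q ^ 5"
    unfolding \<alpha>2_def q(6,7) using q(1) by (simp add: field_simps power_numeral_reduce)
  have 4: "poly res_poly (x powr (-2/3)) = u ^ 3 + u ^ 2 * ((-2/9 + 4 * a1 / 9 / q ^ 2) / q ^ 6)
     + 1/18 * (u * (1 / q ^ 6) * (1 - a1 / q ^ 2) ^ 2) - \<tau> / q ^ 2 * u - 1"
    unfolding res_poly_def u_def[symmetric] poly_add poly_diff poly_mult poly_power poly_smult
    unfolding u_def[symmetric] q(4) using q(1) by (simp add: field_simps power_numeral_reduce)
  show ?thesis
    unfolding 1 2 3 4 unfolding q(2) using q(1)
    by (simp add: field_simps power_numeral_reduce)
qed

lemma coeff_res_poly: "i < 5 \<Longrightarrow> coeff res_poly i = 0"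
proof -
  assume "i < 5"
  then have "i \<in> {0, 1, 2, 3, 4}" by auto
  then show ?thesis
    by (auto simp: res_poly_def u_poly_def a_eqs power2_eq_square power3_eq_cube coeff_pCons
        numeral_eq_Suc one_pCons field_simps)
qed

lemma z_tendsto: "(\<lambda>n::nat. real n powr (-2/3)) \<longlonglongrightarrow> 0" by real_asymp

lemma z5_bigo: "(\<lambda>n::nat. (real n powr (-2/3)) ^ 5) \<in> O(\<lambda>n. 1 / real n ^ 3)" by real_asymp

text \<open>Two errors meet: n z^5 = n^(-7/3) from the truncated series, and n^(1/3) n^(-7/3) = n^-2
  from the Taylor expansion. Relative to n this is order n^-3.\<close>

lemma residual_bigo:
  defines "f \<equiv> \<alpha> a1 a3 a4"
  shows "(\<lambda>n::nat. f (real n) * (string_sum (f (real n - 2)) (f (real n - 1)) (f (real n)) (f (real n + 1)) (f (real n + 2)) / 10 - \<tau>) - real n)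
     \<in> O(\<lambda>n. 1 / real n ^ 2)"
proof -
  let ?p = "\<lambda>n::nat. poly res_poly (real n powr (-2/3))"
  let ?M = "\<lambda>n::nat. 10 * f (real n) ^ 2 + 20 * (f (real n) * \<alpha>2 a1 (real n)) + 5 * \<alpha>1 a1 (real n) ^ 2"
  let ?S = "\<lambda>n::nat. string_sum (f (real n - 2)) (f (real n - 1)) (f (real n)) (f (real n + 1)) (f (real n + 2))"
  have "(\<lambda>n::nat. ?p n) \<in> O(\<lambda>n. (real n powr (-2/3)) ^ 5)"
    by (rule poly_bigo_monom[OF coeff_res_poly z_tendsto])
  also note z5_bigo
  finally have "(\<lambda>n::nat. real n * ?p n) \<in> O(\<lambda>n. real n * (1 / real n ^ 3))"
    by (intro landau_o.big.mult) auto
  also have "(\<lambda>n::nat. real n * (1 / real n ^ 3)) \<in> O(\<lambda>n. 1 / real n ^ 2)" by real_asymp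
  finally have 1: "(\<lambda>n::nat. real n * ?p n) \<in> O(\<lambda>n. 1 / real n ^ 2)" .
  have "(\<lambda>n::nat. f (real n)) \<in> O(\<lambda>n. real n powr (1/3))" unfolding f_def \<alpha>_def by real_asymp
  then have "(\<lambda>n::nat. f (real n) * (?S n - ?M n)) \<in> O(\<lambda>n. real n powr (1/3) * real n powr (-7/3))"
    using string_sum_\<alpha>_bigo[of a1 a3 a4] unfolding f_def by (rule landau_o.big.mult)
  also have "(\<lambda>n. real n powr (1/3) * real n powr (-7/3)) \<in> O(\<lambda>n::nat. 1 / real n ^ 2)" by real_asymp
  finally have "(\<lambda>n::nat. 1/10 * (f (real n) * (?S n - ?M n))) \<in> O(\<lambda>n. 1 / real n ^ 2)"
    by (intro landau_o.big.cmult_in_iff[THEN iffD2]) auto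
  from sum_in_bigo(1)[OF 1 this] show ?thesis
  proof (rule landau_o.big.in_cong[THEN iffD1, rotated])
    show "\<forall>\<^sub>F n in sequentially. real n * ?p n + 1/10 * (f (real n) * (?S n - ?M n))
      = f (real n) * (?S n / 10 - \<tau>) - real n"
      using eventually_gt_at_top[of 0]
    proof eventually_elim
      case (elim n)
      have "real n * ?p n = f (real n) * (?M n / 10 - \<tau>) - real n"
        using residual_eq[of "real n"] elim unfolding f_def by simp
      then show ?case by (simp add: field_simps)
    qed
  qed
qed

text \<open>Stability on the one-point set {t} with the finer approximant. The initial closeness it
  demands is obtained by comparing b with \<open>B\<close>, \<open>B\<close> with (n/60)^(1/3), and
  the latter with \<alpha> / c.\<close>

lemma b_expansion: "(\<lambda>n. b t n / (\<alpha> a1 a3 a4 (real n) / c) - 1) \<in> O(\<lambda>n. 1 / real n ^ 3)"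
proof -
  define f where "f = \<alpha> a1 a3 a4"
  let ?S = "\<lambda>n::nat. string_sum (f (real n - 2)) (f (real n - 1)) (f (real n)) (f (real n + 1)) (f (real n + 2))"
  define A where "A = (\<lambda>(t::real) (n::nat). f (real n) / c)"
  have c: "c > 0" by (rule c_pos)
  obtain K where K: "\<forall>\<^sub>F n in sequentially. norm (f (real n) * (?S n / 10 - \<tau>) - real n)
     \<le> K * norm (1 / real n ^ 2)" and K0: "K > 0"
    using residual_bigo unfolding f_def by (elim landau_o.bigE)
  have evpos: "\<forall>\<^sub>F n::nat in sequentially. f (real n) > 0" unfolding f_def \<alpha>_def by real_asymp
  have lims: "(\<lambda>n::nat. f (real n - 2) / f (real n)) \<longlonglongrightarrow> 1" "(\<lambda>n::nat. f (real n - 1) / f (real n)) \<longlonglongrightarrow> 1"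
    "(\<lambda>n::nat. f (real n + 1) / f (real n)) \<longlonglongrightarrow> 1" "(\<lambda>n::nat. f (real n + 2) / f (real n)) \<longlonglongrightarrow> 1"
    "(\<lambda>n::nat. f (real n) ^ 3 / real n) \<longlonglongrightarrow> 1"
    unfolding f_def \<alpha>_def by real_asymp+
  have blim: "(\<lambda>n. b t n / (f (real n) / c)) \<longlonglongrightarrow> 1"
  proof -
    let ?R = "\<lambda>n. b t n / B t (real n) * (B t (real n) / root 3 (real n / 60)) * (root 3 (real n / 60) / (f (real n) / c))"
    have "(\<lambda>n. b t n / B t (real n)) \<longlonglongrightarrow> 1"
    proof (rule LIMSEQ_I)
      fix r :: real assume r: "r > 0"
      then obtain N where "\<forall>n\<ge>N. \<forall>s\<le>t. \<bar>b s n / B s (real n) - 1\<bar> \<le> r / 2"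
        using b_asymp_B[of "r / 2" t] by auto
      then have "\<forall>n\<ge>N. \<bar>b t n / B t (real n) - 1\<bar> \<le> r / 2" by blast
      then show "\<exists>no. \<forall>n\<ge>no. norm (b t n / B t (real n) - 1) < r"
        using r by (intro exI[of _ N]) (auto intro: le_less_trans[of _ "r / 2"])
    qed
    moreover have "(\<lambda>n. B t (real n) / root 3 (real n / 60)) \<longlonglongrightarrow> 1"
    proof (rule LIM_zero_cancel, rule Lim_null_comparison)
      show "(\<lambda>n. \<bar>t\<bar> * (1 / root 3 (real n / 60) ^ 2)) \<longlonglongrightarrow> 0"
        by (rule tendsto_mult_right_zero) real_asymp
      show "\<forall>\<^sub>F n in sequentially. norm (B t (real n) / root 3 (real n / 60) - 1) \<le> \<bar>t\<bar> * (1 / root 3 (real n / 60) ^ 2)"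
        using eventually_gt_at_top[of 0]
      proof eventually_elim
        case (elim n)
        define r where "r = root 3 (real n / 60)"
        have r: "r > 0" using elim by (simp add: r_def)
        have "\<bar>B t (real n) - r\<bar> / r \<le> \<bar>t\<bar> / r / r"
          using B_cube_root[of "real n" t] elim r by (intro divide_right_mono) (auto simp: r_def)
        moreover have "\<bar>B t (real n) / r - 1\<bar> = \<bar>B t (real n) - r\<bar> / r"
        proof -
          have "B t (real n) / r - 1 = (B t (real n) - r) / r" using r by (simp add: diff_divide_distrib)
          then show ?thesis using r by (simp add: abs_divide)
        qed
        ultimately show ?case by (simp add: r_def power2_eq_square)
      qed
    qed
    moreover have "(\<lambda>n::nat. root 3 (real n / 60) / (f (real n) / c)) \<longlonglongrightarrow> 1"
    proof -
      have "(\<lambda>n::nat. root 3 (real n) / f (real n)) \<longlonglongrightarrow> 1" unfolding f_def \<alpha>_def by real_asymp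
      then show ?thesis by (simp add: real_root_divide c_def)
    qed
    ultimately have "?R \<longlonglongrightarrow> 1 * 1 * 1"
      by (intro tendsto_mult)
    then have "?R \<longlonglongrightarrow> 1" by simp
    then show ?thesis
    proof (rule Lim_transform_eventually)
      show "\<forall>\<^sub>F n in sequentially. ?R n = b t n / (f (real n) / c)"
        using eventually_gt_at_top[of 0]
      proof eventually_elim
        case (elim n)
        then have "B t (real n) \<noteq> 0" "root 3 (real n / 60) \<noteq> 0" using B_pos[of "real n" t] by auto
        then show ?case by simp
      qed
    qed
  qed
  have close: "\<forall>\<^sub>F n in sequentially. \<bar>X n - 1\<bar> \<le> 1/1000" if "X \<longlonglongrightarrow> 1" for X :: "nat \<Rightarrow> real"
    using tendstoD[OF that, of "1/1000"] by (auto simp: dist_real_def elim!: eventually_mono)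
  define good where "good = (\<lambda>n::nat. n \<ge> 2 \<and> f (real n) > 0 \<and> \<bar>f (real n - 2) / f (real n) - 1\<bar> \<le> 1/1000
     \<and> \<bar>f (real n - 1) / f (real n) - 1\<bar> \<le> 1/1000 \<and> \<bar>f (real n + 1) / f (real n) - 1\<bar> \<le> 1/1000
     \<and> \<bar>f (real n + 2) / f (real n) - 1\<bar> \<le> 1/1000 \<and> \<bar>f (real n) ^ 3 / real n - 1\<bar> \<le> 1/1000
     \<and> \<bar>b t n / (f (real n) / c) - 1\<bar> \<le> 1/1000
     \<and> norm (f (real n) * (?S n / 10 - \<tau>) - real n) \<le> K * norm (1 / real n ^ 2))"
  have "\<forall>\<^sub>F n in sequentially. good n" unfolding good_def
    by (intro eventually_conj eventually_ge_at_top evpos close lims blim K)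
  then obtain N where N: "\<And>n. n \<ge> N \<Longrightarrow> good n"
    unfolding eventually_sequentially by blast
  have "\<exists>C N'. \<forall>n\<ge>N'. \<forall>s\<in>{t}. \<bar>b s n / A s n - 1\<bar> \<le> C / real n ^ 3"
  proof (rule string_refine[of N "{t}" A K])
    fix n s assume n: "n \<ge> N" and s: "s \<in> {t}"
    have st: "s = t" using s by simp
    note Nn = N[OF n, unfolded good_def]
    then have n2: "n \<ge> 2" and fpos: "f (real n) > 0" by auto
    show "0 < A s n" using fpos c by (simp add: A_def)
    show "60 * A s n ^ 3 \<le> (1 + 1/1000) * real n"
    proof -
      have "f (real n) ^ 3 / real n \<le> 1 + 1/1000" using Nn by linarith
      then have "f (real n) ^ 3 \<le> (1 + 1/1000) * real n" using n2 by (simp add: pos_divide_le_eq)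
      then show ?thesis by (simp add: A_def power_divide c_cube)
    qed
    show "\<bar>b s n / A s n - 1\<bar> \<le> 1/1000" using Nn st by (simp add: A_def)
    show "\<bar>A s j - A s n\<bar> \<le> 1/1000 * A s n" if j: "n \<le> j + 2" "j \<le> n + 2" for j
    proof -
      have "j = n - 2 \<or> j = n - 1 \<or> j = n \<or> j = n + 1 \<or> j = n + 2" using j by linarith
      then have "real j = real n - 2 \<or> real j = real n - 1 \<or> real j = real n \<or> real j = real n + 1 \<or> real j = real n + 2"
        using n2 by (auto simp: of_nat_diff)
      then have "\<bar>f (real j) / f (real n) - 1\<bar> \<le> 1/1000" using Nn by auto
      moreover have "f (real j) / f (real n) - 1 = (f (real j) - f (real n)) / f (real n)"
        using fpos by (simp add: diff_divide_distrib)
      ultimately have "\<bar>f (real j) - f (real n)\<bar> \<le> 1/1000 * f (real n)"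
        using fpos by (simp add: abs_divide pos_divide_le_eq)
      then have "\<bar>f (real j) - f (real n)\<bar> / c \<le> 1/1000 * f (real n) / c"
        using c by (intro divide_right_mono) auto
      moreover have "\<bar>A s j - A s n\<bar> = \<bar>f (real j) - f (real n)\<bar> / c"
        using c by (simp add: A_def abs_divide flip: diff_divide_distrib)
      ultimately show ?thesis by (simp add: A_def)
    qed
    have hom: "string_sum (x2 / c) (x1 / c) (x / c) (y1 / c) (y2 / c) = string_sum x2 x1 x y1 y2 / c\<^sup>2" for x2 x1 x y1 y2
      using c by (simp add: string_sum_def power2_eq_square add_divide_distrib)
    have "A s n * (6 * string_sum (A s (n - 2)) (A s (n - 1)) (A s n) (A s (n + 1)) (A s (n + 2)) - 2 * s)
      = f (real n) / c * (6 * (?S n / c\<^sup>2) - c * \<tau>)"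
      using n2 unfolding A_def hom st t_eq by (simp add: of_nat_diff add.commute)
    also have "\<dots> = f (real n) * (6 * ?S n / c ^ 3 - \<tau>)"
      using c by (simp add: field_simps power2_eq_square power3_eq_cube)
    also have "\<dots> = f (real n) * (?S n / 10 - \<tau>)"
      by (simp add: c_cube)
    finally have eq: "A s n * (6 * string_sum (A s (n - 2)) (A s (n - 1)) (A s n) (A s (n + 1)) (A s (n + 2)) - 2 * s)
      = f (real n) * (?S n / 10 - \<tau>)" .
    have "K * norm (1 / real n ^ 2) = K / real n ^ 3 * real n"
      using n2 by (simp add: power2_eq_square power3_eq_cube)
    then show "\<bar>A s n * (6 * string_sum (A s (n - 2)) (A s (n - 1)) (A s n) (A s (n + 1)) (A s (n + 2)) - 2 * s) - real n\<bar>
        \<le> K / real n ^ 3 * real n"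
      using Nn unfolding eq by (simp only: real_norm_def)
  qed (use K0 in auto)
  then obtain C N' where "\<forall>n\<ge>N'. \<bar>b t n / A t n - 1\<bar> \<le> C / real n ^ 3" by auto
  then have "\<forall>\<^sub>F n in sequentially. norm (b t n / (f (real n) / c) - 1) \<le> C * norm (1 / real n ^ 3)"
    unfolding eventually_sequentially by (auto simp: A_def)
  then show ?thesis unfolding f_def by (rule bigoI)
qed

text \<open>The Taylor polynomial of degree four of ln (1 + a1 z + a3 z^3 + a4 z^4) at z =
  0.\<close>

definition l_poly :: "real poly" where
  "l_poly = [:0, \<tau> / 3, - (\<tau>\<^sup>2 / 18), 1 / 18, 5 * \<tau> ^ 4 / 972 - 5 * \<tau> / 162 :]"

lemma ln_u_bigo:
  "(\<lambda>n::nat. ln (poly u_poly (real n powr (-2/3))) - poly l_poly (real n powr (-2/3))) \<in> O(\<lambda>n. 1 / real n ^ 3)"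
proof -
  let ?z = "\<lambda>n::nat. real n powr (-2/3)"
  define w where "w = [:0, a1, 0, a3, a4:]"
  let ?t = "\<lambda>n. poly w (?z n) - poly w (?z n) ^ 2 / 2 + poly w (?z n) ^ 3 / 3 - poly w (?z n) ^ 4 / 4"
  let ?P = "w - smult (1/2) (w ^ 2) + smult (1/3) (w ^ 3) - smult (1/4) (w ^ 4) - l_poly"
  have u: "poly u_poly x = 1 + poly w x" for x by (simp add: u_poly_def w_def)
  have "(\<lambda>n. poly w (?z n)) \<in> O(\<lambda>n. ?z n ^ 1)"
    by (rule poly_bigo_monom[OF _ z_tendsto]) (simp add: w_def)
  then have "(\<lambda>n. ln (1 + poly w (?z n)) - (?t n))
      \<in> O(\<lambda>n. ?z n ^ 5)"
    by (intro ln_taylor_4_bigo[OF z_tendsto]) simp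
  moreover have "(\<lambda>n. poly (?P) (?z n)) \<in> O(\<lambda>n. ?z n ^ 5)"
  proof (rule poly_bigo_monom[OF _ z_tendsto])
    fix i :: nat assume "i < 5"
    then have "i \<in> {0, 1, 2, 3, 4}" by auto
    then show "coeff (?P) i = 0"
      by (auto simp: w_def l_poly_def a_eqs power2_eq_square power3_eq_cube power4_eq_xxxx coeff_pCons
          numeral_eq_Suc field_simps)
  qed
  ultimately have "(\<lambda>n. (ln (1 + poly w (?z n)) - (?t n))
     + poly (?P) (?z n)) \<in> O(\<lambda>n. ?z n ^ 5)"
    by (rule sum_in_bigo)
  also note z5_bigo
  finally show ?thesis by (simp add: u)
qed

lemma ln_b_bigo:
  "(\<lambda>n. ln (b t n) - (ln (real n) / 3 - ln 60 / 3 + poly l_poly (real n powr (-2/3)))) \<in> O(\<lambda>n. 1 / real n ^ 3)"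
proof -
  define e where "e = (\<lambda>n. b t n / (\<alpha> a1 a3 a4 (real n) / c) - 1)"
  have e: "e \<in> O(\<lambda>n. 1 / real n ^ 3)" unfolding e_def by (rule b_expansion)
  have "(\<lambda>n::nat. 1 / real n ^ 3) \<longlonglongrightarrow> 0" by real_asymp
  then have e0: "e \<longlonglongrightarrow> 0" by (rule bigo_tendsto_0[OF e])
  have "(\<lambda>n. ln (1 + e n)) \<in> O(e)"
  proof (rule bigoI)
    have "\<forall>\<^sub>F n in sequentially. \<bar>e n\<bar> \<le> 1/2"
      using tendstoD[OF e0, of "1/2"] by (auto elim!: eventually_mono)
    then show "\<forall>\<^sub>F n in sequentially. norm (ln (1 + e n)) \<le> 2 * norm (e n)"
      by eventually_elim (use abs_ln_one_plus_le in auto)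
  qed
  also note e
  finally have "(\<lambda>n. ln (1 + e n) + (ln (poly u_poly (real n powr (-2/3))) - poly l_poly (real n powr (-2/3))))
      \<in> O(\<lambda>n. 1 / real n ^ 3)"
    by (rule sum_in_bigo(1)[OF _ ln_u_bigo])
  then show ?thesis
  proof (rule landau_o.big.in_cong[THEN iffD1, rotated])
    have "\<forall>\<^sub>F n::nat in sequentially. \<alpha> a1 a3 a4 (real n) > 0" unfolding \<alpha>_def by real_asymp
    then show "\<forall>\<^sub>F n in sequentially. ln (1 + e n) + (ln (poly u_poly (real n powr (-2/3))) - poly l_poly (real n powr (-2/3)))
      = ln (b t n) - (ln (real n) / 3 - ln 60 / 3 + poly l_poly (real n powr (-2/3)))"
      using eventually_gt_at_top[of 0]
    proof eventually_elim
      case (elim n)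
      have bp: "b t n > 0" using elim by (intro b_pos) auto
      have up: "poly u_poly (real n powr (-2/3)) > 0"
        using elim \<alpha>_eq[of "real n"] by (simp add: zero_less_mult_iff)
      have "ln c = ln 60 / 3" by (simp add: c_def ln_root)
      moreover have "ln (1 + e n) = ln (b t n) - (ln (\<alpha> a1 a3 a4 (real n)) - ln c)"
        using bp elim c_pos by (simp add: e_def ln_div ln_mult)
      moreover have "ln (\<alpha> a1 a3 a4 (real n)) = ln (real n) / 3 + ln (poly u_poly (real n powr (-2/3)))"
        using up elim by (simp add: \<alpha>_eq ln_mult ln_powr)
      ultimately show ?case by linarith
    qed
  qed
qed

section \<open>The claimed expansion: its increments, its constant, and summation\<close>

definition Lf :: "real \<Rightarrow> real" where
  "Lf x = x * ln x / 3 - (1 + ln 60) / 3 * x + \<tau> * x powr (1/3) + ln x / 6 + ln (2 * pi) - ln 60 / 6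
    + \<tau>\<^sup>2 / 6 * x powr (-1/3) + \<tau> / 6 * x powr (-2/3) - 1 / (36 * x) - \<tau>\<^sup>2 / 36 * x powr (-4/3) - \<tau> ^ 4 / 324 * x powr (-5/3)"

text \<open>Sorting by powers of \<tau> leaves four comparisons between explicit functions of n that
  contain no parameter.\<close>

lemma Lf_diff_bigo:
  "(\<lambda>n::nat. Lf (real n) - Lf (real n - 1) - (ln (real n) / 3 - ln 60 / 3 + poly l_poly (real n powr (-2/3))))
     \<in> O(\<lambda>n. 1 / real n ^ 3)"
proof -
  let ?x = "\<lambda>n::nat. real n" let ?y = "\<lambda>n::nat. real n - 1" let ?z = "\<lambda>n::nat. real n powr (-2/3)"
  define g0 where "g0 = (\<lambda>n. (?x n * ln (?x n) - ?y n * ln (?y n)) / 3 - 1/3 + (ln (?x n) - ln (?y n)) / 6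
      - (1 / (36 * ?x n) - 1 / (36 * ?y n)) - (ln (?x n) / 3 + 1 / (18 * ?x n ^ 2)))"
  define g1 where "g1 = (\<lambda>n. ?x n powr (1/3) - ?y n powr (1/3) + (?x n powr (-2/3) - ?y n powr (-2/3)) / 6
      - (?z n / 3 - 5/162 * ?z n ^ 4))"
  define g2 where "g2 = (\<lambda>n. (?x n powr (-1/3) - ?y n powr (-1/3)) / 6 - (?x n powr (-4/3) - ?y n powr (-4/3)) / 36
      + ?z n ^ 2 / 18)"
  define g4 where "g4 = (\<lambda>n. - (?x n powr (-5/3) - ?y n powr (-5/3)) / 324 - 5/972 * ?z n ^ 4)"
  have "g0 \<in> O(\<lambda>n. 1 / real n ^ 3)"
  proof -
    let ?g = "\<lambda>n. 1/3 * ((?x n * ln (?x n) - ?y n * ln (?y n)) - ln (?x n) - 1 + 1 / (2 * ?x n) + 1 / (6 * ?x n ^ 2))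
        + 1/6 * (ln (?x n) - ln (?y n) - 1 / ?x n - 1 / (2 * ?x n ^ 2))
        - (1 / (36 * ?x n) - 1 / (36 * ?y n) + 1 / (36 * ?x n ^ 2))"
    have 1: "(\<lambda>n. (?x n * ln (?x n) - ?y n * ln (?y n)) - ln (?x n) - 1 + 1 / (2 * ?x n) + 1 / (6 * ?x n ^ 2)) \<in> O(\<lambda>n. 1 / real n ^ 3)"
      by real_asymp
    have 2: "(\<lambda>n. ln (?x n) - ln (?y n) - 1 / ?x n - 1 / (2 * ?x n ^ 2)) \<in> O(\<lambda>n. 1 / real n ^ 3)"
      by real_asymp
    have 3: "(\<lambda>n. 1 / (36 * ?x n) - 1 / (36 * ?y n) + 1 / (36 * ?x n ^ 2)) \<in> O(\<lambda>n. 1 / real n ^ 3)"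
      by real_asymp
    have "?g \<in> O(\<lambda>n. 1 / real n ^ 3)"
      by (intro sum_in_bigo 1[THEN landau_o.big.cmult_in_iff[THEN iffD2, rotated]]
          2[THEN landau_o.big.cmult_in_iff[THEN iffD2, rotated]] 3) simp_all
    also have "?g = g0"
      unfolding g0_def by (rule ext) (simp add: algebra_simps diff_divide_distrib add_divide_distrib)
    finally show ?thesis .
  qed
  moreover have "g1 \<in> O(\<lambda>n. 1 / real n ^ 3)" unfolding g1_def by real_asymp
  moreover have "g2 \<in> O(\<lambda>n. 1 / real n ^ 3)" unfolding g2_def by real_asymp
  moreover have "g4 \<in> O(\<lambda>n. 1 / real n ^ 3)" unfolding g4_def by real_asymp
  ultimately have "(\<lambda>n. g0 n + \<tau> * g1 n + \<tau>\<^sup>2 * g2 n + \<tau> ^ 4 * g4 n) \<in> O(\<lambda>n. 1 / real n ^ 3)"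
    by (intro sum_in_bigo) simp_all
  also have "(\<lambda>n. g0 n + \<tau> * g1 n + \<tau>\<^sup>2 * g2 n + \<tau> ^ 4 * g4 n) =
    (\<lambda>n::nat. Lf (real n) - Lf (real n - 1) - (ln (real n) / 3 - ln 60 / 3 + poly l_poly (real n powr (-2/3))))"
  proof
    fix n
    define x y where "x = ?x n" "y = ?y n"
    have yx: "y = x - 1" by (simp add: x_y_def)
    \<comment> \<open>The term 1 / (18 x^2) in g0 plays the role of the z^3 term of
      \<open>l_poly\<close>. At x = 0 both sides are 0 by the conventions for division and
      \<open>powr\<close>.\<close>
    have z3: "1 / (18 * x ^ 2) = (x powr (-2/3)) ^ 3 / 18"
    proof (cases "x = 0")
      case False
      then have "x > 0" by (simp add: x_y_def)
      then have "x\<^sup>2 = (x powr (1/3)) ^ 6" "(x powr (-2/3)) ^ 3 = 1 / (x powr (1/3)) ^ 6"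
        using powr_third(4)[of x] by (simp_all add: power_divide powr_powr flip: powr_realpow powr_numeral)
      then show ?thesis by simp
    qed simp
    have l: "poly l_poly z = \<tau> / 3 * z - \<tau>\<^sup>2 / 18 * z ^ 2 + z ^ 3 / 18 + (5 * \<tau> ^ 4 / 972 - 5 * \<tau> / 162) * z ^ 4" for z
      by (simp add: l_poly_def field_simps power_numeral_reduce)
    have "(1 + ln 60) / 3 * x - (1 + ln 60) / 3 * y = 1/3 + ln 60 / 3" by (simp add: yx field_simps)
    then show "g0 n + \<tau> * g1 n + \<tau>\<^sup>2 * g2 n + \<tau> ^ 4 * g4 n =
      Lf (real n) - Lf (real n - 1) - (ln (real n) / 3 - ln 60 / 3 + poly l_poly (real n powr (-2/3)))"
      unfolding g0_def g1_def g2_def g4_def Lf_def x_y_def[symmetric] l z3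
      by (simp add: add_divide_distrib diff_divide_distrib algebra_simps)
  qed
  finally show ?thesis .
qed

text \<open>An o(1) comparison suffices, its purpose being the additive constant. \<open>G\<close>
  is evaluated at a trial point X in place of the exact root: the maximum property bounds it from
  below, convexity in \<nu> from above, and the gap is the product of two null sequences.\<close>

lemma G_expansion: "(\<lambda>n::nat. G t (real n + 1/2) + ln (2 * pi) - Lf (real n)) \<longlonglongrightarrow> 0"
proof -
  \<comment> \<open>The correction 1 / (6 n) comes from the shift to n + 1/2 under the cube root,
    and \<tau> / 3 from the first coefficient of \<alpha>. With them the cubic at X misses n + 1/2
    by o(1) only.\<close>
  define Y where "Y = (\<lambda>n::nat. 1 + 1 / (6 * real n) + \<tau> / 3 * real n powr (-2/3))"
  define q where "q = (\<lambda>n::nat. real n powr (1/3))"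
  define X where "X = (\<lambda>n. q n * Y n / c)"
  define \<nu> where "\<nu> = (\<lambda>n::nat. real n + 1/2)"
  define \<nu>' where "\<nu>' = (\<lambda>n. 60 * X n ^ 3 - 2 * t * X n)"
  have \<nu>': "\<nu>' n = q n ^ 3 * Y n ^ 3 - \<tau> * (q n * Y n)" for n
    using c_pos by (simp add: \<nu>'_def X_def t_eq power_divide power_mult_distrib c_cube)
  let ?\<Phi> = "\<lambda>n. \<nu> n * ln (X n) - 20 * X n ^ 3 + 2 * t * X n"
  have Ypos: "\<forall>\<^sub>F n in sequentially. Y n > 0" unfolding Y_def by real_asymp
  have \<nu>'pos: "\<forall>\<^sub>F n in sequentially. \<nu>' n > 0" unfolding \<nu>' q_def Y_def by real_asymp
  have \<delta>: "(\<lambda>n. \<nu> n - \<nu>' n) \<longlonglongrightarrow> 0" unfolding \<nu>' \<nu>_def q_def Y_def by real_asymp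
  have lnB: "(\<lambda>n. ln (B t (\<nu> n)) - ln (X n)) \<longlonglongrightarrow> 0"
  proof -
    let ?W = "\<lambda>n. ((B t (\<nu> n) - root 3 (real n / 60)) * (1 / root 3 (real n / 60)) + 1) * (1 / Y n)"
    have r: "(\<lambda>n::nat. 1 / root 3 (real n / 60)) \<longlonglongrightarrow> 0" by real_asymp
    have "(\<lambda>n. (B t (\<nu> n) - root 3 (real n / 60)) * (1 / root 3 (real n / 60)) + 1) \<longlonglongrightarrow> 0 * 0 + 1"
      unfolding \<nu>_def by (intro tendsto_add tendsto_mult B_asymp r tendsto_const)
    moreover have "(\<lambda>n. 1 / Y n) \<longlonglongrightarrow> 1" unfolding Y_def by real_asymp
    ultimately have "(\<lambda>n. ?W n) \<longlonglongrightarrow> (0 * 0 + 1) * 1"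
      by (rule tendsto_mult)
    then have "(\<lambda>n. ln (?W n)) \<longlonglongrightarrow> ln ((0 * 0 + 1) * 1)"
      by (rule tendsto_ln) simp
    then have "(\<lambda>n. ln (?W n)) \<longlonglongrightarrow> 0" by simp
    then show ?thesis
    proof (rule Lim_transform_eventually)
      show "\<forall>\<^sub>F n in sequentially. ln (?W n)
        = ln (B t (\<nu> n)) - ln (X n)"
        using Ypos eventually_gt_at_top[of 0]
      proof eventually_elim
        case (elim n)
        have r: "root 3 (real n / 60) = q n / c"
          using elim by (simp add: real_root_divide c_def q_def root_powr_inverse)
        have pos: "q n > 0" "B t (\<nu> n) > 0" "c > 0"
          using elim c_pos by (auto simp: q_def \<nu>_def intro!: B_pos)
        have "((B t (\<nu> n) - q n / c) * (1 / (q n / c)) + 1) * (1 / Y n) = B t (\<nu> n) / X n"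
          using pos elim by (simp add: X_def field_simps)
        then show ?case using pos elim unfolding r by (simp add: ln_div ln_mult X_def)
      qed
    qed
  qed
  have main: "(\<lambda>n. ?\<Phi> n + ln (2 * pi) - Lf (real n)) \<longlonglongrightarrow> 0"
  proof -
    let ?U = "\<lambda>n::nat. (real n + 1/2) * (ln (real n) / 3 + ln (Y n)) - (real n / 3) * Y n ^ 3 + \<tau> * real n powr (1/3) * Y n
        - ((real n + 1/2) * ln (real n) / 3 + \<tau> * real n powr (1/3) - real n / 3)"
    let ?V = "\<lambda>n::nat. \<tau>\<^sup>2 / 6 * real n powr (-1/3) + \<tau> / 6 * real n powr (-2/3) - 1 / (36 * real n)
       - \<tau>\<^sup>2 / 36 * real n powr (-4/3) - \<tau> ^ 4 / 324 * real n powr (-5/3)"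
    have "?U \<longlonglongrightarrow> 0"
      unfolding Y_def by real_asymp
    moreover have "?V \<longlonglongrightarrow> \<tau>\<^sup>2 / 6 * 0 + \<tau> / 6 * 0 - 0 - \<tau>\<^sup>2 / 36 * 0 - \<tau> ^ 4 / 324 * 0"
      by (intro tendsto_add tendsto_diff tendsto_mult tendsto_const) real_asymp+
    ultimately have "(\<lambda>n. ?U n - ?V n) \<longlonglongrightarrow> 0 - (\<tau>\<^sup>2 / 6 * 0 + \<tau> / 6 * 0 - 0 - \<tau>\<^sup>2 / 36 * 0 - \<tau> ^ 4 / 324 * 0)"
      by (rule tendsto_diff)
    then have "(\<lambda>n. ?U n - ?V n) \<longlonglongrightarrow> 0" by simp
    then show ?thesis
    proof (rule Lim_transform_eventually)
      show "\<forall>\<^sub>F n in sequentially. ?U n - ?V n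
       = ?\<Phi> n + ln (2 * pi) - Lf (real n)"
        using Ypos eventually_gt_at_top[of 0]
      proof eventually_elim
        case (elim n)
        have qp: "q n > 0" using elim by (simp add: q_def)
        have "ln c = ln 60 / 3" by (simp add: c_def ln_root)
        then have lnX: "ln (X n) = ln (real n) / 3 + ln (Y n) - ln 60 / 3"
          using elim c_pos qp by (simp add: X_def ln_div ln_mult q_def ln_powr)
        have q3: "q n ^ 3 = real n" using powr_third(2)[of "real n"] elim by (simp add: q_def)
        have X3: "20 * X n ^ 3 = real n / 3 * Y n ^ 3"
          by (simp add: X_def power_divide power_mult_distrib c_cube q3)
        have tX: "2 * t * X n = \<tau> * real n powr (1/3) * Y n"
          using c_pos by (simp add: t_eq X_def q_def)
        show ?case unfolding lnX X3 tX \<nu>_def Lf_def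
          by (simp add: add_divide_distrib diff_divide_distrib algebra_simps)
      qed
    qed
  qed
  have "(\<lambda>n. (\<nu> n - \<nu>' n) * (ln (B t (\<nu> n)) - ln (X n))) \<longlonglongrightarrow> 0 * 0"
    by (intro tendsto_mult \<delta> lnB)
  then have up: "(\<lambda>n. (\<nu> n - \<nu>' n) * (ln (B t (\<nu> n)) - ln (X n))) \<longlonglongrightarrow> 0" by simp
  have bounds: "\<forall>\<^sub>F n in sequentially. 0 \<le> G t (\<nu> n) - (?\<Phi> n) \<and>
      G t (\<nu> n) - (?\<Phi> n) \<le> (\<nu> n - \<nu>' n) * (ln (B t (\<nu> n)) - ln (X n))"
    using Ypos \<nu>'pos eventually_gt_at_top[of 0]
  proof eventually_elim
    case (elim n)
    have \<nu>p: "\<nu> n > 0" by (simp add: \<nu>_def)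
    have Xp: "X n > 0" using elim c_pos by (simp add: X_def q_def)
    have BX: "B t (\<nu>' n) = X n" using Xp elim by (intro B_unique) (auto simp: \<nu>'_def)
    have G': "G t (\<nu>' n) = \<nu>' n * ln (X n) - 20 * X n ^ 3 + 2 * t * X n" by (simp add: G_def BX)
    have "?\<Phi> n \<le> G t (\<nu> n)" by (rule G_ge[OF Xp \<nu>p])
    moreover have "G t (\<nu> n) + (\<nu>' n - \<nu> n) * ln (B t (\<nu> n)) \<le> G t (\<nu>' n)"
      using elim \<nu>p by (intro G_convex_nu)
    ultimately show ?case unfolding G' by (simp add: algebra_simps)
  qed
  have "(\<lambda>n. G t (\<nu> n) - (?\<Phi> n)) \<longlonglongrightarrow> 0"
    by (rule tendsto_sandwich[OF _ _ tendsto_const up])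
       (use bounds in \<open>auto elim: eventually_mono\<close>)
  from tendsto_add[OF this main]
  have "(\<lambda>n. G t (\<nu> n) - (?\<Phi> n)
      + (?\<Phi> n + ln (2 * pi) - Lf (real n))) \<longlonglongrightarrow> 0"
    by (simp only: add_0_right)
  also have "(\<lambda>n. G t (\<nu> n) - (?\<Phi> n)
      + (?\<Phi> n + ln (2 * pi) - Lf (real n)))
    = (\<lambda>n. G t (real n + 1/2) + ln (2 * pi) - Lf (real n))"
    by (rule ext) (simp add: \<nu>_def)
  finally show ?thesis .
qed

text \<open>The difference D tends to 0 and has increments O(n^-3), so summing the tail from n to
  infinity gives O(n^-2) with no free constant.\<close>

lemma ln_H_expansion: "(\<lambda>n. ln (H t n) - Lf (real n)) \<in> O(\<lambda>n. 1 / real n ^ 2)"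
proof -
  let ?l = "\<lambda>n::nat. ln (real n) / 3 - ln 60 / 3 + poly l_poly (real n powr (-2/3))"
  define D where "D = (\<lambda>n. ln (H t n) - Lf (real n))"
  have D0: "D \<longlonglongrightarrow> 0"
    using tendsto_add[OF E_tendsto_0[of t] G_expansion] by (simp add: E_def D_def)
  have "(\<lambda>n. (ln (b t n) - ?l n)
     - (Lf (real n) - Lf (real n - 1) - ?l n))
     \<in> O(\<lambda>n. 1 / real n ^ 3)"
    by (intro sum_in_bigo ln_b_bigo Lf_diff_bigo)
  then obtain K where K: "K > 0" and "\<forall>\<^sub>F n in sequentially. norm ((ln (b t n) - ?l n)
     - (Lf (real n) - Lf (real n - 1) - ?l n))
     \<le> K * norm (1 / real n ^ 3)" by (elim landau_o.bigE)
  then obtain N where N: "\<And>n. n \<ge> N \<Longrightarrow> norm ((ln (b t n) - ?l n)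
     - (Lf (real n) - Lf (real n - 1) - ?l n))
     \<le> K * norm (1 / real n ^ 3)"
    unfolding eventually_sequentially by blast
  have step: "\<bar>D (Suc n) - D n\<bar> \<le> K * (1 / real (Suc n) ^ 3)" if "n \<ge> N" for n
  proof -
    have "ln (H t (Suc n)) = ln (b t (Suc n)) + ln (H t n)"
      using b_pos[of "Suc n" t] by (simp add: H_Suc ln_mult)
    then have "D (Suc n) - D n = ln (b t (Suc n)) - (Lf (real (Suc n)) - Lf (real (Suc n) - 1))"
      by (simp add: D_def)
    then show ?thesis using N[of "Suc n"] that by simp
  qed
  have tele: "\<bar>D m - D n\<bar> \<le> K * (1 / real n ^ 2)" if n: "n \<ge> N" "n \<ge> 1" and m: "m \<ge> n" for n m
  proof -
    have "\<bar>D m - D n\<bar> \<le> K * (1 / real n ^ 2 - 1 / real m ^ 2)"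
      using m
    proof (induction m rule: dec_induct)
      case (step m)
      define x where "x = real m"
      have x: "x \<ge> 1" using step n by (simp add: x_def)
      have "1 / (x + 1) ^ 3 \<le> 1 / x ^ 2 - 1 / (x + 1) ^ 2"
      proof -
        have "1 / x ^ 2 - 1 / (x + 1) ^ 2 = (2 * x + 1) / (x ^ 2 * (x + 1) ^ 2)"
        proof -
          have "(x + 1) ^ 2 - x ^ 2 = 2 * x + 1" by (simp add: power2_eq_square algebra_simps)
          then show ?thesis using x diff_frac_eq[of "x ^ 2" "(x + 1) ^ 2" 1 1] by simp
        qed
        moreover have "1 / (x + 1) ^ 3 = x ^ 2 / (x ^ 2 * (x + 1) ^ 3)" using x by simp
        moreover have "x ^ 2 / (x ^ 2 * (x + 1) ^ 3) \<le> (2 * x + 1) * (x + 1) / (x ^ 2 * (x + 1) ^ 3)"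
          using x by (intro divide_right_mono) (auto simp: power2_eq_square algebra_simps)
        moreover have "(2 * x + 1) * (x + 1) / (x ^ 2 * (x + 1) ^ 3) = (2 * x + 1) / (x ^ 2 * (x + 1) ^ 2)"
          using x by (simp add: power2_eq_square power3_eq_cube)
        ultimately show ?thesis by simp
      qed
      then have "K * (1 / (x + 1) ^ 3) \<le> K * (1 / x ^ 2 - 1 / (x + 1) ^ 2)" using K by (intro mult_left_mono) auto
      moreover have "\<bar>D (Suc m) - D m\<bar> \<le> K * (1 / (x + 1) ^ 3)"
        using \<open>\<And>n. n \<ge> N \<Longrightarrow> \<bar>D (Suc n) - D n\<bar> \<le> K * (1 / real (Suc n) ^ 3)\<close>[of m] step n by (simp add: x_def add.commute)
      moreover have "K * (1 / real n ^ 2 - 1 / (x + 1) ^ 2) = K * (1 / real n ^ 2 - 1 / x ^ 2) + K * (1 / x ^ 2 - 1 / (x + 1) ^ 2)"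
        by (simp add: right_diff_distrib)
      moreover have "\<bar>D (Suc m) - D n\<bar> \<le> \<bar>D (Suc m) - D m\<bar> + \<bar>D m - D n\<bar>" by linarith
      ultimately have "\<bar>D (Suc m) - D n\<bar> \<le> K * (1 / real n ^ 2 - 1 / (x + 1) ^ 2)"
        using step.IH unfolding x_def[symmetric] by linarith
      then show ?case by (simp add: x_def add.commute)
    qed simp
    also have "\<dots> \<le> K * (1 / real n ^ 2)" using K by (intro mult_left_mono) auto
    finally show ?thesis .
  qed
  have "\<bar>D n\<bar> \<le> K * (1 / real n ^ 2)" if n: "n \<ge> N" "n \<ge> 1" for n
  proof -
    have "(\<lambda>m. \<bar>D m - D n\<bar>) \<longlonglongrightarrow> \<bar>0 - D n\<bar>" by (intro tendsto_intros D0)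
    then have "\<bar>0 - D n\<bar> \<le> K * (1 / real n ^ 2)"
      by (rule LIMSEQ_le_const2) (use tele n in blast)
    then show ?thesis by simp
  qed
  then have "\<forall>\<^sub>F n in sequentially. norm (D n) \<le> K * norm (1 / real n ^ 2)"
    unfolding eventually_sequentially by (intro exI[of _ "max N 1"]) auto
  then show ?thesis unfolding D_def by (rule bigoI)
qed

end

theorem corollary3p5:
  fixes t :: real and P :: "nat \<Rightarrow> real poly" and h :: "nat \<Rightarrow> real"
  assumes "monic_orthogonal_polys t P"
    and "\<And>n. h n = sq_norm t (P n)"
  shows "(\<lambda>n::nat. ln (h n) -
     (real n * ln (real n) / 3
      - 1 / 3 * (1 + ln 60) * real n
      + 2 * real n powr (1/3) * t / root 3 60
      + ln (real n) / 6
      + ln (2 * pi)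
      - ln 60 / 6
      + t ^ 2 / (3 * root 3 450 * real n powr (1/3))
      + t / (3 * root 3 60 * real n powr (2/3))
      - 1 / (36 * real n)
      - t ^ 2 / (18 * root 3 450 * real n powr (4/3))
      - t ^ 4 / (1215 * root 3 60 * real n powr (5/3))))
    \<in> O[at_top](\<lambda>n. 1 / real n ^ 2)"
proof -
  define c where "c = root 3 60"
  define \<tau> where "\<tau> = 2 * t / root 3 60"
  have c: "c > 0" by (simp add: c_def)
  have tc: "t = c * \<tau> / 2" by (simp add: \<tau>_def c_def)
  have h: "h n = H t n" for n
    using assms by (simp add: monic_orthogonal_polys_imp sq_norm_def H_def lin_def power2_eq_square)
  have c3: "c ^ 3 = 60" by (simp add: c_def)
  \<comment> \<open>Since 450 = 60^2 / 8, the second cube root of the statement is expressed through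
    the first.\<close>
  have r450: "root 3 450 = c\<^sup>2 / 2"
  proof (rule real_root_pos_unique)
    have "(c\<^sup>2 / 2) ^ 3 = (c ^ 3)\<^sup>2 / 8" by (simp add: power_divide flip: power_mult)
    then show "(c\<^sup>2 / 2) ^ 3 = 450" by (simp add: c3)
  qed simp_all
  have "Lf t x = x * ln x / 3 - 1 / 3 * (1 + ln 60) * x + 2 * x powr (1/3) * t / root 3 60 + ln x / 6
      + ln (2 * pi) - ln 60 / 6 + t ^ 2 / (3 * root 3 450 * x powr (1/3)) + t / (3 * root 3 60 * x powr (2/3))
      - 1 / (36 * x) - t ^ 2 / (18 * root 3 450 * x powr (4/3)) - t ^ 4 / (1215 * root 3 60 * x powr (5/3))" for x
  proof -
    have neg: "x powr (-1/3) = 1 / x powr (1/3)" "x powr (-2/3) = 1 / x powr (2/3)"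
      "x powr (-4/3) = 1 / x powr (4/3)" "x powr (-5/3) = 1 / x powr (5/3)"
      using powr_minus_divide[of x "1/3"] powr_minus_divide[of x "2/3"]
        powr_minus_divide[of x "4/3"] powr_minus_divide[of x "5/3"] by simp_all
    have "2 * x powr (1/3) * t / c = \<tau> * x powr (1/3)"
      using c by (simp add: tc)
    moreover have "t ^ 2 / (3 * (c\<^sup>2 / 2) * y) = \<tau>\<^sup>2 / 6 * (1 / y)" for y
      using c by (simp add: tc power_divide power_mult_distrib)
    moreover have "t ^ 2 / (18 * (c\<^sup>2 / 2) * y) = \<tau>\<^sup>2 / 36 * (1 / y)" for y
      using c by (simp add: tc power_divide power_mult_distrib)
    moreover have "t / (3 * c * y) = \<tau> / 6 * (1 / y)" for y
      using c by (simp add: tc)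
    moreover have "t ^ 4 / (1215 * c * y) = \<tau> ^ 4 / 324 * (1 / y)" for y
    proof -
      \<comment> \<open>With c^3 = 60 the factor is 60 / 16 = 15/4, and 324 * 15/4 = 1215.\<close>
      have "t ^ 4 = c * (c ^ 3 * \<tau> ^ 4 / 16)"
        by (simp add: tc power_divide power_mult_distrib power4_eq_xxxx power3_eq_cube)
      then have t4: "t ^ 4 = c * (15/4 * \<tau> ^ 4)" by (simp add: c3)
      show ?thesis unfolding t4 using c by simp
    qed
    ultimately show ?thesis
      unfolding Lf_def \<tau>_def[symmetric] unfolding neg c_def[symmetric] r450 by simp
  qed
  then show ?thesis
    using ln_H_expansion[of t] unfolding h by simp
qed

end
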